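(* Let $\mathcal P$ be a Poisson point process of intensity $1$ on $\mathbb{R}_+^2$, with associated process $\{W(a)=(U(a),V(a)):a>0\}$ of vertices of its left-lower convex hull. Let $a_0=1$, let $a_1<a_2<\dots$ be the successive jump times of the process $\{W(a):a\ge 1\}$, let $D_0$ be the area of the isosceles triangle $T_0$ with apex at the origin, two equal sides along the $x$- and $y$-axis, and base running through $W(1)$ (that is, base on the line $x+y=U(1)+V(1)$), and, for $i\ge1$, let $D_i$ be the area of the triangle $T_i$ with top at $W(a_{i-1})$, base along the $x$-axis, and other two sides along the lines $x+a_{i-1}y=U(a_{i-1})+a_{i-1}V(a_{i-1})$ and $x+a_iy=U(a_i)+a_iV(a_i)$. Then: (i) The areas $D_0,D_1,D_2,\dots$ form an i.i.d. sequence of standard exponential random variables. (ii) For $i\ge 1$, let $S_i$ be the length of the line segment connecting $W(a_{i-1})$ and $W(a_i)$, and let $L_i$ be the length of the segment obtained by extending the line segment from $W(a_{i-1})$ to $W(a_i)$ (beyond $W(a_i)$) until it crosses the $x$-axis. Then the random variables $S_i^2/L_i^2$, $i=1,2,\dots$, form an i.i.d. sequence of Uniform$(0,1)$ random variables, independent of $W(1)$. Moreover, the $S_i^2/L_i^2$ are independent of the sequence $D_0,D_1,\dots$.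
   Context: $\mathcal P$ is the Poisson point process with intensity $1$ (with respect to Lebesgue measure) on the first quadrant $\mathbb{R}_+^2$. For each $a>0$, $W(a)=(U(a),V(a))$ is the point of the realization of $\mathcal P$ such that all points of the realization lie (weakly) to the right of the line of the form $x+ay=c$ which passes through $W(a)$. If there are several such points (which has probability zero for fixed $a$), $U(a)$ is defined as the supremum of the $x$-coordinates, and $V(a)$ as the infimum of the $y$-coordinates, of points of this type. Thus $a\mapsto W(a)$ is a pure jump process running through the vertices of the left-lower convex hull of $\mathcal P$. *)

theory Defs
  imports "HOL-Probability.Probability"
begin

text \<open>
  A Poisson process as a random locally finite set of points. Representing it by a set rather
  than a counting measure fits diffuse intensities such as Lebesgue measure, for which multiple
  points almost surely do not occur. The Poisson probabilities are written out because the
  library's \<open>poisson_pmf\<close> is only specified for a positive rate, whereas null sets have rate 0.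
  Independence for finite families of disjoint sets is the case in which all but finitely many
  of the sets are empty.
\<close>

locale poisson_process = prob_space M
  for M :: "'w measure" +
  fixes \<mu> :: "'a::metric_space measure" and \<Xi> :: "'w \<Rightarrow> 'a set"
  assumes intensity_finite: "A \<in> sets \<mu> \<Longrightarrow> bounded A \<Longrightarrow> emeasure \<mu> A < \<infinity>"
    and points_in_space: "\<omega> \<in> space M \<Longrightarrow> \<Xi> \<omega> \<subseteq> space \<mu>"
    and locally_finite: "\<omega> \<in> space M \<Longrightarrow> bounded A \<Longrightarrow> finite (\<Xi> \<omega> \<inter> A)"
    and count_measurable: "A \<in> sets \<mu> \<Longrightarrow> bounded A \<Longrightarrow>
      (\<lambda>\<omega>. card (\<Xi> \<omega> \<inter> A)) \<in> measurable M (count_space UNIV)"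
    and count_poisson: "A \<in> sets \<mu> \<Longrightarrow> bounded A \<Longrightarrow>
      prob {\<omega> \<in> space M. card (\<Xi> \<omega> \<inter> A) = k} = measure \<mu> A ^ k / fact k * exp (- measure \<mu> A)"
    and count_indep: "(\<And>i::nat. B i \<in> sets \<mu> \<and> bounded (B i)) \<Longrightarrow> disjoint_family B \<Longrightarrow>
      indep_vars (\<lambda>_. count_space UNIV) (\<lambda>i \<omega>. card (\<Xi> \<omega> \<inter> B i)) UNIV"

abbreviation quadrant :: "(real \<times> real) set" where
  "quadrant \<equiv> {0..} \<times> {0..}"

text \<open>
  The library's \<open>indep_var\<close> requires both random variables to have the same value type.
\<close>

definition indep_rv ::
  "'w measure \<Rightarrow> 'a measure \<Rightarrow> ('w \<Rightarrow> 'a) \<Rightarrow> 'b measure \<Rightarrow> ('w \<Rightarrow> 'b) \<Rightarrow> bool" where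
  "indep_rv M N X K Y \<longleftrightarrow> X \<in> measurable M N \<and> Y \<in> measurable M K \<and>
     prob_space.indep_set M {X -` A \<inter> space M | A. A \<in> sets N} {Y -` B \<inter> space M | B. B \<in> sets K}"

text \<open>The following notions are defined for a fixed realization \<open>X\<close> of the point process.\<close>

definition extreme_points :: "(real \<times> real) set \<Rightarrow> real \<Rightarrow> (real \<times> real) set" where
  "extreme_points X a = {p \<in> X. \<forall>q\<in>X. fst p + a * snd p \<le> fst q + a * snd q}"

definition hull_U :: "(real \<times> real) set \<Rightarrow> real \<Rightarrow> real" where
  "hull_U X a = (SUP p\<in>extreme_points X a. fst p)"

definition hull_V :: "(real \<times> real) set \<Rightarrow> real \<Rightarrow> real" where
  "hull_V X a = (INF p\<in>extreme_points X a. snd p)"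

definition hull_W :: "(real \<times> real) set \<Rightarrow> real \<Rightarrow> real \<times> real" where
  "hull_W X a = (hull_U X a, hull_V X a)"

definition jumps_from_1 :: "(real \<Rightarrow> 'b::topological_space) \<Rightarrow> real set" where
  "jumps_from_1 w = {t \<in> {1..}. \<not> continuous (at t within {1..}) w}"

text \<open>
  If there is no further jump (a null event for the Poisson process), the sequence of jump times
  is continued as a constant.
\<close>

primrec jump_time :: "(real \<Rightarrow> 'b::topological_space) \<Rightarrow> nat \<Rightarrow> real" where
  "jump_time w 0 = 1"
| "jump_time w (Suc i) =
     (let J = {t \<in> jumps_from_1 w. jump_time w i < t}
      in if J = {} then jump_time w i else Inf J)"

abbreviation hull_a :: "(real \<times> real) set \<Rightarrow> nat \<Rightarrow> real" where
  "hull_a X \<equiv> jump_time (hull_W X)"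

text \<open>
  The line \<open>x + a y = U(a) + a V(a)\<close> through \<open>W(a)\<close> meets the \<open>x\<close>-axis at abscissa
  \<open>U(a) + a V(a)\<close>.
\<close>

definition line_level :: "(real \<times> real) set \<Rightarrow> real \<Rightarrow> real" where
  "line_level X a = hull_U X a + a * hull_V X a"

fun triangle :: "(real \<times> real) set \<Rightarrow> nat \<Rightarrow> (real \<times> real) set" where
  "triangle X 0 = convex hull {(0, 0), (line_level X 1, 0), (0, line_level X 1)}"
| "triangle X (Suc i) = convex hull
     {hull_W X (hull_a X i), (line_level X (hull_a X i), 0), (line_level X (hull_a X (Suc i)), 0)}"

definition triangle_area :: "(real \<times> real) set \<Rightarrow> nat \<Rightarrow> real" where
  "triangle_area X i = measure lborel (triangle X i)"

text \<open>The point at which the segment from \<open>p\<close> to \<open>q\<close>, extended beyond \<open>q\<close>, reaches the \<open>x\<close>-axis.\<close>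

definition x_axis_crossing :: "real \<times> real \<Rightarrow> real \<times> real \<Rightarrow> real \<times> real" where
  "x_axis_crossing p q = (THE r. snd r = 0 \<and> (\<exists>t\<ge>1. r = p + t *\<^sub>R (q - p)))"

text \<open>The lengths \<open>S\<^sub>i\<close> and \<open>L\<^sub>i\<close> are meaningful for \<open>i \<ge> 1\<close> only.\<close>

definition edge_length :: "(real \<times> real) set \<Rightarrow> nat \<Rightarrow> real" where
  "edge_length X i = dist (hull_W X (hull_a X (i - 1))) (hull_W X (hull_a X i))"

definition extended_length :: "(real \<times> real) set \<Rightarrow> nat \<Rightarrow> real" where
  "extended_length X i =
     (let p = hull_W X (hull_a X (i - 1)); q = hull_W X (hull_a X i)
      in dist p (x_axis_crossing p q))"

definition length_ratio :: "(real \<times> real) set \<Rightarrow> nat \<Rightarrow> real" where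
  "length_ratio X i = (edge_length X i)\<^sup>2 / (extended_length X i)\<^sup>2"

end

theory Submission
  imports Defs
begin

text \<open>
  The hull is explored vertex by vertex. After reaching the vertex \<open>p = (u, v)\<close> in direction \<open>a\<close>, the
  next vertex is the point first hit when the supporting line \<open>x + a y = u + a v\<close> is rotated about
  \<open>p\<close>. In the coordinates formed by the area \<open>d\<close> swept out by the line and the squared ratio
  \<open>r = ((v - y) / v)\<^sup>2\<close>, which take Lebesgue measure on the swept region to Lebesgue measure on
  \<open>{0<..} \<times> {0<..1}\<close>, the first point met is the leftmost point of a Poisson process on a strip of
  width 1. Hence \<open>d\<close> is standard exponential, \<open>r\<close> is uniform, and they are independent.

  Exploring \<open>p\<close> does not look at the region beyond the supporting line, so the points there are still
  Poisson given the past, and every step has this law independently of all earlier ones. This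
  strong Markov property is obtained by approximating the unexplored region from inside by countably
  many fixed regions. On each of these the points may be replaced by those of an independent
  copy of the process, and the resulting identity on the product space is preserved in the limit.
\<close>

section \<open>Vertices of the hull of a fixed configuration\<close>

text \<open>Both coordinates of a mark come from one integral. At depth \<open>v - y\<close> below
  the vertex, the lines of directions \<open>a\<close> and \<open>b\<close> through it are
  \<open>(b - a) (v - y)\<close> apart. Integrating over \<open>0 <= y < v\<close> gives the swept
  area \<open>v^2 (b - a) / 2\<close>; since the width is linear in the depth, it is the square of
  the relative depth that is uniform over the sweep.

  The law of a mark is not obtained by transporting the point process. Only counts in cells, the
  preimages of rectangles, are used: they give lower bounds for two complementary ranges of
  \<open>r\<close>, a void probability gives an upper bound for the union, and the bounds add up, so
  both are equalities.

  Configurations are bare sets without a sigma-algebra of their own, so measurability of the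
  vertices has to be derived from counts in countably many dyadic squares.

  The zeroth mark is the whole vertex W(1), not just the area \<open>D_0\<close>. Independence of
  the marks, with the product form of their laws, therefore yields all the independence claims,
  while the law of \<open>D_0\<close> is the void probability of a corner triangle.\<close>

definition config :: "(real \<times> real) set \<Rightarrow> bool" where
  "config Y \<longleftrightarrow> Y \<subseteq> quadrant \<and> (\<forall>A. bounded A \<longrightarrow> finite (Y \<inter> A))"

definition lvl :: "real \<Rightarrow> real \<times> real \<Rightarrow> real" where
  "lvl a q = fst q + a * snd q"

text \<open>The tie rule agrees with the supremum and infimum in \<^const>\<open>hull_U\<close> and \<^const>\<open>hull_V\<close>.\<close>

definition is_W :: "(real \<times> real) set \<Rightarrow> real \<Rightarrow> real \<times> real \<Rightarrow> bool" where
  "is_W Y a p \<longleftrightarrow> p \<in> Y \<and>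
     (\<forall>q\<in>Y. lvl a p < lvl a q \<or> lvl a p = lvl a q \<and> snd p \<le> snd q)"

text \<open>This is the direction \<open>a\<close> for which \<open>p\<close> and \<open>q\<close>
  lie on a common line \<open>x + a y = c\<close>.\<close>

definition slope :: "real \<times> real \<Rightarrow> real \<times> real \<Rightarrow> real" where
  "slope p q = (fst q - fst p) / (snd p - snd q)"

text \<open>Among collinear candidates the lowest is taken, because the hull process passes to the
  far end of an edge in a single jump.\<close>

definition is_next :: "(real \<times> real) set \<Rightarrow> real \<times> real \<Rightarrow> real \<times> real \<Rightarrow> bool" where
  "is_next Y p q \<longleftrightarrow> q \<in> Y \<and> snd q < snd p \<and>
     (\<forall>q'\<in>Y. snd q' < snd p \<longrightarrow>
        slope p q < slope p q' \<or> slope p q = slope p q' \<and> snd q \<le> snd q')"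

definition hull_pt :: "(real \<times> real) set \<Rightarrow> nat \<Rightarrow> real \<times> real" where
  "hull_pt Y n = hull_W Y (hull_a Y n)"

lemma is_W_le: "is_W Y a p \<Longrightarrow> q \<in> Y \<Longrightarrow> lvl a p \<le> lvl a q"
  unfolding is_W_def using less_imp_le by fastforce

lemma is_W_tie: "is_W Y a p \<Longrightarrow> q \<in> Y \<Longrightarrow> lvl a q = lvl a p \<Longrightarrow> snd p \<le> snd q"
  unfolding is_W_def by fastforce

lemma config_nonneg: "config Y \<Longrightarrow> q \<in> Y \<Longrightarrow> 0 \<le> fst q" "config Y \<Longrightarrow> q \<in> Y \<Longrightarrow> 0 \<le> snd q"
  unfolding config_def by (metis mem_Times_iff subset_iff atLeast_iff)+

lemma config_subset: "config Y \<Longrightarrow> Z \<subseteq> Y \<Longrightarrow> config Z"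
  unfolding config_def by (meson Int_mono finite_subset order.refl order.trans)

lemma config_finite_box:
  assumes "config Y" "\<And>q. q \<in> S \<Longrightarrow> q \<in> Y \<and> fst q \<le> b \<and> snd q \<le> c"
  shows "finite S"
proof -
  have "bounded ({0..b} \<times> {0..c})"
    by (intro bounded_Times) auto
  then have "finite (Y \<inter> ({0..b} \<times> {0..c}))"
    using assms(1) unfolding config_def by blast
  moreover have "S \<subseteq> Y \<inter> ({0..b} \<times> {0..c})"
  proof
    fix q assume "q \<in> S"
    then have "q \<in> Y" "fst q \<le> b" "snd q \<le> c" using assms(2) by auto
    then show "q \<in> Y \<inter> ({0..b} \<times> {0..c})"
      using config_nonneg[OF assms(1)] by (simp add: mem_Times_iff)
  qed
  ultimately show ?thesis by (rule finite_subset[rotated])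
qed

lemma finite_lex_min:
  fixes f g :: "'a \<Rightarrow> real"
  assumes "finite S" "S \<noteq> {}"
  obtains q where "q \<in> S" "\<And>q'. q' \<in> S \<Longrightarrow> f q < f q' \<or> f q = f q' \<and> g q \<le> g q'"
proof -
  obtain m where m: "m \<in> S" "\<And>x. x \<in> S \<Longrightarrow> f m \<le> f x"
    using arg_min_if_finite(1)[OF assms, of f] arg_min_least[OF assms, of _ f] by blast
  let ?T = "{x \<in> S. f x = f m}"
  have T: "finite ?T" "?T \<noteq> {}" using assms m by auto
  obtain q where q: "q \<in> ?T" "\<And>x. x \<in> ?T \<Longrightarrow> g q \<le> g x"
    using arg_min_if_finite(1)[OF T, of g] arg_min_least[OF T, of _ g] by blast
  show ?thesis
  proof (rule that[of q])
    show "q \<in> S" using q by auto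
    fix q' assume "q' \<in> S"
    then show "f q < f q' \<or> f q = f q' \<and> g q \<le> g q'"
      using q m by (cases "f q' = f m") (auto simp: less_le)
  qed
qed

text \<open>A line of positive direction cuts a bounded triangle off the quadrant, so only finitely
  many points compete for the minimum.\<close>

lemma ex_is_W:
  assumes "config Y" "Y \<noteq> {}" "0 < a"
  shows "\<exists>p. is_W Y a p"
proof -
  obtain q0 where q0: "q0 \<in> Y" using assms by auto
  let ?S = "{q \<in> Y. lvl a q \<le> lvl a q0}"
  have "finite ?S"
  proof (rule config_finite_box[OF assms(1), of _ "lvl a q0" "lvl a q0 / a"])
    fix q assume "q \<in> ?S"
    then have q: "q \<in> Y" "lvl a q \<le> lvl a q0" by auto
    have "0 \<le> fst q" "0 \<le> snd q" using config_nonneg[OF assms(1) q(1)] .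
    moreover have "0 \<le> a * snd q" using \<open>0 \<le> snd q\<close> assms by simp
    ultimately have "fst q \<le> lvl a q" "a * snd q \<le> lvl a q" unfolding lvl_def by auto
    then show "q \<in> Y \<and> fst q \<le> lvl a q0 \<and> snd q \<le> lvl a q0 / a"
      using q assms(3) by (simp add: pos_le_divide_eq mult.commute)
  qed
  then obtain p where p: "p \<in> ?S" and
    min: "\<And>q. q \<in> ?S \<Longrightarrow> lvl a p < lvl a q \<or> lvl a p = lvl a q \<and> snd p \<le> snd q"
    using q0 finite_lex_min[of ?S "lvl a" snd] by blast
  have "lvl a p < lvl a q \<or> lvl a p = lvl a q \<and> snd p \<le> snd q" if "q \<in> Y" for q
  proof (cases "lvl a q \<le> lvl a q0")
    case True then show ?thesis using min that by auto
  next
    case False then show ?thesis using p by auto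
  qed
  then show ?thesis using p unfolding is_W_def by blast
qed

lemma hull_W_eqI:
  assumes "is_W Y a p" "0 < a"
  shows "hull_W Y a = p"
proof -
  have E: "extreme_points Y a = {q \<in> Y. lvl a q = lvl a p}" (is "_ = ?E")
  proof (intro equalityI subsetI)
    fix q assume "q \<in> extreme_points Y a"
    then have "q \<in> Y" "lvl a q \<le> lvl a p"
      using assms(1) unfolding extreme_points_def is_W_def lvl_def[symmetric] by auto
    then show "q \<in> ?E" using is_W_le[OF assms(1)] by (simp add: order_antisym)
  next
    fix q assume "q \<in> ?E"
    then show "q \<in> extreme_points Y a"
      using is_W_le[OF assms(1)] unfolding extreme_points_def lvl_def[symmetric] by simp
  qed
  have p: "p \<in> ?E" using assms(1) by (auto simp: is_W_def)
  have snd_le: "snd p \<le> snd q" if "q \<in> ?E" for q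
    using that is_W_tie[OF assms(1)] by simp
  have fst_le: "fst q \<le> fst p" if "q \<in> ?E" for q
  proof -
    have "a * snd p \<le> a * snd q" using snd_le[OF that] assms(2) by simp
    then show ?thesis using that by (simp add: lvl_def)
  qed
  have "hull_U Y a = fst p"
    unfolding hull_U_def E using p fst_le by (intro cSup_eq_maximum) auto
  moreover have "hull_V Y a = snd p"
    unfolding hull_V_def E using p snd_le by (intro cInf_eq_minimum) auto
  ultimately show ?thesis by (simp add: hull_W_def)
qed

lemma is_W_hull_W:
  assumes "config Y" "Y \<noteq> {}" "0 < a"
  shows "is_W Y a (hull_W Y a)"
  using ex_is_W[OF assms] hull_W_eqI assms(3) by metis

lemma ex_is_next:
  assumes "config Y" "q0 \<in> Y" "snd q0 < snd p"
  shows "\<exists>q. is_next Y p q"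
proof -
  let ?S = "{q \<in> Y. snd q < snd p \<and> slope p q \<le> slope p q0}"
  have "finite ?S"
  \<comment> \<open>A point below \<open>p\<close> lies at most \<open>snd p\<close> below it, so a
    bound on the slope bounds the abscissa. Slopes may be negative here, as \<open>p\<close> need
    not be a vertex; hence the absolute value.\<close>
  proof (rule config_finite_box[OF assms(1), of _ "fst p + \<bar>slope p q0\<bar> * snd p" "snd p"])
    fix q assume "q \<in> ?S"
    then have q: "q \<in> Y" "snd q < snd p" "slope p q \<le> slope p q0" by auto
    have "0 \<le> fst q" "0 \<le> snd q" using config_nonneg[OF assms(1) q(1)] .
    have "slope p q \<le> \<bar>slope p q0\<bar>" using q by linarith
    then have "fst q - fst p \<le> \<bar>slope p q0\<bar> * (snd p - snd q)"
      using q(2) unfolding slope_def by (simp add: pos_divide_le_eq)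
    also have "\<dots> \<le> \<bar>slope p q0\<bar> * snd p"
      using \<open>0 \<le> snd q\<close> by (intro mult_left_mono) auto
    finally show "q \<in> Y \<and> fst q \<le> fst p + \<bar>slope p q0\<bar> * snd p \<and> snd q \<le> snd p"
      using q by simp
  qed
  then obtain r where r: "r \<in> ?S" and
    min: "\<And>q. q \<in> ?S \<Longrightarrow> slope p r < slope p q \<or> slope p r = slope p q \<and> snd r \<le> snd q"
    using assms finite_lex_min[of ?S "slope p" snd] by blast
  have "slope p r < slope p q \<or> slope p r = slope p q \<and> snd r \<le> snd q"
    if "q \<in> Y" "snd q < snd p" for q
  proof (cases "slope p q \<le> slope p q0")
    case True then show ?thesis using min that by auto
  next
    case False then show ?thesis using r by auto
  qed
  then show ?thesis using r unfolding is_next_def by blast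
qed

lemma ex_is_next_iff:
  "config Y \<Longrightarrow> (\<exists>q. is_next Y p q) \<longleftrightarrow> (\<exists>q\<in>Y. snd q < snd p)"
  using ex_is_next is_next_def by metis

lemma slope_eqD: "snd q < snd p \<Longrightarrow> fst q = fst p + slope p q * (snd p - snd q)"
  unfolding slope_def by simp

lemma slope_less_iff: "snd q < snd p \<Longrightarrow> b < slope p q \<longleftrightarrow> lvl b p < lvl b q"
  unfolding slope_def lvl_def by (auto simp: pos_less_divide_eq algebra_simps)

lemma lvl_slope: "snd q < snd p \<Longrightarrow> lvl (slope p q) q = lvl (slope p q) p"
  unfolding lvl_def by (subst slope_eqD) (auto simp: algebra_simps)

lemma is_next_unique: "is_next Y p q \<Longrightarrow> is_next Y p q' \<Longrightarrow> q = q'"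
  unfolding is_next_def by (intro prod_eqI) (force simp: slope_eqD)+

text \<open>Turning the line adds \<open>(b - a) * snd\<close> to every level, which is at least as
  much for the higher point.\<close>

lemma lvl_mono_above:
  assumes "lvl a p \<le> lvl a q" "snd p \<le> snd q" "a \<le> b"
  shows "lvl b p \<le> lvl b q"
proof -
  have "a * (snd q - snd p) \<le> b * (snd q - snd p)"
    using assms by (intro mult_right_mono) auto
  then show ?thesis using assms(1) unfolding lvl_def by (simp add: algebra_simps)
qed

text \<open>Points at the height of \<open>p\<close> or above cannot overtake it as the direction
  grows, so only lower points are constrained.\<close>

lemma is_W_later:
  assumes "is_W Y a p" "a \<le> b" "\<And>q. q \<in> Y \<Longrightarrow> snd q < snd p \<Longrightarrow> b < slope p q"
  shows "is_W Y b p"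
  unfolding is_W_def
proof (intro conjI ballI)
  show "p \<in> Y" using assms(1) by (simp add: is_W_def)
  fix q assume q: "q \<in> Y"
  show "lvl b p < lvl b q \<or> lvl b p = lvl b q \<and> snd p \<le> snd q"
  proof (cases "snd q < snd p")
    case True then show ?thesis using assms(3)[OF q] slope_less_iff by blast
  next
    case False
    have "lvl a p \<le> lvl a q" by (rule is_W_le[OF assms(1) q])
    then have "lvl b p \<le> lvl b q" using False assms(2) \<open>lvl a p \<le> lvl a q\<close> by (simp add: lvl_mono_above)
    then show ?thesis using False by auto
  qed
qed

text \<open>Strictness comes from the tie rule: a lower point on the supporting line itself would
  have been chosen instead of \<open>p\<close>.\<close>

lemma is_W_less_slope:
  assumes "is_W Y a p" "q \<in> Y" "snd q < snd p"
  shows "a < slope p q"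
  using is_W_le[OF assms(1,2)] is_W_tie[OF assms(1,2)] assms(3) slope_less_iff[OF assms(3), of a]
  by force

text \<open>In the new direction \<open>p\<close> and \<open>q\<close> share a supporting line, and
  the tie rule of \<open>is_next\<close> makes \<open>q\<close> its lowest point.\<close>

lemma is_W_next:
  assumes W: "is_W Y a p" and n: "is_next Y p q"
  shows "is_W Y (slope p q) q"
  unfolding is_W_def
proof (intro conjI ballI)
  show "q \<in> Y" using n by (simp add: is_next_def)
  have q: "snd q < snd p" using n by (simp add: is_next_def)
  have a: "a < slope p q" using W n q by (auto simp: is_next_def intro: is_W_less_slope)
  fix r assume r: "r \<in> Y"
  show "lvl (slope p q) q < lvl (slope p q) r \<or> lvl (slope p q) q = lvl (slope p q) r \<and> snd q \<le> snd r"
  proof (cases "snd r < snd p")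
    case True
    then consider "slope p q < slope p r" | "slope p q = slope p r" "snd q \<le> snd r"
      using n r unfolding is_next_def by auto
    then show ?thesis
    proof cases
      case 1 then show ?thesis using slope_less_iff[OF True] lvl_slope[OF q] by auto
    next
      case 2 then show ?thesis using lvl_slope[OF q] lvl_slope[OF True] by auto
    qed
  next
    case False
    have "lvl a p \<le> lvl a r" by (rule is_W_le[OF W r])
    then have "lvl (slope p q) p \<le> lvl (slope p q) r"
      using False a \<open>lvl a p \<le> lvl a r\<close> lvl_mono_above[of a p r] by simp
    then show ?thesis using False q lvl_slope[OF q] by auto
  qed
qed

section \<open>Jumps of the vertex process\<close>

lemma hull_W_empty: "hull_W {} a = hull_W {} b"
  by (simp add: hull_W_def hull_U_def hull_V_def extreme_points_def)

lemma not_jump_if_constant: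
  fixes w :: "real \<Rightarrow> 'b::topological_space"
  assumes "\<And>b. a \<le> b \<Longrightarrow> b < c \<Longrightarrow> w b = p" "a < t" "t < c"
  shows "t \<notin> jumps_from_1 w"
proof -
  have "eventually (\<lambda>b. b \<in> {a<..<c}) (at t within {1..})"
    using assms(2,3) by (intro eventually_at_topological[THEN iffD2]) (metis greaterThanLessThan_iff open_greaterThanLessThan)
  then have "eventually (\<lambda>b. w b = p) (at t within {1..})"
    by eventually_elim (use assms(1) in auto)
  then have "(w \<longlongrightarrow> p) (at t within {1..})"
    by (rule tendsto_eventually)
  then have "continuous (at t within {1..}) w"
    using assms by (simp add: continuous_within)
  then show ?thesis by (simp add: jumps_from_1_def)
qed

text \<open>The left limit at \<open>c\<close> is \<open>p\<close>, whereas the value there is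
  not.\<close>

lemma jump_if_changes:
  fixes w :: "real \<Rightarrow> 'b::t2_space"
  assumes "\<And>b. a \<le> b \<Longrightarrow> b < c \<Longrightarrow> w b = p" "1 \<le> a" "a < c" "w c \<noteq> p"
  shows "c \<in> jumps_from_1 w"
proof -
  have "\<not> continuous (at c within {1..}) w"
  proof
    assume "continuous (at c within {1..}) w"
    then have "(w \<longlongrightarrow> w c) (at c within {a..<c})"
      unfolding continuous_within by (rule tendsto_within_subset) (use assms in auto)
    moreover have "eventually (\<lambda>b. w b = p) (at c within {a..<c})"
      unfolding eventually_at_filter using assms(1) by (intro always_eventually) auto
    then have "(w \<longlongrightarrow> p) (at c within {a..<c})"
      by (rule tendsto_eventually)
    moreover have "at c within {a..<c} \<noteq> bot"
      using assms(3) by (simp add: trivial_limit_within islimpt_Ico)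
    ultimately show False using tendsto_unique assms(4) by blast
  qed
  then show ?thesis using assms by (simp add: jumps_from_1_def)
qed

lemma jump_time_Suc_constant:
  assumes "\<And>b. jump_time w n \<le> b \<Longrightarrow> w b = p"
  shows "jump_time w (Suc n) = jump_time w n"
proof -
  have "{t \<in> jumps_from_1 w. jump_time w n < t} = {}"
    using not_jump_if_constant[of "jump_time w n" _ w p] assms gt_ex by blast
  then show ?thesis by (simp add: Let_def)
qed

lemma jump_time_Suc_changes:
  fixes w :: "real \<Rightarrow> 'b::t2_space"
  assumes "\<And>b. jump_time w n \<le> b \<Longrightarrow> b < c \<Longrightarrow> w b = p" "1 \<le> jump_time w n" "jump_time w n < c"
    "w c \<noteq> p"
  shows "jump_time w (Suc n) = c"
proof -
  let ?J = "{t \<in> jumps_from_1 w. jump_time w n < t}"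
  have c: "c \<in> ?J" using jump_if_changes[of "jump_time w n" c w p] assms by auto
  have "Inf ?J = c"
  proof (rule cInf_eq_minimum[OF c])
    fix t assume t: "t \<in> ?J"
    show "c \<le> t"
      using not_jump_if_constant[of "jump_time w n" c w p t] assms(1) t by force
  qed
  then show ?thesis using c by (auto simp: Let_def)
qed

text \<open>This replaces jump times, defined by discontinuity, with a recursion on vertices:
  \<open>W\<close> rests at a vertex until the line through it meets the next point, and stays there
  for ever if no lower point is left.\<close>

lemma hull_step:
  assumes "config Y" "1 \<le> hull_a Y n"
  shows "is_next Y (hull_pt Y n) q \<Longrightarrow> hull_pt Y (Suc n) = q \<and> hull_a Y (Suc n) = slope (hull_pt Y n) q"
    and "(\<nexists>q. is_next Y (hull_pt Y n) q) \<Longrightarrow> hull_pt Y (Suc n) = hull_pt Y n \<and> hull_a Y (Suc n) = hull_a Y n"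
proof -
  let ?a = "hull_a Y n" and ?p = "hull_pt Y n"
  {
    assume n: "is_next Y ?p q"
    then have q: "snd q < snd ?p" "q \<in> Y" by (auto simp: is_next_def)
    then have "is_W Y ?a ?p"
      unfolding hull_pt_def using assms by (intro is_W_hull_W) auto
    note W = this
    have less: "?a < slope ?p q" by (rule is_W_less_slope[OF W q(2,1)])
    have "hull_W Y b = ?p" if "?a \<le> b" "b < slope ?p q" for b
    proof (rule hull_W_eqI)
      show "0 < b" using that assms by simp
      show "is_W Y b ?p"
        by (rule is_W_later[OF W that(1)]) (use n that(2) in \<open>force simp: is_next_def\<close>)
    qed
    moreover have *: "hull_W Y (slope ?p q) = q"
      by (rule hull_W_eqI[OF is_W_next[OF W n]]) (use assms less in auto)
    moreover have "q \<noteq> ?p" using q by auto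
    ultimately have "hull_a Y (Suc n) = slope ?p q"
      using assms less by (intro jump_time_Suc_changes[where p = ?p]) auto
    then show "hull_pt Y (Suc n) = q \<and> hull_a Y (Suc n) = slope ?p q"
      using * by (simp add: hull_pt_def del: jump_time.simps)
  next
    assume n: "\<nexists>q. is_next Y ?p q"
    have "hull_W Y b = ?p" if "?a \<le> b" for b
    proof (cases "Y = {}")
      \<comment> \<open>Without points \<open>hull_W\<close> takes an unspecified value, but the
        same one in every direction.\<close>
      case True then show ?thesis by (simp add: hull_pt_def hull_W_empty[of b])
    next
      case False
      then have W: "is_W Y ?a ?p"
        unfolding hull_pt_def using assms by (intro is_W_hull_W) auto
      show ?thesis
        using n ex_is_next_iff[OF assms(1), of ?p] assms that
        by (intro hull_W_eqI is_W_later[OF W]) (blast | simp)+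
    qed
    then have "hull_a Y (Suc n) = hull_a Y n"
      by (rule jump_time_Suc_constant)
    then show "hull_pt Y (Suc n) = ?p \<and> hull_a Y (Suc n) = ?a"
      by (simp add: hull_pt_def del: jump_time.simps)
  }
qed

lemma hull_a_ge_1: "config Y \<Longrightarrow> 1 \<le> hull_a Y n"
proof (induction n)
  case (Suc n)
  show ?case
  proof (cases "\<exists>q. is_next Y (hull_pt Y n) q")
    case True
    then obtain q where q: "is_next Y (hull_pt Y n) q" by auto
    then have "is_W Y (hull_a Y n) (hull_pt Y n)"
      unfolding hull_pt_def using Suc by (intro is_W_hull_W) (auto simp: is_next_def)
    then have "hull_a Y n < slope (hull_pt Y n) q"
      using q by (auto simp: is_next_def intro: is_W_less_slope)
    then show ?thesis using hull_step(1)[OF Suc.prems _ q] Suc by simp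
  next
    case False
    then show ?thesis using hull_step(2)[OF Suc.prems _ False] Suc by simp
  qed
qed simp

lemmas hull_next = hull_step(1)[OF _ hull_a_ge_1]
lemmas hull_no_next = hull_step(2)[OF _ hull_a_ge_1]

lemma is_W_hull_pt: "config Y \<Longrightarrow> Y \<noteq> {} \<Longrightarrow> is_W Y (hull_a Y n) (hull_pt Y n)"
  unfolding hull_pt_def using hull_a_ge_1[of Y n] by (intro is_W_hull_W) auto

lemma hull_a_mono_Suc: "config Y \<Longrightarrow> hull_a Y n \<le> hull_a Y (Suc n)"
proof (cases "\<exists>q. is_next Y (hull_pt Y n) q")
  case True
  assume Y: "config Y"
  obtain q where q: "is_next Y (hull_pt Y n) q" using True by auto
  then have "is_W Y (hull_a Y n) (hull_pt Y n)"
    using Y by (intro is_W_hull_pt) (auto simp: is_next_def)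
  then have "hull_a Y n < slope (hull_pt Y n) q"
    using q by (auto simp: is_next_def intro: is_W_less_slope)
  then show ?thesis using hull_next[OF Y Y q] by simp
next
  case False
  assume Y: "config Y"
  then show ?thesis using hull_no_next[OF Y Y False] by simp
qed

lemma hull_a_mono: "config Y \<Longrightarrow> j \<le> n \<Longrightarrow> hull_a Y j \<le> hull_a Y n"
  by (rule lift_Suc_mono_le[of "hull_a Y"]) (simp_all add: hull_a_mono_Suc del: jump_time.simps)

lemma snd_hull_pt_Suc: "config Y \<Longrightarrow> snd (hull_pt Y (Suc n)) \<le> snd (hull_pt Y n)"
proof (cases "\<exists>q. is_next Y (hull_pt Y n) q")
  case True
  assume Y: "config Y"
  obtain q where q: "is_next Y (hull_pt Y n) q" using True by auto
  then show ?thesis using hull_next[OF Y Y q] by (auto simp: is_next_def)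
next
  case False
  assume Y: "config Y"
  then show ?thesis using hull_no_next[OF Y Y False] by simp
qed

lemma snd_hull_pt_antimono: "config Y \<Longrightarrow> j \<le> n \<Longrightarrow> snd (hull_pt Y n) \<le> snd (hull_pt Y j)"
  by (rule lift_Suc_antimono_le[of "\<lambda>n. snd (hull_pt Y n)"]) (simp_all add: snd_hull_pt_Suc)

text \<open>The next vertex can only lie here, below \<open>p\<close> and strictly beyond the
  supporting line, while none of the earlier choices depended on this region.\<close>

definition unexplored :: "real \<times> real \<Rightarrow> real \<Rightarrow> (real \<times> real) set" where
  "unexplored p a = {q. snd q < snd p \<and> lvl a p < lvl a q}"

text \<open>
  Once the process has stopped jumping, points of the unexplored region would restart it, so that
  the past is insensitive to that region only while every step has found a next vertex.
\<close>

definition alive :: "(real \<times> real) set \<Rightarrow> nat \<Rightarrow> bool" where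
  "alive Y n \<longleftrightarrow> Y \<noteq> {} \<and> (\<forall>j<n. \<exists>q. is_next Y (hull_pt Y j) q)"

lemma alive_Suc: "alive Y (Suc n) \<longleftrightarrow> alive Y n \<and> (\<exists>q. is_next Y (hull_pt Y n) q)"
  by (auto simp: alive_def less_Suc_eq)

text \<open>Going back to the smaller direction of step \<open>j\<close> only increases the excess
  of the lower point \<open>q\<close> over vertex \<open>n\<close>, and in that direction vertex
  \<open>n\<close> is no better than vertex \<open>j\<close>.\<close>

lemma unexplored_above:
  assumes Y: "config Y" "Y \<noteq> {}" and j: "j \<le> n"
    and q: "q \<in> unexplored (hull_pt Y n) (hull_a Y n)"
  shows "lvl (hull_a Y j) (hull_pt Y j) < lvl (hull_a Y j) q"
proof -
  let ?p = "hull_pt Y n" and ?a = "hull_a Y n" and ?b = "hull_a Y j"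
  have p: "?p \<in> Y" using is_W_hull_pt[OF Y, of n] by (simp add: is_W_def)
  have "?b * (snd ?p - snd q) \<le> ?a * (snd ?p - snd q)"
    using q hull_a_mono[OF Y(1) j] by (intro mult_right_mono) (auto simp: unexplored_def)
  then have "lvl ?b ?p < lvl ?b q"
    using q by (simp add: unexplored_def lvl_def algebra_simps)
  moreover have "lvl ?b (hull_pt Y j) \<le> lvl ?b ?p"
    using is_W_hull_pt[OF Y, of j] p by (rule is_W_le)
  ultimately show ?thesis by simp
qed

text \<open>Points of \<open>G\<close> lie beyond every supporting line used so far, so adding or
  deleting them changes neither W(1) nor any choice of a next vertex up to step
  \<open>n\<close>.\<close>

lemma hull_pt_cong_unexplored:
  assumes Y: "config Y" and Y': "config Y'" and n: "alive Y n"
    and G: "G \<subseteq> unexplored (hull_pt Y n) (hull_a Y n)"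
    and diff: "Y - G = Y' - G" and j: "j \<le> n"
  shows "hull_pt Y' j = hull_pt Y j \<and> hull_a Y' j = hull_a Y j"
proof -
  have ne: "Y \<noteq> {}" using n by (simp add: alive_def)
  have mem: "hull_pt Y j \<in> Y'" if "j \<le> n" for j
  proof -
    have "hull_pt Y j \<in> Y" using is_W_hull_pt[OF Y ne] by (simp add: is_W_def)
    \<comment> \<open>Vertices up to \<open>n\<close> are at least as high as vertex
      \<open>n\<close>, whereas \<open>G\<close> lies strictly below it.\<close>
    moreover have "hull_pt Y j \<notin> G"
      using snd_hull_pt_antimono[OF Y that] G by (force simp: unexplored_def)
    ultimately show ?thesis using diff by blast
  qed
  show ?thesis using j
  proof (induction j)
    case 0
    have "is_W Y' 1 (hull_pt Y 0)"
      unfolding is_W_def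
    proof (intro conjI ballI)
      show "hull_pt Y 0 \<in> Y'" by (simp add: mem)
      fix q assume q: "q \<in> Y'"
      show "lvl 1 (hull_pt Y 0) < lvl 1 q \<or> lvl 1 (hull_pt Y 0) = lvl 1 q \<and> snd (hull_pt Y 0) \<le> snd q"
      proof (cases "q \<in> G")
        case True
        then show ?thesis using unexplored_above[OF Y ne, of 0 n q] G by auto
      next
        case False
        then have "q \<in> Y" using q diff by blast
        then show ?thesis using is_W_hull_pt[OF Y ne, of 0] by (simp add: is_W_def)
      qed
    qed
    then show ?case using hull_W_eqI[of Y' 1] by (simp add: hull_pt_def)
  next
    case (Suc j)
    then have IH: "hull_pt Y' j = hull_pt Y j" "hull_a Y' j = hull_a Y j" by auto
    obtain q where q: "is_next Y (hull_pt Y j) q" using n Suc.prems unfolding alive_def by (meson Suc_le_eq)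
    let ?p = "hull_pt Y j"
    have st: "hull_pt Y (Suc j) = q" "hull_a Y (Suc j) = slope ?p q"
      using hull_next[OF Y Y q] by auto
    have "is_next Y' ?p q"
      unfolding is_next_def
    proof (intro conjI ballI impI)
      show "q \<in> Y'" using mem[of "Suc j"] Suc.prems st by simp
      show ql: "snd q < snd ?p" using q by (simp add: is_next_def)
      fix r assume r: "r \<in> Y'" "snd r < snd ?p"
      show "slope ?p q < slope ?p r \<or> slope ?p q = slope ?p r \<and> snd q \<le> snd r"
      proof (cases "r \<in> G")
        case True
        \<comment> \<open>At stage \<open>Suc j\<close> the direction is \<open>slope ?p q\<close>,
          so \<open>r\<close> lies strictly beyond the line through \<open>?p\<close> and
          \<open>q\<close>.\<close>
        then have "lvl (slope ?p q) q < lvl (slope ?p q) r"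
          using unexplored_above[OF Y ne Suc.prems, of r] G st by auto
        then show ?thesis using slope_less_iff[OF r(2)] lvl_slope[OF ql] by auto
      next
        case False
        then have "r \<in> Y" using r diff by blast
        then show ?thesis using q r by (simp add: is_next_def)
      qed
    qed
    then show ?case using hull_next[OF Y' Y', of j q] IH st by simp
  qed
qed

text \<open>The old vertex \<open>Suc j\<close> is still present and strictly below vertex
  \<open>j\<close>, which suffices for a next vertex to exist.\<close>

lemma alive_cong_unexplored:
  assumes "config Y" "config Y'" "alive Y n"
    and "G \<subseteq> unexplored (hull_pt Y n) (hull_a Y n)" "Y - G = Y' - G"
  shows "alive Y' n"
  unfolding alive_def
proof (intro conjI allI impI)
  note st = hull_pt_cong_unexplored[OF assms]
  have ne: "Y \<noteq> {}" using assms by (simp add: alive_def)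
  have mem: "hull_pt Y j \<in> Y'" if "j \<le> n" for j
  proof -
    have "hull_pt Y j \<in> Y" using is_W_hull_pt[OF assms(1) ne] by (simp add: is_W_def)
    moreover have "hull_pt Y j \<notin> G"
      using snd_hull_pt_antimono[OF assms(1) that] assms(4) by (force simp: unexplored_def)
    ultimately show ?thesis using assms(5) by blast
  qed
  show "Y' \<noteq> {}" using mem[of 0] by auto
  fix j assume j: "j < n"
  obtain q where q: "is_next Y (hull_pt Y j) q" using assms(3) j unfolding alive_def by blast
  have "snd (hull_pt Y (Suc j)) < snd (hull_pt Y j)"
    using hull_next[OF assms(1) assms(1) q] q by (simp add: is_next_def)
  then show "\<exists>q. is_next Y' (hull_pt Y' j) q"
    using mem[of "Suc j"] j st[of j] ex_is_next[OF assms(2)] by (metis Suc_leI less_imp_le)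
qed

section \<open>Measurability of functionals of a configuration\<close>

lemma borel_fst [measurable (raw)]:
  "f \<in> borel_measurable L \<Longrightarrow> (\<lambda>x. fst (f x) :: real) \<in> borel_measurable L"
  for f :: "_ \<Rightarrow> real \<times> real"
  by (rule measurable_compose[of f L borel fst]) (auto simp: borel_prod[symmetric])

lemma borel_snd [measurable (raw)]:
  "f \<in> borel_measurable L \<Longrightarrow> (\<lambda>x. snd (f x) :: real) \<in> borel_measurable L"
  for f :: "_ \<Rightarrow> real \<times> real"
  by (rule measurable_compose[of f L borel snd]) (auto simp: borel_prod[symmetric])

section \<open>Dyadic squares, a countable family that isolates points\<close>

definition sq :: "nat \<Rightarrow> int \<Rightarrow> int \<Rightarrow> (real \<times> real) set" where
  "sq k i j = {p. \<lfloor>2 ^ k * fst p\<rfloor> = i \<and> \<lfloor>2 ^ k * snd p\<rfloor> = j}"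

abbreviation sq_at :: "nat \<Rightarrow> real \<times> real \<Rightarrow> (real \<times> real) set" where
  "sq_at k p \<equiv> sq k \<lfloor>2 ^ k * fst p\<rfloor> \<lfloor>2 ^ k * snd p\<rfloor>"

lemma floor_pow2_Suc: "\<lfloor>2 ^ k * x\<rfloor> = \<lfloor>2 ^ Suc k * x\<rfloor> div 2" for x :: real
  using floor_divide_real_eq_div[of 2 "2 ^ Suc k * x"] by simp

lemma sq_at_antimono: "k \<le> l \<Longrightarrow> sq_at l p \<subseteq> sq_at k p"
proof (induction l rule: dec_induct)
  case (step l)
  have "sq_at (Suc l) p \<subseteq> sq_at l p"
    unfolding sq_def using floor_pow2_Suc[of l] by auto
  then show ?case using step by blast
qed simp

lemma sq_atI: "q \<in> sq k i j \<Longrightarrow> sq k i j = sq_at k q"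
  by (simp add: sq_def)

lemma sq_at_subset_open:
  assumes "open U" "p \<in> U"
  shows "\<exists>l\<ge>k. sq_at l p \<subseteq> U"
proof -
  obtain e where e: "e > 0" "ball p e \<subseteq> U" using assms openE by blast
  \<comment> \<open>Half of \<open>e\<close> for each coordinate, since the distance is at most the
    sum of the coordinate differences.\<close>
  obtain n where n: "(1 / 2) ^ n < e / 2"
    using real_arch_pow_inv[of "e / 2" "1 / 2"] e by auto
  let ?l = "max n k"
  have "(1 / 2) ^ ?l \<le> (1 / 2 :: real) ^ n" by (intro power_decreasing) auto
  with n have l: "(1 / 2) ^ ?l < e / 2" by linarith
  have close: "\<bar>x - y\<bar> < (1 / 2) ^ ?l" if "\<lfloor>2 ^ ?l * x\<rfloor> = \<lfloor>2 ^ ?l * y\<rfloor>" for x y :: real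
  proof -
    have "\<bar>2 ^ ?l * x - 2 ^ ?l * y\<bar> < 1" using that by linarith
    then have "2 ^ ?l * \<bar>x - y\<bar> < 1" by (simp add: abs_mult flip: right_diff_distrib)
    then show ?thesis by (simp add: power_one_over field_simps)
  qed
  have "sq_at ?l p \<subseteq> U"
  proof
    fix q assume "q \<in> sq_at ?l p"
    then have "\<bar>fst p - fst q\<bar> < (1 / 2) ^ ?l" "\<bar>snd p - snd q\<bar> < (1 / 2) ^ ?l"
      unfolding sq_def by (auto intro: close)
    moreover have "dist p q \<le> \<bar>fst p - fst q\<bar> + \<bar>snd p - snd q\<bar>"
      using sqrt_sum_squares_le_sum_abs[of "fst p - fst q" "snd p - snd q"]
      by (simp add: dist_prod_def dist_real_def)
    ultimately have "q \<in> ball p e" using l by simp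
    then show "q \<in> U" using e by blast
  qed
  then show ?thesis by (intro exI[of _ ?l]) auto
qed

lemma sets_sq [measurable]: "sq k i j \<in> sets borel"
proof -
  have "{p \<in> space borel. \<lfloor>2 ^ k * fst p\<rfloor> = i \<and> \<lfloor>2 ^ k * snd p\<rfloor> = j} \<in> sets (borel :: (real \<times> real) measure)"
    by measurable
  then show ?thesis by (simp add: sq_def)
qed

lemma bounded_sq: "bounded (sq k i j)"
proof -
  have "sq k i j \<subseteq> {i / 2 ^ k .. (i + 1) / 2 ^ k} \<times> {j / 2 ^ k .. (j + 1) / 2 ^ k}"
  proof
    fix q assume "q \<in> sq k i j"
    then have "i = \<lfloor>2 ^ k * fst q\<rfloor>" "j = \<lfloor>2 ^ k * snd q\<rfloor>" by (auto simp: sq_def)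
    then have "i \<le> 2 ^ k * fst q" "2 ^ k * fst q \<le> i + 1" "j \<le> 2 ^ k * snd q" "2 ^ k * snd q \<le> j + 1"
      by linarith+
    then show "q \<in> {i / 2 ^ k .. (i + 1) / 2 ^ k} \<times> {j / 2 ^ k .. (j + 1) / 2 ^ k}"
      by (simp add: mem_Times_iff field_simps)
  qed
  moreover have "bounded ({i / 2 ^ k .. (i + 1) / 2 ^ k} \<times> {j / 2 ^ k .. (j + 1) / 2 ^ k} :: (real \<times> real) set)"
    by (intro bounded_Times) auto
  ultimately show ?thesis by (rule bounded_subset[rotated])
qed

text \<open>Asking for measurable counts of squares only lets the same results serve the whole
  process on \<open>M\<close> and the points in a region \<open>G\<close> on the smaller algebra
  \<open>config_algebra G\<close>.\<close>

locale measurable_config =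
  fixes K :: "'k measure" and Y :: "'k \<Rightarrow> (real \<times> real) set"
  assumes config: "\<omega> \<in> space K \<Longrightarrow> config (Y \<omega>)"
    and card_sq [measurable]: "(\<lambda>\<omega>. card (Y \<omega> \<inter> sq k i j)) \<in> measurable K (count_space UNIV)"
begin

lemma finite_sq: "\<omega> \<in> space K \<Longrightarrow> finite (Y \<omega> \<inter> sq k i j)"
  using config bounded_sq unfolding config_def by blast

text \<open>Every point of a configuration is alone in some dyadic square, so these countably many
  variables enumerate the random set measurably. Uses of the default are guarded by the condition
  that the count is 1.\<close>

definition lone_point :: "nat \<Rightarrow> int \<Rightarrow> int \<Rightarrow> 'k \<Rightarrow> real \<times> real" where
  "lone_point k i j \<omega> = (if card (Y \<omega> \<inter> sq k i j) = 1 then the_elem (Y \<omega> \<inter> sq k i j) else 0)"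

lemma lone_pointD: "card (Y \<omega> \<inter> sq k i j) = 1 \<Longrightarrow> Y \<omega> \<inter> sq k i j = {lone_point k i j \<omega>}"
proof -
  assume c: "card (Y \<omega> \<inter> sq k i j) = 1"
  then obtain x where "Y \<omega> \<inter> sq k i j = {x}" by (rule card_1_singletonE)
  then show ?thesis by (simp add: lone_point_def)
qed

text \<open>A small square around the point fits into \<open>U\<close> and into the given square, so
  membership is a countable disjunction of count events.\<close>

lemma lone_point_in_open_iff:
  assumes "\<omega> \<in> space K" and c: "card (Y \<omega> \<inter> sq k i j) = 1" and U: "open U"
  shows "lone_point k i j \<omega> \<in> U \<longleftrightarrow>
    (\<exists>l i' j'. sq l i' j' \<subseteq> U \<inter> sq k i j \<and> card (Y \<omega> \<inter> sq l i' j') = 1)"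
proof
  let ?z = "lone_point k i j \<omega>"
  have z: "?z \<in> Y \<omega>" "?z \<in> sq k i j" using lone_pointD[OF c] by auto
  {
    assume "?z \<in> U"
    then obtain l where l: "l \<ge> k" "sq_at l ?z \<subseteq> U" using sq_at_subset_open[OF U] by blast
    have s: "sq_at l ?z \<subseteq> sq k i j"
      using sq_at_antimono[OF l(1), of ?z] sq_atI[OF z(2)] by simp
    have "?z \<in> sq_at l ?z" by (simp add: sq_def)
    with s z lone_pointD[OF c] have "Y \<omega> \<inter> sq_at l ?z = {?z}" by blast
    then have "card (Y \<omega> \<inter> sq_at l ?z) = 1" by simp
    then show "\<exists>l i' j'. sq l i' j' \<subseteq> U \<inter> sq k i j \<and> card (Y \<omega> \<inter> sq l i' j') = 1"
      using l s by blast
  }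
  assume "\<exists>l i' j'. sq l i' j' \<subseteq> U \<inter> sq k i j \<and> card (Y \<omega> \<inter> sq l i' j') = 1"
  then obtain l i' j' where *: "sq l i' j' \<subseteq> U \<inter> sq k i j" "card (Y \<omega> \<inter> sq l i' j') = 1" by blast
  let ?y = "lone_point l i' j' \<omega>"
  have "?y \<in> Y \<omega>" "?y \<in> sq l i' j'" using lone_pointD[OF *(2)] by auto
  then have "?y \<in> {?z}" "?y \<in> U" using *(1) unfolding lone_pointD[OF c, symmetric] by auto
  then show "?z \<in> U" by simp
qed

lemma lone_point_measurable [measurable]: "lone_point k i j \<in> borel_measurable K"
proof (rule borel_measurableI)
  fix U :: "(real \<times> real) set" assume U: "open U"
  have "lone_point k i j -` U \<inter> space K =
    {\<omega> \<in> space K. (card (Y \<omega> \<inter> sq k i j) = 1 \<and>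
        (\<exists>l i' j'. sq l i' j' \<subseteq> U \<inter> sq k i j \<and> card (Y \<omega> \<inter> sq l i' j') = 1)) \<or>
      (card (Y \<omega> \<inter> sq k i j) \<noteq> 1 \<and> 0 \<in> U)}"
  proof (intro set_eqI)
    fix \<omega>
    show "\<omega> \<in> lone_point k i j -` U \<inter> space K \<longleftrightarrow> \<omega> \<in>
      {\<omega> \<in> space K. (card (Y \<omega> \<inter> sq k i j) = 1 \<and>
        (\<exists>l i' j'. sq l i' j' \<subseteq> U \<inter> sq k i j \<and> card (Y \<omega> \<inter> sq l i' j') = 1)) \<or>
      (card (Y \<omega> \<inter> sq k i j) \<noteq> 1 \<and> 0 \<in> U)}"
    proof (cases "\<omega> \<in> space K \<and> card (Y \<omega> \<inter> sq k i j) = 1")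
      case True
      then show ?thesis using lone_point_in_open_iff[OF _ _ U, of \<omega> k i j] by blast
    next
      case False
      then show ?thesis by (auto simp: lone_point_def)
    qed
  qed
  also have "\<dots> \<in> sets K" by measurable
  finally show "lone_point k i j -` U \<inter> space K \<in> sets K" .
qed

text \<open>Local finiteness isolates each point in a small enough square, so a quantifier over
  points becomes a countable one.\<close>

lemma ex_point_iff:
  assumes "\<omega> \<in> space K"
  shows "(\<exists>p\<in>Y \<omega>. \<phi> p) \<longleftrightarrow> (\<exists>k i j. card (Y \<omega> \<inter> sq k i j) = 1 \<and> \<phi> (lone_point k i j \<omega>))"
proof
  assume "\<exists>p\<in>Y \<omega>. \<phi> p"
  then obtain p where p: "p \<in> Y \<omega>" "\<phi> p" by auto
  have "finite (Y \<omega> \<inter> sq_at 0 p)" using finite_sq[OF assms] .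
  \<comment> \<open>Deleting the finitely many other points of the unit square leaves an open
    neighbourhood of \<open>p\<close>.\<close>
  then have "open (- ((Y \<omega> \<inter> sq_at 0 p) - {p}))" by (intro open_Compl finite_imp_closed) auto
  then obtain l where l: "sq_at l p \<subseteq> - ((Y \<omega> \<inter> sq_at 0 p) - {p})"
    using sq_at_subset_open[of _ p 0] by blast
  have "p \<in> sq_at l p" by (simp add: sq_def)
  with l sq_at_antimono[of 0 l p] p have "Y \<omega> \<inter> sq_at l p = {p}" by blast
  then show "\<exists>k i j. card (Y \<omega> \<inter> sq k i j) = 1 \<and> \<phi> (lone_point k i j \<omega>)"
    using p by (intro exI[of _ l] exI[of _ "\<lfloor>2 ^ l * fst p\<rfloor>"] exI[of _ "\<lfloor>2 ^ l * snd p\<rfloor>"])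
      (simp add: lone_point_def)
next
  assume "\<exists>k i j. card (Y \<omega> \<inter> sq k i j) = 1 \<and> \<phi> (lone_point k i j \<omega>)"
  then show "\<exists>p\<in>Y \<omega>. \<phi> p" using lone_pointD by blast
qed

text \<open>The parameter \<open>l\<close> allows quantifiers over points to be nested, as in
  \<open>is_next\<close>: for the inner one it is a pair that contains the outer point.\<close>

lemma ex_point_measurable:
  assumes f [measurable]: "f \<in> measurable L K"
    and \<phi> [measurable]: "Measurable.pred (L \<Otimes>\<^sub>M borel) (\<lambda>x. \<phi> (fst x) (snd x))"
  shows "Measurable.pred L (\<lambda>l. \<exists>p\<in>Y (f l). \<phi> l p)"
proof -
  have "Measurable.pred L (\<lambda>l. \<phi> (fst (l, lone_point k i j (f l))) (snd (l, lone_point k i j (f l))))" for k i j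
    by (rule measurable_compose[OF _ \<phi>]) measurable
  then have [measurable]: "Measurable.pred L (\<lambda>l. \<phi> l (lone_point k i j (f l)))" for k i j
    by simp
  have "Measurable.pred L (\<lambda>l. \<exists>k i j. card (Y (f l) \<inter> sq k i j) = 1 \<and> \<phi> l (lone_point k i j (f l)))"
    by measurable
  then show ?thesis
    by (rule measurable_cong[THEN iffD1, rotated])
      (use ex_point_iff measurable_space[OF f] in blast)
qed

lemma ball_point_measurable:
  assumes f [measurable]: "f \<in> measurable L K"
    and \<phi> [measurable]: "Measurable.pred (L \<Otimes>\<^sub>M borel) (\<lambda>x. \<phi> (fst x) (snd x))"
  shows "Measurable.pred L (\<lambda>l. \<forall>p\<in>Y (f l). \<phi> l p)"
proof -
  have "Measurable.pred L (\<lambda>l. \<not> (\<exists>p\<in>Y (f l). \<not> \<phi> l p))"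
    by (intro pred_intros_logic ex_point_measurable[where f = f]) measurable
  then show ?thesis by simp
qed

lemma void_measurable:
  assumes A: "A \<in> sets borel"
  shows "Measurable.pred K (\<lambda>\<omega>. Y \<omega> \<inter> A = {})"
proof -
  have "Measurable.pred K (\<lambda>\<omega>. \<forall>p\<in>Y \<omega>. p \<notin> A)"
    by (rule ball_point_measurable[where f = "\<lambda>x. x"]) (use A in measurable)
  moreover have "(\<forall>p\<in>Y \<omega>. p \<notin> A) \<longleftrightarrow> Y \<omega> \<inter> A = {}" for \<omega> by auto
  ultimately show ?thesis by simp
qed

end

text \<open>
  If \<open>q\<close> follows \<open>p = W(a\<^sub>n)\<close>, the line through \<open>p\<close> sweeps out the area \<open>v\<^sup>2 (a\<^sub>n\<^sub>+\<^sub>1 - a\<^sub>n) / 2\<close>, and by similar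
  triangles \<open>S / L = (v - v') / v\<close>. Thus \<open>marks Y n = (D\<^sub>n, S\<^sub>n\<^sup>2 / L\<^sub>n\<^sup>2)\<close> for \<open>n \<ge> 1\<close>, while \<open>marks Y 0 = W(1)\<close>.
\<close>

definition mark :: "real \<times> real \<Rightarrow> real \<Rightarrow> real \<times> real \<Rightarrow> real \<times> real" where
  "mark p a q = ((snd p)\<^sup>2 / 2 * (slope p q - a), ((snd p - snd q) / snd p)\<^sup>2)"

text \<open>A predicate rather than a point-valued map, so that no default mark is needed when there
  is no next vertex.\<close>

definition next_mark_in :: "(real \<times> real) set \<Rightarrow> real \<times> real \<Rightarrow> real \<Rightarrow> (real \<times> real) set \<Rightarrow> bool" where
  "next_mark_in Y p a C \<longleftrightarrow> (\<exists>q. is_next Y p q \<and> mark p a q \<in> C)"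

definition marks :: "(real \<times> real) set \<Rightarrow> nat \<Rightarrow> real \<times> real" where
  "marks Y n = (case n of 0 \<Rightarrow> hull_pt Y 0 | Suc m \<Rightarrow>
     ((snd (hull_pt Y m))\<^sup>2 / 2 * (hull_a Y n - hull_a Y m),
      ((snd (hull_pt Y m) - snd (hull_pt Y n)) / snd (hull_pt Y m))\<^sup>2))"

lemma slope_measurable [measurable (raw)]:
  assumes [measurable]: "f \<in> borel_measurable L" "g \<in> borel_measurable L"
  shows "(\<lambda>x. slope (f x) (g x)) \<in> borel_measurable L"
  unfolding slope_def by measurable

lemma lvl_measurable [measurable (raw)]:
  assumes [measurable]: "f \<in> borel_measurable L" "g \<in> borel_measurable L"
  shows "(\<lambda>x. lvl (f x) (g x)) \<in> borel_measurable L"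
  unfolding lvl_def by measurable

lemma mark_measurable [measurable (raw)]:
  assumes [measurable]: "f \<in> borel_measurable L" "g \<in> borel_measurable L" "h \<in> borel_measurable L"
  shows "(\<lambda>x. mark (f x) (g x) (h x)) \<in> borel_measurable L"
  unfolding mark_def by measurable

context measurable_config
begin

lemma next_measurable:
  assumes f [measurable]: "f \<in> measurable L K" and p [measurable]: "p \<in> borel_measurable L"
    and \<phi> [measurable]: "Measurable.pred (L \<Otimes>\<^sub>M borel) (\<lambda>x. \<phi> (fst x) (snd x))"
  shows "Measurable.pred L (\<lambda>l. \<exists>q. is_next (Y (f l)) (p l) q \<and> \<phi> l q)"
proof -
  have 1: "Measurable.pred L (\<lambda>l. \<exists>q\<in>Y (f l). snd q < snd (p l) \<and> \<phi> l q \<and>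
     (\<forall>q'\<in>Y (f l). snd q' < snd (p l) \<longrightarrow>
        slope (p l) q < slope (p l) q' \<or> slope (p l) q = slope (p l) q' \<and> snd q \<le> snd q'))"
  proof (rule ex_point_measurable[OF f])
    have "Measurable.pred (L \<Otimes>\<^sub>M borel) (\<lambda>x. \<forall>q'\<in>Y (f (fst x)). snd q' < snd (p (fst x)) \<longrightarrow>
        slope (p (fst x)) (snd x) < slope (p (fst x)) q' \<or>
        slope (p (fst x)) (snd x) = slope (p (fst x)) q' \<and> snd (snd x) \<le> snd q')"
      by (rule ball_point_measurable[where f = "\<lambda>x. f (fst x)"]) measurable
    then show "Measurable.pred (L \<Otimes>\<^sub>M borel) (\<lambda>x. snd (snd x) < snd (p (fst x)) \<and> \<phi> (fst x) (snd x) \<and>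
     (\<forall>q'\<in>Y (f (fst x)). snd q' < snd (p (fst x)) \<longrightarrow>
        slope (p (fst x)) (snd x) < slope (p (fst x)) q' \<or>
        slope (p (fst x)) (snd x) = slope (p (fst x)) q' \<and> snd (snd x) \<le> snd q'))"
      by measurable
  qed
  show ?thesis
    using 1 by (rule measurable_cong[THEN iffD1, rotated]) (simp only: is_next_def, blast)
qed

lemma next_mark_measurable:
  assumes f [measurable]: "f \<in> measurable L K" and p [measurable]: "p \<in> borel_measurable L"
    and a [measurable]: "a \<in> borel_measurable L" and C [measurable]: "C \<in> sets borel"
  shows "Measurable.pred L (\<lambda>l. next_mark_in (Y (f l)) (p l) (a l) C)"
  unfolding next_mark_in_def by (rule next_measurable[OF f p]) measurable

text \<open>Membership of a vertex in \<open>A\<close> is turned into a quantification over points,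
  using the uniqueness of W(1) and of the next vertex.\<close>

lemma hull_measurable:
  shows hull_pt_measurable: "(\<lambda>\<omega>. hull_pt (Y \<omega>) n) \<in> borel_measurable K"
    and hull_a_measurable: "(\<lambda>\<omega>. hull_a (Y \<omega>) n) \<in> borel_measurable K"
proof (induction n)
  case 0
  {
    case 1
    show ?case
    proof (rule measurableI)
      fix A :: "(real \<times> real) set" assume [measurable]: "A \<in> sets borel"
      \<comment> \<open>The second disjunct covers the empty configuration, whose vertex is a fixed
        unspecified point.\<close>
      have eq: "hull_pt (Y \<omega>) 0 \<in> A \<longleftrightarrow>
          (\<exists>p\<in>Y \<omega>. p \<in> A \<and> (\<forall>q\<in>Y \<omega>. lvl 1 p < lvl 1 q \<or> lvl 1 p = lvl 1 q \<and> snd p \<le> snd q)) \<or>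
          (\<not> (\<exists>p\<in>Y \<omega>. True)) \<and> hull_pt {} 0 \<in> A" (is "_ \<longleftrightarrow> ?R \<omega>") if "\<omega> \<in> space K" for \<omega>
      proof (cases "Y \<omega> = {}")
        case False
        have "is_W (Y \<omega>) 1 (hull_pt (Y \<omega>) 0)"
          using is_W_hull_pt[OF config[OF that] False, of 0] by simp
        moreover have "hull_pt (Y \<omega>) 0 = p" if "is_W (Y \<omega>) 1 p" for p
          using hull_W_eqI[OF that] by (simp add: hull_pt_def)
        ultimately show ?thesis using False unfolding is_W_def by blast
      qed auto
      have "Measurable.pred (K \<Otimes>\<^sub>M borel) (\<lambda>x. \<forall>q\<in>Y (fst x). lvl 1 (snd x) < lvl 1 q \<or> lvl 1 (snd x) = lvl 1 q \<and> snd (snd x) \<le> snd q)"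
        by (rule ball_point_measurable[where f = fst]) measurable
      then have "Measurable.pred (K \<Otimes>\<^sub>M borel) (\<lambda>x. snd x \<in> A \<and> (\<forall>q\<in>Y (fst x). lvl 1 (snd x) < lvl 1 q \<or> lvl 1 (snd x) = lvl 1 q \<and> snd (snd x) \<le> snd q))"
        by measurable
      then have [measurable]: "Measurable.pred K (\<lambda>\<omega>. \<exists>p\<in>Y \<omega>. p \<in> A \<and> (\<forall>q\<in>Y \<omega>. lvl 1 p < lvl 1 q \<or> lvl 1 p = lvl 1 q \<and> snd p \<le> snd q))"
        by (intro ex_point_measurable[where f = "\<lambda>x. x"]) simp_all
      have [measurable]: "Measurable.pred K (\<lambda>\<omega>. \<exists>p\<in>Y \<omega>. True)"
        by (rule ex_point_measurable[where f = "\<lambda>x. x"]) simp_all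
      have "Measurable.pred K ?R" by measurable
      then have "{\<omega> \<in> space K. ?R \<omega>} \<in> sets K" by simp
      also have "{\<omega> \<in> space K. ?R \<omega>} = (\<lambda>\<omega>. hull_pt (Y \<omega>) 0) -` A \<inter> space K"
        using eq by blast
      finally show "(\<lambda>\<omega>. hull_pt (Y \<omega>) 0) -` A \<inter> space K \<in> sets K" .
    qed simp
  next
    case 2 show ?case by simp
  }
next
  case (Suc n)
  note [measurable] = Suc
  have ex [measurable]: "Measurable.pred K (\<lambda>\<omega>. \<exists>q. is_next (Y \<omega>) (hull_pt (Y \<omega>) n) q)"
    using next_measurable[of "\<lambda>x. x" K _ "\<lambda>_ _. True", OF _ Suc(1)] by simp
  have p [measurable]: "(\<lambda>\<omega>. hull_pt (Y \<omega>) (Suc n)) \<in> borel_measurable K"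
  proof (rule measurableI)
    fix A :: "(real \<times> real) set" assume [measurable]: "A \<in> sets borel"
    have [measurable]: "Measurable.pred K (\<lambda>\<omega>. \<exists>q. is_next (Y \<omega>) (hull_pt (Y \<omega>) n) q \<and> q \<in> A)"
      by (rule next_measurable[of "\<lambda>x. x"]) measurable
    \<comment> \<open>Without a next vertex the process stays where it is.\<close>
    have "{\<omega> \<in> space K. (\<exists>q. is_next (Y \<omega>) (hull_pt (Y \<omega>) n) q \<and> q \<in> A) \<or>
        \<not> (\<exists>q. is_next (Y \<omega>) (hull_pt (Y \<omega>) n) q) \<and> hull_pt (Y \<omega>) n \<in> A} \<in> sets K"
      (is "?S \<in> _") by measurable
    also have "?S = (\<lambda>\<omega>. hull_pt (Y \<omega>) (Suc n)) -` A \<inter> space K"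
    proof (intro set_eqI)
      fix \<omega>
      show "\<omega> \<in> ?S \<longleftrightarrow> \<omega> \<in> (\<lambda>\<omega>. hull_pt (Y \<omega>) (Suc n)) -` A \<inter> space K"
      proof (cases "\<omega> \<in> space K \<and> (\<exists>q. is_next (Y \<omega>) (hull_pt (Y \<omega>) n) q)")
        case True
        then obtain q where q: "is_next (Y \<omega>) (hull_pt (Y \<omega>) n) q" by auto
        have "hull_pt (Y \<omega>) (Suc n) = q" using hull_next[OF config config q] True by auto
        then show ?thesis using True q is_next_unique[OF q] by blast
      next
        case False
        then show ?thesis using hull_no_next[OF config config, of \<omega> n] by auto
      qed
    qed
    finally show "(\<lambda>\<omega>. hull_pt (Y \<omega>) (Suc n)) -` A \<inter> space K \<in> sets K" .
  qed simp
  have "(\<lambda>\<omega>. if (\<exists>q. is_next (Y \<omega>) (hull_pt (Y \<omega>) n) q)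
      then slope (hull_pt (Y \<omega>) n) (hull_pt (Y \<omega>) (Suc n)) else hull_a (Y \<omega>) n) \<in> borel_measurable K"
    by measurable
  also have "?this \<longleftrightarrow> (\<lambda>\<omega>. hull_a (Y \<omega>) (Suc n)) \<in> borel_measurable K"
  proof (rule measurable_cong)
    fix \<omega> assume \<omega>: "\<omega> \<in> space K"
    show "(if (\<exists>q. is_next (Y \<omega>) (hull_pt (Y \<omega>) n) q)
      then slope (hull_pt (Y \<omega>) n) (hull_pt (Y \<omega>) (Suc n)) else hull_a (Y \<omega>) n) = hull_a (Y \<omega>) (Suc n)"
    proof (cases "\<exists>q. is_next (Y \<omega>) (hull_pt (Y \<omega>) n) q")
      case True
      then obtain q where q: "is_next (Y \<omega>) (hull_pt (Y \<omega>) n) q" by auto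
      then show ?thesis using hull_next[OF config config q] \<omega> True by simp
    next
      case False
      then show ?thesis using hull_no_next[OF config config False] \<omega> by simp
    qed
  qed
  finally have a: "(\<lambda>\<omega>. hull_a (Y \<omega>) (Suc n)) \<in> borel_measurable K" .
  { case 1 show ?case by (rule p) next case 2 show ?case by (rule a) }
qed

lemma marks_measurable: "(\<lambda>\<omega>. marks (Y \<omega>) n) \<in> borel_measurable K"
proof -
  note [measurable] = hull_pt_measurable hull_a_measurable
  show ?thesis
    unfolding marks_def by (cases n) (simp_all del: jump_time.simps)
qed

lemma alive_measurable: "Measurable.pred K (\<lambda>\<omega>. alive (Y \<omega>) n)"
proof (induction n)
  case 0
  then show ?case using void_measurable[of UNIV] by (simp add: alive_def)
next
  case (Suc n)
  have "Measurable.pred K (\<lambda>\<omega>. \<exists>q. is_next (Y \<omega>) (hull_pt (Y \<omega>) n) q)"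
    using next_measurable[of "\<lambda>x. x" K _ "\<lambda>_ _. True", OF _ hull_pt_measurable] by simp
  then show ?case using Suc by (simp add: alive_Suc)
qed

end

section \<open>Independence over disjoint regions\<close>

lemma (in prob_space) indep_sets_reindex:
  assumes "inj f" "indep_sets F (range f)"
  shows "indep_sets (\<lambda>i. F (f i)) UNIV"
  unfolding indep_sets_def
proof (intro conjI ballI allI impI)
  fix i show "F (f i) \<subseteq> events" using assms(2) by (auto simp: indep_sets_def)
next
  fix J A assume J: "J \<subseteq> UNIV" "J \<noteq> {}" "finite J" and A: "A \<in> (\<Pi> j\<in>J. F (f j))"
  let ?A = "\<lambda>n. A (inv f n)"
  have f: "inv f (f j) = j" for j using assms(1) by simp
  have "prob (\<Inter>n\<in>f ` J. ?A n) = (\<Prod>n\<in>f ` J. prob (?A n))"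
  proof -
    have "?A \<in> (\<Pi> n\<in>f ` J. F n)" using A by (auto simp: f)
    moreover have "f ` J \<subseteq> range f" "f ` J \<noteq> {}" "finite (f ` J)" using J by auto
    ultimately show ?thesis using assms(2) unfolding indep_sets_def by blast
  qed
  then show "prob (\<Inter> (A ` J)) = (\<Prod>j\<in>J. prob (A j))"
    using assms(1) by (simp add: f prod.reindex inj_on_subset image_image)
qed

text \<open>The identity maps into \<open>K\<close> and \<open>L\<close> are independent random
  variables, so their joint law, carried by the diagonal, is the product of their laws. On events
  built from two independent algebras, one sample read twice thus cannot be told from two
  independent samples.\<close>

lemma (in prob_space) emeasure_diagonal_indep:
  assumes ind: "indep_set (sets K) (sets L)" and sp: "space K = space M" "space L = space M"
    and E: "E \<in> sets (K \<Otimes>\<^sub>M L)"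
  shows "E \<in> sets (M \<Otimes>\<^sub>M M)"
    and "emeasure M {\<omega> \<in> space M. (\<omega>, \<omega>) \<in> E} = emeasure (M \<Otimes>\<^sub>M M) E"
proof -
  have sub: "sets K \<subseteq> events" "sets L \<subseteq> events" using ind by (auto simp: indep_sets2_eq)
  have id: "(\<lambda>x. x) \<in> measurable M K" "(\<lambda>x. x) \<in> measurable M L"
    using sub sp by (auto simp: measurable_def intro: Int_absorb2 dest: sets.sets_into_space)
  have m: "(\<lambda>x. (fst x, snd x)) \<in> measurable (M \<Otimes>\<^sub>M M) (K \<Otimes>\<^sub>M L)"
    by (intro measurable_Pair measurable_compose[OF measurable_fst id(1)] measurable_compose[OF measurable_snd id(2)])
  have "(\<lambda>x. (fst x, snd x)) -` E \<inter> space (M \<Otimes>\<^sub>M M) = E"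
    using sets.sets_into_space[OF E] sp by (auto simp: space_pair_measure)
  then show EM: "E \<in> sets (M \<Otimes>\<^sub>M M)" using measurable_sets[OF m E] by simp
  have gen: "sigma_sets (space M) {(\<lambda>x. x) -` A \<inter> space M |A. A \<in> sets N} = sets N"
    if "space N = space M" for N
  proof -
    have "{(\<lambda>x. x) -` A \<inter> space M |A. A \<in> sets N} = sets N"
    proof (intro equalityI subsetI)
      fix A assume "A \<in> sets N"
      then have "A = (\<lambda>x. x) -` A \<inter> space M" using sets.sets_into_space[of A N] that by auto
      then show "A \<in> {(\<lambda>x. x) -` A \<inter> space M |A. A \<in> sets N}" using \<open>A \<in> sets N\<close> by blast
    next
      fix B assume "B \<in> {(\<lambda>x. x) -` A \<inter> space M |A. A \<in> sets N}"
      then show "B \<in> sets N" using sets.sets_into_space[of _ N] that by (auto simp: Int_absorb2)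
    qed
    then show ?thesis using sets.sigma_sets_eq[of N] that by simp
  qed
  have "indep_var K (\<lambda>x. x) L (\<lambda>x. x)"
    unfolding indep_var_eq using id ind gen[OF sp(1)] gen[OF sp(2)] by simp
  then have eq: "distr M K (\<lambda>x. x) \<Otimes>\<^sub>M distr M L (\<lambda>x. x) = distr M (K \<Otimes>\<^sub>M L) (\<lambda>x. (x, x))"
    by (simp add: indep_var_distribution_eq)
  have "sigma_finite_measure (distr M L (\<lambda>x. x))"
    using prob_space_distr[OF id(2)] prob_space_imp_sigma_finite by blast
  then have "distr M K (\<lambda>x. x) \<Otimes>\<^sub>M distr M L (\<lambda>x. x) = distr (M \<Otimes>\<^sub>M M) (K \<Otimes>\<^sub>M L) (\<lambda>(x, y). (x, y))"
    by (rule pair_measure_distr[OF id])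
  with eq have "distr M (K \<Otimes>\<^sub>M L) (\<lambda>x. (x, x)) = distr (M \<Otimes>\<^sub>M M) (K \<Otimes>\<^sub>M L) (\<lambda>x. x)"
    by (simp add: id_def)
  then have "emeasure (distr M (K \<Otimes>\<^sub>M L) (\<lambda>x. (x, x))) E = emeasure (distr (M \<Otimes>\<^sub>M M) (K \<Otimes>\<^sub>M L) (\<lambda>x. x)) E"
    by simp
  moreover have "emeasure (distr M (K \<Otimes>\<^sub>M L) (\<lambda>x. (x, x))) E = emeasure M {\<omega> \<in> space M. (\<omega>, \<omega>) \<in> E}"
    using id E by (subst emeasure_distr) (auto intro!: arg_cong[where f = "emeasure M"])
  moreover have "emeasure (distr (M \<Otimes>\<^sub>M M) (K \<Otimes>\<^sub>M L) (\<lambda>x. x)) E = emeasure (M \<Otimes>\<^sub>M M) E"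
    using m E sets.sets_into_space[OF EM]
    by (subst emeasure_distr) (auto intro!: arg_cong[where f = "emeasure (M \<Otimes>\<^sub>M M)"])
  ultimately show "emeasure M {\<omega> \<in> space M. (\<omega>, \<omega>) \<in> E} = emeasure (M \<Otimes>\<^sub>M M) E" by simp
qed

section \<open>Information carried by the Poisson points of a region\<close>

locale quadrant_poisson = poisson_process M "restrict_space lborel quadrant" P
  for M :: "'w measure" and P
begin

lemma config_P: "\<omega> \<in> space M \<Longrightarrow> config (P \<omega>)"
  using points_in_space[of \<omega>] locally_finite[of \<omega>]
  by (simp add: config_def space_restrict_space)

lemma P_Int_quadrant: "\<omega> \<in> space M \<Longrightarrow> P \<omega> \<inter> (A \<inter> quadrant) = P \<omega> \<inter> A"
  using config_P[of \<omega>] by (auto simp: config_def)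

lemma quadrant_borel: "quadrant \<in> sets borel"
  unfolding borel_prod[symmetric] by (intro pair_measureI) auto

lemma restricted_sets: "A \<in> sets borel \<Longrightarrow> A \<inter> quadrant \<in> sets (restrict_space lborel quadrant)"
  by (auto simp: sets_restrict_space)

lemma card_P_measurable [measurable]:
  assumes "A \<in> sets borel" "bounded A"
  shows "(\<lambda>\<omega>. card (P \<omega> \<inter> A)) \<in> measurable M (count_space UNIV)"
proof -
  have "(\<lambda>\<omega>. card (P \<omega> \<inter> (A \<inter> quadrant))) \<in> measurable M (count_space UNIV)"
    using assms by (intro count_measurable restricted_sets bounded_Int) auto
  then show ?thesis by (rule measurable_cong[THEN iffD1, rotated]) (simp only: P_Int_quadrant)
qed

lemma prob_card_P:
  assumes "A \<in> sets borel" "bounded A"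
  shows "prob {\<omega> \<in> space M. card (P \<omega> \<inter> A) = k} =
    measure lborel (A \<inter> quadrant) ^ k / fact k * exp (- measure lborel (A \<inter> quadrant))"
proof -
  have "{\<omega> \<in> space M. card (P \<omega> \<inter> A) = k} = {\<omega> \<in> space M. card (P \<omega> \<inter> (A \<inter> quadrant)) = k}"
    using P_Int_quadrant by auto
  then show ?thesis
    using assms quadrant_borel
    by (simp add: count_poisson restricted_sets bounded_Int measure_restrict_space)
qed

lemma indep_card_P:
  fixes C :: "'i::countable \<Rightarrow> (real \<times> real) set"
  assumes C: "\<And>i. C i \<in> sets borel" "\<And>i. bounded (C i)" and disj: "disjoint_family C"
  shows "indep_vars (\<lambda>_. count_space UNIV) (\<lambda>i \<omega>. card (P \<omega> \<inter> C i)) UNIV"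
proof -
  define B :: "nat \<Rightarrow> (real \<times> real) set"
    where "B n = (if n \<in> range (to_nat :: 'i \<Rightarrow> nat) then C (from_nat n) \<inter> quadrant else {})" for n
  have "indep_vars (\<lambda>_. count_space UNIV) (\<lambda>n \<omega>. card (P \<omega> \<inter> B n)) UNIV"
  proof (rule count_indep)
    show "B n \<in> sets (restrict_space lborel quadrant) \<and> bounded (B n)" for n
      using C by (auto simp: B_def restricted_sets bounded_Int)
    show "disjoint_family B"
      unfolding disjoint_family_on_def
    proof (intro ballI impI)
      fix m n :: nat assume "m \<noteq> n"
      show "B m \<inter> B n = {}"
      proof (cases "m \<in> range (to_nat :: 'i \<Rightarrow> nat) \<and> n \<in> range (to_nat :: 'i \<Rightarrow> nat)")
        case True
        then have "(from_nat m :: 'i) \<noteq> from_nat n" using \<open>m \<noteq> n\<close> by auto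
        then have "C (from_nat m) \<inter> C (from_nat n) = {}"
          using disj by (simp add: disjoint_family_on_def)
        then show ?thesis by (auto simp: B_def)
      qed (auto simp: B_def)
    qed
  qed
  then have "indep_sets (\<lambda>n. {(\<lambda>\<omega>. card (P \<omega> \<inter> B n)) -` A \<inter> space M |A. A \<in> sets (count_space UNIV)}) (range (to_nat :: 'i \<Rightarrow> nat))"
    unfolding indep_vars_def2 by (auto intro: indep_sets_mono_index)
  then have "indep_sets (\<lambda>i. {(\<lambda>\<omega>. card (P \<omega> \<inter> B (to_nat i))) -` A \<inter> space M |A. A \<in> sets (count_space UNIV)}) (UNIV :: 'i set)"
    by (intro indep_sets_reindex) auto
  moreover have "{(\<lambda>\<omega>. card (P \<omega> \<inter> B (to_nat i))) -` A \<inter> space M |A. A \<in> sets (count_space UNIV)} =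
      {(\<lambda>\<omega>. card (P \<omega> \<inter> C i)) -` A \<inter> space M |A. A \<in> sets (count_space UNIV)}" for i
  proof -
    have "(\<lambda>\<omega>. card (P \<omega> \<inter> B (to_nat i))) -` A \<inter> space M = (\<lambda>\<omega>. card (P \<omega> \<inter> C i)) -` A \<inter> space M" for A
      using P_Int_quadrant[of _ "C i"] by (auto simp: B_def)
    then show ?thesis by auto
  qed
  ultimately show ?thesis
    unfolding indep_vars_def2 using C by auto
qed

definition count_events :: "(real \<times> real) set \<Rightarrow> nat \<Rightarrow> int \<Rightarrow> int \<Rightarrow> 'w set set" where
  "count_events G k i j =
     {(\<lambda>\<omega>. card (P \<omega> \<inter> (G \<inter> sq k i j))) -` A \<inter> space M |A. A \<in> sets (count_space UNIV)}"

text \<open>Keeping to one mesh size makes the squares disjoint, as the independence of Poisson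
  counts requires; squares of different sizes may overlap.\<close>

definition level_events :: "(real \<times> real) set \<Rightarrow> nat \<Rightarrow> 'w set set" where
  "level_events G k = sigma_sets (space M) (\<Union>i j. count_events G k i j)"

definition config_algebra :: "(real \<times> real) set \<Rightarrow> 'w measure" where
  "config_algebra G = sigma (space M) (\<Union>k. level_events G k)"

lemma level_events_Pow: "level_events G k \<subseteq> Pow (space M)"
proof
  fix A assume "A \<in> level_events G k"
  then show "A \<in> Pow (space M)"
    unfolding level_events_def by (rule sigma_sets_into_sp[rotated, THEN PowI]) (auto simp: count_events_def)
qed

lemma space_config_algebra [simp]: "space (config_algebra G) = space M"
  by (simp add: config_algebra_def space_measure_of_conv)

lemma sets_config_algebra: "sets (config_algebra G) = sigma_sets (space M) (\<Union>k. level_events G k)"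
  unfolding config_algebra_def using level_events_Pow by (intro sets_measure_of) auto

lemma indep_level_events:
  assumes G: "G \<in> sets borel" "H \<in> sets borel" "G \<inter> H = {}"
  shows "indep_set (level_events G k) (level_events H k)"
proof -
  \<comment> \<open>The Boolean selects the region, so that the squares cut from \<open>G\<close>
    and from \<open>H\<close> form one disjoint family, which is grouped by region
    afterwards.\<close>
  define C :: "bool \<times> int \<times> int \<Rightarrow> (real \<times> real) set"
    where "C = (\<lambda>(b, i, j). (if b then G else H) \<inter> sq k i j)"
  have "indep_vars (\<lambda>_. count_space UNIV) (\<lambda>i \<omega>. card (P \<omega> \<inter> C i)) UNIV"
  proof (rule indep_card_P)
    show "C i \<in> sets borel" for i using G by (auto simp: C_def split: prod.split)
    show "bounded (C i)" for i using bounded_sq by (auto simp: C_def bounded_Int split: prod.split)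
    show "disjoint_family C"
      using G(3) unfolding disjoint_family_on_def C_def by (auto simp: sq_def split: if_splits)
  qed
  then have "indep_sets (\<lambda>i. {(\<lambda>\<omega>. card (P \<omega> \<inter> C i)) -` A \<inter> space M |A. A \<in> sets (count_space UNIV)}) UNIV"
    by (simp add: indep_vars_def2)
  then have "indep_sets (\<lambda>b. sigma_sets (space M)
      (\<Union>i\<in>{b} \<times> UNIV. {(\<lambda>\<omega>. card (P \<omega> \<inter> C i)) -` A \<inter> space M |A. A \<in> sets (count_space UNIV)})) UNIV"
  proof (intro indep_sets_collect_sigma)
    assume "indep_sets (\<lambda>i. {(\<lambda>\<omega>. card (P \<omega> \<inter> C i)) -` A \<inter> space M |A. A \<in> sets (count_space UNIV)}) UNIV"
    moreover have "(\<Union>b\<in>UNIV. {b} \<times> UNIV) = (UNIV :: (bool \<times> int \<times> int) set)" by auto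
    ultimately show "indep_sets (\<lambda>i. {(\<lambda>\<omega>. card (P \<omega> \<inter> C i)) -` A \<inter> space M |A. A \<in> sets (count_space UNIV)})
      (\<Union>b\<in>UNIV. {b} \<times> UNIV)" by simp
    show "Int_stable {(\<lambda>\<omega>. card (P \<omega> \<inter> C i)) -` A \<inter> space M |A. A \<in> sets (count_space UNIV)}" for i
    proof (rule Int_stableI)
      fix a b
      assume "a \<in> {(\<lambda>\<omega>. card (P \<omega> \<inter> C i)) -` A \<inter> space M |A. A \<in> sets (count_space UNIV)}"
        "b \<in> {(\<lambda>\<omega>. card (P \<omega> \<inter> C i)) -` A \<inter> space M |A. A \<in> sets (count_space UNIV)}"
      then obtain A B where "a = (\<lambda>\<omega>. card (P \<omega> \<inter> C i)) -` A \<inter> space M" "b = (\<lambda>\<omega>. card (P \<omega> \<inter> C i)) -` B \<inter> space M"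
        by auto
      then have "a \<inter> b = (\<lambda>\<omega>. card (P \<omega> \<inter> C i)) -` (A \<inter> B) \<inter> space M" by blast
      then show "a \<inter> b \<in> {(\<lambda>\<omega>. card (P \<omega> \<inter> C i)) -` A \<inter> space M |A. A \<in> sets (count_space UNIV)}"
        by (intro CollectI exI[of _ "A \<inter> B"]) simp
    qed
    show "disjoint_family_on (\<lambda>b. {b} \<times> UNIV) (UNIV :: bool set)"
      by (auto simp: disjoint_family_on_def)
  qed
  moreover have "(\<lambda>b. sigma_sets (space M)
      (\<Union>i\<in>{b} \<times> UNIV. {(\<lambda>\<omega>. card (P \<omega> \<inter> C i)) -` A \<inter> space M |A. A \<in> sets (count_space UNIV)})) =
      case_bool (level_events G k) (level_events H k)"
  proof
    fix b
    have "(\<Union>i\<in>{b} \<times> UNIV. {(\<lambda>\<omega>. card (P \<omega> \<inter> C i)) -` A \<inter> space M |A. A \<in> sets (count_space UNIV)}) =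
      (\<Union>i j. count_events (if b then G else H) k i j)"
    proof -
      have "(\<Union>x\<in>{b} \<times> UNIV. f x) = (\<Union>i j. f (b, i, j))" for f :: "bool \<times> int \<times> int \<Rightarrow> 'w set set"
        by auto
      then show ?thesis unfolding count_events_def by (simp only: C_def prod.case)
    qed
    then show "sigma_sets (space M)
      (\<Union>i\<in>{b} \<times> UNIV. {(\<lambda>\<omega>. card (P \<omega> \<inter> C i)) -` A \<inter> space M |A. A \<in> sets (count_space UNIV)}) =
      case_bool (level_events G k) (level_events H k) b"
      by (simp add: level_events_def split: bool.split)
  qed
  ultimately show ?thesis by (simp add: indep_set_def)
qed

lemma card_sq_Suc:
  assumes "\<omega> \<in> space M"
  shows "card (P \<omega> \<inter> (G \<inter> sq k i j)) =
    (\<Sum>(i', j')\<in>{2 * i, 2 * i + 1} \<times> {2 * j, 2 * j + 1}. card (P \<omega> \<inter> (G \<inter> sq (Suc k) i' j')))"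
proof -
  let ?I = "{2 * i, 2 * i + 1} \<times> {2 * j, 2 * j + 1}"
  have div: "n div 2 = m \<longleftrightarrow> n = 2 * m \<or> n = 2 * m + 1" for n m :: int by presburger
  have "P \<omega> \<inter> (G \<inter> sq k i j) = (\<Union>x\<in>?I. P \<omega> \<inter> (G \<inter> sq (Suc k) (fst x) (snd x)))"
  proof (intro set_eqI)
    fix q
    have "q \<in> sq k i j \<longleftrightarrow> (\<exists>x\<in>?I. q \<in> sq (Suc k) (fst x) (snd x))"
      unfolding sq_def mem_Collect_eq floor_pow2_Suc[of k] div by auto
    then show "q \<in> P \<omega> \<inter> (G \<inter> sq k i j) \<longleftrightarrow> q \<in> (\<Union>x\<in>?I. P \<omega> \<inter> (G \<inter> sq (Suc k) (fst x) (snd x)))"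
      by blast
  qed
  also have "card \<dots> = (\<Sum>x\<in>?I. card (P \<omega> \<inter> (G \<inter> sq (Suc k) (fst x) (snd x))))"
  proof (rule card_UN_disjoint)
    show "\<forall>x\<in>?I. finite (P \<omega> \<inter> (G \<inter> sq (Suc k) (fst x) (snd x)))"
      using bounded_sq locally_finite[OF assms] by (intro ballI) (simp add: bounded_Int)
    show "\<forall>x\<in>?I. \<forall>y\<in>?I. x \<noteq> y \<longrightarrow>
        (P \<omega> \<inter> (G \<inter> sq (Suc k) (fst x) (snd x))) \<inter> (P \<omega> \<inter> (G \<inter> sq (Suc k) (fst y) (snd y))) = {}"
      by (auto simp: sq_def)
  qed simp
  finally show ?thesis by (simp add: case_prod_unfold)
qed

text \<open>The count of a square is the sum of the counts of its four children.\<close>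

lemma level_events_Suc: "level_events G k \<subseteq> level_events G (Suc k)"
proof -
  define N where "N = sigma (space M) (\<Union>i j. count_events G (Suc k) i j)"
  have Pow: "(\<Union>i j. count_events G (Suc k) i j) \<subseteq> Pow (space M)"
    by (auto simp: count_events_def)
  then have sp: "space N = space M" and N: "sets N = level_events G (Suc k)"
    unfolding N_def level_events_def by (auto simp: space_measure_of_conv)
  have [measurable]: "(\<lambda>\<omega>. card (P \<omega> \<inter> (G \<inter> sq (Suc k) i j))) \<in> measurable N (count_space UNIV)" for i j
  proof (rule measurableI)
    fix A :: "nat set"
    have "(\<lambda>\<omega>. card (P \<omega> \<inter> (G \<inter> sq (Suc k) i j))) -` A \<inter> space N \<in> count_events G (Suc k) i j"
      using sp by (auto simp: count_events_def)
    then show "(\<lambda>\<omega>. card (P \<omega> \<inter> (G \<inter> sq (Suc k) i j))) -` A \<inter> space N \<in> sets N"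
      unfolding N level_events_def by (intro sigma_sets.Basic) auto
  qed simp
  have "(\<lambda>\<omega>. card (P \<omega> \<inter> (G \<inter> sq k i j))) \<in> measurable N (count_space UNIV)" for i j
  proof -
    have "(\<lambda>\<omega>. \<Sum>(i', j')\<in>{2 * i, 2 * i + 1} \<times> {2 * j, 2 * j + 1}. card (P \<omega> \<inter> (G \<inter> sq (Suc k) i' j')))
      \<in> measurable N (count_space UNIV)"
      by simp
    then show ?thesis
      by (rule measurable_cong[THEN iffD2, rotated]) (simp only: sp, rule card_sq_Suc)
  qed
  then have "count_events G k i j \<subseteq> sets N" for i j
    unfolding count_events_def sp[symmetric] by (auto intro: measurable_sets)
  then have "(\<Union>i j. count_events G k i j) \<subseteq> sets N" by auto
  then show ?thesis
    unfolding level_events_def[of G k] N[symmetric] sp[symmetric] by (rule sets.sigma_sets_subset)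
qed

lemma level_events_mono: "k \<le> l \<Longrightarrow> level_events G k \<subseteq> level_events G l"
  by (rule lift_Suc_mono_le) (rule level_events_Suc)

text \<open>Two events of different meshes both belong to the finer one. The union over all meshes
  is thus a pi-system, through which independence passes to the generated algebras.\<close>

lemma Int_stable_level_events: "Int_stable (\<Union>k. level_events G k)"
proof (rule Int_stableI)
  fix a b assume "a \<in> (\<Union>k. level_events G k)" "b \<in> (\<Union>k. level_events G k)"
  then obtain k l where "a \<in> level_events G k" "b \<in> level_events G l" by auto
  then have "a \<in> level_events G (max k l)" "b \<in> level_events G (max k l)"
    using level_events_mono[of k "max k l"] level_events_mono[of l "max k l"] by auto
  moreover have "sigma_algebra (space M) (level_events G (max k l))"
    unfolding level_events_def by (rule sigma_algebra_sigma_sets) (auto simp: count_events_def)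
  then have "ring_of_sets (space M) (level_events G (max k l))"
    by (simp add: sigma_algebra_def algebra_def)
  ultimately have "a \<inter> b \<in> level_events G (max k l)"
    using semiring_of_sets.Int ring_of_sets_def by metis
  then show "a \<inter> b \<in> (\<Union>k. level_events G k)" by blast
qed

lemma indep_config_algebra:
  assumes "G \<in> sets borel" "H \<in> sets borel" "G \<inter> H = {}"
  shows "indep_set (sets (config_algebra G)) (sets (config_algebra H))"
  unfolding sets_config_algebra
proof (rule indep_set_sigma_sets)
  show "indep_set (\<Union>k. level_events G k) (\<Union>k. level_events H k)"
    unfolding indep_sets2_eq
  proof (intro conjI ballI)
    show "(\<Union>k. level_events G k) \<subseteq> events" "(\<Union>k. level_events H k) \<subseteq> events"
      using indep_level_events[OF assms] unfolding indep_sets2_eq by blast+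
    fix a b assume "a \<in> (\<Union>k. level_events G k)" "b \<in> (\<Union>k. level_events H k)"
    then obtain k l where "a \<in> level_events G k" "b \<in> level_events H l" by auto
    then have "a \<in> level_events G (max k l)" "b \<in> level_events H (max k l)"
      using level_events_mono[of k "max k l"] level_events_mono[of l "max k l"] by auto
    then show "prob (a \<inter> b) = prob a * prob b"
      using indep_level_events[OF assms] by (auto simp: indep_sets2_eq)
  qed
qed (rule Int_stable_level_events)+

lemma measurable_config_restrict: "measurable_config (config_algebra G) (\<lambda>\<omega>. P \<omega> \<inter> G)"
proof
  show "config (P \<omega> \<inter> G)" if "\<omega> \<in> space (config_algebra G)" for \<omega>
    using config_subset[OF config_P] that by simp
  fix k i j
  show "(\<lambda>\<omega>. card (P \<omega> \<inter> G \<inter> sq k i j)) \<in> measurable (config_algebra G) (count_space UNIV)"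
  proof (rule measurableI)
    fix A :: "nat set"
    have "(\<lambda>\<omega>. card (P \<omega> \<inter> (G \<inter> sq k i j))) -` A \<inter> space M \<in> level_events G k"
      unfolding level_events_def by (intro sigma_sets.Basic) (auto simp: count_events_def)
    then show "(\<lambda>\<omega>. card (P \<omega> \<inter> G \<inter> sq k i j)) -` A \<inter> space (config_algebra G) \<in> sets (config_algebra G)"
      unfolding sets_config_algebra by (intro sigma_sets.Basic) (auto simp: Int_assoc)
  qed simp
qed

end

sublocale quadrant_poisson \<subseteq> measurable_config M P
  using config_P bounded_sq by unfold_locales (auto intro: card_P_measurable)

section \<open>The law of the first step\<close>

text \<open>In the plane this is typically a trapezoid, bounded by two lines through
  \<open>p\<close> and two horizontal lines. Half-open rectangles keep adjacent cells
  disjoint.\<close>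

definition cell :: "real \<times> real \<Rightarrow> real \<Rightarrow> real \<Rightarrow> real \<Rightarrow> real \<Rightarrow> real \<Rightarrow> (real \<times> real) set" where
  "cell p a d1 d2 r1 r2 = {q. 0 \<le> snd q \<and> snd q < snd p \<and> mark p a q \<in> {d1<..d2} \<times> {r1<..r2}}"

lemma cell_borel [measurable]: "cell p a d1 d2 r1 r2 \<in> sets borel"
proof -
  have [measurable]: "{d1<..d2} \<times> {r1<..r2} \<in> sets (borel :: (real \<times> real) measure)"
    unfolding borel_prod[symmetric] by (intro pair_measureI) auto
  have "{q \<in> space borel. 0 \<le> snd q \<and> snd q < snd p \<and> mark p a q \<in> {d1<..d2} \<times> {r1<..r2}} \<in> sets (borel :: (real \<times> real) measure)"
    by measurable
  then show ?thesis by (simp add: cell_def)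
qed

text \<open>Sweeping out the area \<open>d\<close> turns the line from direction \<open>a\<close> to
  direction \<open>a + 2 * d / v^2\<close>.\<close>

lemma mark_time_le_iff:
  fixes v y x u a d :: real
  assumes "0 < v" "y < v"
  shows "v\<^sup>2 / 2 * ((x - u) / (v - y) - a) \<le> d \<longleftrightarrow> x \<le> u + (v - y) * (a + 2 * d / v\<^sup>2)"
proof -
  have "v\<^sup>2 / 2 * ((x - u) / (v - y) - a) \<le> d \<longleftrightarrow> (x - u) / (v - y) \<le> a + 2 * d / v\<^sup>2"
    using assms by (auto simp: field_simps)
  also have "\<dots> \<longleftrightarrow> x \<le> u + (v - y) * (a + 2 * d / v\<^sup>2)"
    using assms by (simp add: pos_divide_le_eq algebra_simps)
  finally show ?thesis .
qed

lemma mark_time_less_iff: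
  fixes v y x u a d :: real
  assumes "0 < v" "y < v"
  shows "d < v\<^sup>2 / 2 * ((x - u) / (v - y) - a) \<longleftrightarrow> u + (v - y) * (a + 2 * d / v\<^sup>2) < x"
  using mark_time_le_iff[OF assms, of x u a d] by linarith

lemma ratio_sq_le_iff:
  fixes v y r :: real
  assumes "0 < v" "y < v" "0 \<le> r"
  shows "((v - y) / v)\<^sup>2 \<le> r \<longleftrightarrow> v * (1 - sqrt r) \<le> y"
proof -
  have "((v - y) / v)\<^sup>2 \<le> r \<longleftrightarrow> (v - y) / v \<le> sqrt r"
    using assms by (metis diff_ge_0_iff_ge divide_nonneg_pos less_imp_le real_le_rsqrt real_sqrt_ge_0_iff real_sqrt_le_iff real_sqrt_pow2 real_sqrt_unique sqrt_le_D)
  also have "\<dots> \<longleftrightarrow> v * (1 - sqrt r) \<le> y"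
    using assms by (simp add: pos_divide_le_eq algebra_simps)
  finally show ?thesis .
qed

lemma ratio_sq_less_iff:
  fixes v y r :: real
  assumes "0 < v" "y < v" "0 \<le> r"
  shows "r < ((v - y) / v)\<^sup>2 \<longleftrightarrow> y < v * (1 - sqrt r)"
  using ratio_sq_le_iff[OF assms] by linarith

lemma cell_section:
  assumes p: "0 < snd p" and r: "0 \<le> r1" "r1 \<le> r2" "r2 \<le> 1"
  shows "(\<lambda>x. (x, y)) -` cell p a d1 d2 r1 r2 =
    (if snd p * (1 - sqrt r2) \<le> y \<and> y < snd p * (1 - sqrt r1)
     then {fst p + (snd p - y) * (a + 2 * d1 / (snd p)\<^sup>2) <.. fst p + (snd p - y) * (a + 2 * d2 / (snd p)\<^sup>2)} else {})"
proof -
  have "0 \<le> y" if "snd p * (1 - sqrt r2) \<le> y"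
  proof -
    have "0 \<le> snd p * (1 - sqrt r2)" using p r by simp
    then show ?thesis using that by linarith
  qed
  moreover have "y < snd p" if "y < snd p * (1 - sqrt r1)"
  proof -
    have "snd p * (1 - sqrt r1) \<le> snd p * 1" using p r by (intro mult_left_mono) auto
    then show ?thesis using that by simp
  qed
  ultimately have y: "0 \<le> y" "y < snd p"
    if "snd p * (1 - sqrt r2) \<le> y \<and> y < snd p * (1 - sqrt r1)"
    using that by blast+
  have "(x, y) \<in> cell p a d1 d2 r1 r2 \<longleftrightarrow>
    (snd p * (1 - sqrt r2) \<le> y \<and> y < snd p * (1 - sqrt r1)) \<and>
    fst p + (snd p - y) * (a + 2 * d1 / (snd p)\<^sup>2) < x \<and> x \<le> fst p + (snd p - y) * (a + 2 * d2 / (snd p)\<^sup>2)" for x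
  proof (cases "0 \<le> y \<and> y < snd p")
    case True
    then show ?thesis
      using mark_time_le_iff[OF p, of y x "fst p" a d2] mark_time_less_iff[OF p, of y d1 x "fst p" a]
        ratio_sq_le_iff[OF p, of y r2] ratio_sq_less_iff[OF p, of y r1] r
      unfolding cell_def mark_def slope_def
      by (simp only: mem_Collect_eq mem_Times_iff greaterThanAtMost_iff fst_conv snd_conv) argo
  next
    case False
    then show ?thesis using y by (auto simp: cell_def)
  qed
  then show ?thesis by (intro set_eqI) (simp only: vimage_eq greaterThanAtMost_iff empty_iff split: if_split, blast)
qed

text \<open>The section at height \<open>y\<close> has length proportional to \<open>v - y\<close>,
  and \<open>y\<close> runs from \<open>v (1 - sqrt r2)\<close> to \<open>v (1 - sqrt r1)\<close>.
  The quadratic antiderivative turns the square roots into \<open>r2 - r1\<close>, which is why the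
  ratio is squared in \<open>mark\<close>.\<close>

lemma emeasure_cell:
  assumes p: "0 < snd p" and r: "0 \<le> r1" "r1 \<le> r2" "r2 \<le> 1" and d: "d1 \<le> d2"
  shows "emeasure lborel (cell p a d1 d2 r1 r2) = ennreal ((d2 - d1) * (r2 - r1))"
proof -
  let ?v = "snd p"
  let ?y2 = "?v * (1 - sqrt r2)" and ?y1 = "?v * (1 - sqrt r1)"
  \<comment> \<open>The difference of the two bounding directions, that is, the width of the cell
    per unit of depth below \<open>p\<close>.\<close>
  define c where "c = 2 * (d2 - d1) / ?v\<^sup>2"
  have c: "0 \<le> c" using d by (simp add: c_def)
  have y: "?y2 \<le> ?y1" "?y1 \<le> ?v" using p r by auto
  have "emeasure lborel (cell p a d1 d2 r1 r2) =
      (\<integral>\<^sup>+ y. emeasure lborel ((\<lambda>x. (x, y)) -` cell p a d1 d2 r1 r2) \<partial>lborel)"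
    by (subst lborel_prod[symmetric], subst lborel_pair.emeasure_pair_measure_alt2)
      (use cell_borel in \<open>simp_all only: lborel_prod sets_lborel\<close>)
  also have "\<dots> = (\<integral>\<^sup>+ y. ennreal ((?v - y) * c) * indicator {?y2 .. ?y1} y \<partial>lborel)"
  proof (rule nn_integral_cong_AE)
    \<comment> \<open>The section at the upper end \<open>?y1\<close> is empty, while the closed
      interval of integration contains this height.\<close>
    have "AE y in lborel. y \<noteq> ?y1" by (rule AE_lborel_singleton)
    then show "AE y in lborel. emeasure lborel ((\<lambda>x. (x, y)) -` cell p a d1 d2 r1 r2) =
      ennreal ((?v - y) * c) * indicator {?y2 .. ?y1} y"
    proof eventually_elim
      case (elim y)
      show ?case
      proof (cases "?y2 \<le> y \<and> y < ?y1")
        case True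
        then have "y < ?v" using y by linarith
        then have "(?v - y) * (a + 2 * d1 / ?v\<^sup>2) \<le> (?v - y) * (a + 2 * d2 / ?v\<^sup>2)"
          using d p by (intro mult_left_mono add_left_mono divide_right_mono) auto
        moreover have "(?v - y) * (a + 2 * d2 / ?v\<^sup>2) - (?v - y) * (a + 2 * d1 / ?v\<^sup>2) = (?v - y) * c"
          by (simp add: c_def right_diff_distrib diff_divide_distrib distrib_left)
        ultimately show ?thesis using True unfolding cell_section[OF p r] by simp
      next
        case False
        then show ?thesis using elim unfolding cell_section[OF p r] by (auto simp: indicator_def)
      qed
    qed
  qed
  also have "\<dots> = ennreal ((- (?v - ?y1)\<^sup>2 * c / 2) - (- (?v - ?y2)\<^sup>2 * c / 2))"
  proof (rule nn_integral_FTC_Icc)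
    fix x assume "x \<in> {?y2 .. ?y1}"
    then show "DERIV (\<lambda>y. - (?v - y)\<^sup>2 * c / 2) x :> (?v - x) * c"
      by (auto intro!: derivative_eq_intros simp: field_simps)
    show "0 \<le> (?v - x) * c"
      using \<open>x \<in> {?y2 .. ?y1}\<close> y c by (intro mult_nonneg_nonneg) auto
  qed (use y in auto)
  also have "(- (?v - ?y1)\<^sup>2 * c / 2) - (- (?v - ?y2)\<^sup>2 * c / 2) = (d2 - d1) * (r2 - r1)"
  proof -
    have "?v - ?y1 = ?v * sqrt r1" "?v - ?y2 = ?v * sqrt r2" by (simp_all add: algebra_simps)
    then show ?thesis using p r by (simp add: c_def power_mult_distrib field_simps)
  qed
  finally show ?thesis .
qed

lemma cell_nonneg:
  assumes "0 \<le> fst p" "0 < snd p" "0 \<le> a" "0 \<le> d1" "q \<in> cell p a d1 d2 r1 r2"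
  shows "0 \<le> fst q"
proof -
  have q: "snd q < snd p" "d1 < (snd p)\<^sup>2 / 2 * ((fst q - fst p) / (snd p - snd q) - a)"
    using assms(5) by (auto simp: cell_def mark_def slope_def)
  then have "fst p + (snd p - snd q) * (a + 2 * d1 / (snd p)\<^sup>2) < fst q"
    using mark_time_less_iff[OF assms(2) q(1)] by blast
  moreover have "0 \<le> (snd p - snd q) * (a + 2 * d1 / (snd p)\<^sup>2)"
    using q assms by (intro mult_nonneg_nonneg add_nonneg_nonneg) auto
  ultimately show ?thesis using assms(1) by linarith
qed

lemma bounded_cell:
  assumes "0 \<le> fst p" "0 < snd p" "0 \<le> a" "0 \<le> d1"
  shows "bounded (cell p a d1 d2 r1 r2)"
proof -
  \<comment> \<open>\<open>d2\<close> may be negative here; the absolute value keeps the bound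
    monotone in the depth.\<close>
  let ?b = "fst p + snd p * (a + 2 * \<bar>d2\<bar> / (snd p)\<^sup>2)"
  have "cell p a d1 d2 r1 r2 \<subseteq> {0 .. ?b} \<times> {0 .. snd p}"
  proof
    fix q assume q: "q \<in> cell p a d1 d2 r1 r2"
    then have q': "0 \<le> snd q" "snd q < snd p" "(snd p)\<^sup>2 / 2 * ((fst q - fst p) / (snd p - snd q) - a) \<le> \<bar>d2\<bar>"
      by (auto simp: cell_def mark_def slope_def)
    then have "fst q \<le> fst p + (snd p - snd q) * (a + 2 * \<bar>d2\<bar> / (snd p)\<^sup>2)"
      using mark_time_le_iff[OF assms(2) q'(2)] by blast
    also have "\<dots> \<le> ?b" using q' assms by (intro add_left_mono mult_right_mono) auto
    finally show "q \<in> {0 .. ?b} \<times> {0 .. snd p}"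
      using cell_nonneg[OF assms q] q' by (simp add: mem_Times_iff)
  qed
  moreover have "bounded ({0 .. ?b} \<times> {0 .. snd p})" by (intro bounded_Times) auto
  ultimately show ?thesis by (rule bounded_subset[rotated])
qed

lemma mark_pos_iff:
  assumes "0 < snd p" "snd q < snd p"
  shows "0 < fst (mark p a q) \<longleftrightarrow> q \<in> unexplored p a"
  using assms slope_less_iff[OF assms(2), of a]
  by (simp add: mark_def unexplored_def zero_less_mult_iff)

lemma mark_ratio_bounds:
  assumes "0 \<le> snd q" "snd q < snd p"
  shows "0 < snd (mark p a q)" "snd (mark p a q) \<le> 1"
proof -
  have *: "0 < (snd p - snd q) / snd p" "(snd p - snd q) / snd p \<le> 1" using assms by auto
  show "0 < snd (mark p a q)" "snd (mark p a q) \<le> 1"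
    unfolding mark_def snd_conv using zero_less_power[OF *(1), of 2] power_le_one[OF _ *(2), of 2] *(1) by auto
qed

lemma next_mark_in_mono: "next_mark_in Y p a C \<Longrightarrow> C \<subseteq> D \<Longrightarrow> next_mark_in Y p a D"
  unfolding next_mark_in_def by blast

lemma next_mark_in_Int: "next_mark_in Y p a C \<Longrightarrow> next_mark_in Y p a D \<Longrightarrow> next_mark_in Y p a (C \<inter> D)"
  unfolding next_mark_in_def using is_next_unique by blast

lemma next_mark_in_empty: "\<not> next_mark_in Y p a {}"
  unfolding next_mark_in_def by blast

lemma mark_time_mono:
  assumes "0 < snd p"
  shows "fst (mark p a q) < fst (mark p a q') \<longleftrightarrow> slope p q < slope p q'"
  using assms by (simp add: mark_def)

section \<open>The two marginal laws of a mark\<close>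

abbreviation exp_law :: "real measure" where
  "exp_law \<equiv> density lborel (exponential_density 1)"

abbreviation unit_law :: "real measure" where
  "unit_law \<equiv> uniform_measure lborel {0<..<1}"

lemma prob_space_unit_law: "prob_space unit_law"
  by (rule prob_space_uniform_measure) auto

lemma prob_space_exp_law: "prob_space exp_law"
  by (rule prob_space_exponential_density) simp

lemma unit_law_atMost: "emeasure unit_law {..y} = ennreal (max 0 (min 1 y))"
proof -
  have "{0<..<1} \<inter> {..y} = (if y \<le> 0 then {} else if y < 1 then {0<..y} else {0<..<1})"
    by auto
  then show ?thesis by (auto simp: divide_ennreal_def max_def min_def ennreal_neg)
qed

lemma exp_law_atMost: "emeasure exp_law {..x} = ennreal (if x < 0 then 0 else 1 - exp (- x))"
  by (simp add: emeasure_erlang_density erlang_CDF_def)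

text \<open>Closed lower left quadrants form a pi-system generating the Borel sets of the plane, so
  the joint distribution function determines the law.\<close>

lemma mark_law_eqI:
  assumes "finite_measure N" and sets: "sets N = sets borel"
    and eq: "\<And>x y. emeasure N ({..x} \<times> {..y}) = emeasure exp_law {..x} * emeasure unit_law {..y}"
  shows "N = exp_law \<Otimes>\<^sub>M unit_law"
proof -
  interpret N: finite_measure N by fact
  interpret U: prob_space unit_law by (rule prob_space_unit_law)
  let ?E = "range (\<lambda>a :: real \<times> real. {..a})"
  have Iic: "{..a} = {..fst a} \<times> {..snd a}" for a :: "real \<times> real"
    by (auto simp: less_eq_prod_def)
  have gen: "sigma_sets UNIV ?E = sets borel"
    unfolding borel_eq_atMost by simp
  show ?thesis
  proof (rule measure_eqI_generator_eq[where E = ?E and \<Omega> = UNIV and A = "\<lambda>n. {..(real n, real n)}"])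
    show "Int_stable ?E"
    proof (rule Int_stableI)
      fix a b assume "a \<in> ?E" "b \<in> ?E"
      then obtain x y where "a = {..x}" "b = {..y}" by auto
      then have "a \<inter> b = {..(min (fst x) (fst y), min (snd x) (snd y))}"
        by (auto simp: Iic)
      then show "a \<inter> b \<in> ?E" by blast
    qed
    show "emeasure N X = emeasure (exp_law \<Otimes>\<^sub>M unit_law) X" if "X \<in> ?E" for X
      using that eq by (auto simp: Iic U.emeasure_pair_measure_Times)
    show "sets N = sigma_sets UNIV ?E" using sets gen by simp
    have "sets (exp_law \<Otimes>\<^sub>M unit_law) = sets (borel \<Otimes>\<^sub>M borel)"
      by (intro sets_pair_measure_cong) auto
    then show "sets (exp_law \<Otimes>\<^sub>M unit_law) = sigma_sets UNIV ?E"
      unfolding gen by (simp only: borel_prod)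
    show "(\<Union>n. {..(real n, real n)}) = UNIV"
    proof (intro equalityI subsetI UNIV_I)
      fix q :: "real \<times> real"
      obtain n where "max (fst q) (snd q) \<le> real n" using real_arch_simple by blast
      then show "q \<in> (\<Union>n. {..(real n, real n)})" by (auto simp: less_eq_prod_def)
    qed
    show "emeasure N {..(real n, real n)} \<noteq> \<infinity>" for n by simp
  qed auto
qed

section \<open>The next mark seen from a fixed vertex and direction\<close>

context quadrant_poisson
begin

context
  fixes p :: "real \<times> real" and a :: real
  assumes p: "0 \<le> fst p" "0 < snd p" and a: "0 \<le> a"
begin

lemma unexplored_borel: "unexplored p a \<in> sets borel"
proof -
  have "{q \<in> space borel. snd q < snd p \<and> lvl a p < lvl a q} \<in> sets (borel :: (real \<times> real) measure)"
    by measurable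
  then show ?thesis by (simp add: unexplored_def)
qed

lemma measure_cell:
  assumes "0 \<le> d1" "d1 \<le> d2" "0 \<le> r1" "r1 \<le> r2" "r2 \<le> 1"
  shows "measure lborel (cell p a d1 d2 r1 r2 \<inter> quadrant) = (d2 - d1) * (r2 - r1)"
proof -
  have "cell p a d1 d2 r1 r2 \<inter> quadrant = cell p a d1 d2 r1 r2"
    using cell_nonneg[OF p a assms(1)] by (auto simp: cell_def mem_Times_iff)
  then show ?thesis
    using emeasure_cell[OF p(2) assms(3-5) assms(2)] assms by (simp add: measure_def)
qed

lemma in_cellI:
  assumes "q \<in> P \<omega>" "\<omega> \<in> space M" "q \<in> unexplored p a" "fst (mark p a q) \<le> d"
  shows "q \<in> cell p a 0 d 0 1"
proof -
  have q: "0 \<le> snd q" "snd q < snd p"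
    using config_nonneg[OF config_P assms(1)] assms by (auto simp: unexplored_def)
  then show ?thesis
    using mark_pos_iff[OF p(2) q(2)] mark_ratio_bounds[OF q] assms
    by (simp add: cell_def mem_Times_iff)
qed

text \<open>Three disjoint cells of total area \<open>t\<close> have independent Poisson counts,
  whose exponential factors combine to \<open>exp (- t)\<close>. With one point in the cell for
  \<open>r1\<close>, \<open>r2\<close> and none in the other two, that point is the first one
  met.\<close>

lemma first_in_cell_prob:
  assumes h: "0 \<le> s" "s \<le> t" and r: "0 \<le> r1" "r1 \<le> r2" "r2 \<le> 1"
  defines "F \<equiv> {\<omega> \<in> space M. card (P \<omega> \<inter> cell p a 0 s 0 1) = 0 \<and> card (P \<omega> \<inter> cell p a s t r1 r2) = 1 \<and>
      card (P \<omega> \<inter> (cell p a s t 0 1 - cell p a s t r1 r2)) = 0}"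
  shows "F \<in> events" "prob F = (t - s) * (r2 - r1) * exp (- t)"
    "\<omega> \<in> F \<Longrightarrow> next_mark_in (P \<omega> \<inter> unexplored p a) p a ({s<..t} \<times> {r1<..r2})"
proof -
  \<comment> \<open>The empty sets complete the three cells to a family indexed by all natural
    numbers.\<close>
  let ?A = "\<lambda>i::nat. if i = 0 then cell p a 0 s 0 1 else if i = 1 then cell p a s t r1 r2
    else if i = 2 then cell p a s t 0 1 - cell p a s t r1 r2 else {}"
  let ?k = "\<lambda>i::nat. if i = 1 then 1 else 0 :: nat"
  have sub: "cell p a s t r1 r2 \<subseteq> cell p a s t 0 1" using r by (auto simp: cell_def)
  have bd: "bounded (cell p a s t' r r')" "bounded (cell p a 0 t' r r')" for t' r r'
    using h p a by (auto intro: bounded_cell)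
  have A: "?A i \<in> sets borel" "bounded (?A i)" for i
    using bd by (auto intro: bounded_subset)
  have disj: "disjoint_family ?A"
    unfolding disjoint_family_on_def by (auto simp: cell_def)
  have ind: "indep_vars (\<lambda>_. count_space UNIV) (\<lambda>i \<omega>. card (P \<omega> \<inter> ?A i)) UNIV"
    by (rule indep_card_P[OF A disj])
  have F: "F = (\<Inter>i\<in>{0,1,2}. (\<lambda>\<omega>. card (P \<omega> \<inter> ?A i)) -` {?k i} \<inter> space M)"
    unfolding F_def by auto
  have "prob F = (\<Prod>i\<in>{0,1,2}. prob ((\<lambda>\<omega>. card (P \<omega> \<inter> ?A i)) -` {?k i} \<inter> space M))"
    unfolding F by (rule indep_varsD[OF ind]) auto
  also have "\<dots> = (\<Prod>i\<in>{0,1,2}. prob {\<omega> \<in> space M. card (P \<omega> \<inter> ?A i) = ?k i})"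
    by (intro prod.cong refl arg_cong[where f = prob]) auto
  also have "\<dots> = (\<Prod>i\<in>{0,1,2}. measure lborel (?A i \<inter> quadrant) ^ ?k i / fact (?k i) * exp (- measure lborel (?A i \<inter> quadrant)))"
    by (intro prod.cong refl prob_card_P A)
  also have "\<dots> = (t - s) * (r2 - r1) * (exp (- s) * exp (- ((t - s) * (r2 - r1))) *
      exp (- measure lborel ((cell p a s t 0 1 - cell p a s t r1 r2) \<inter> quadrant)))"
    using h r by (simp add: measure_cell)
  also have "measure lborel ((cell p a s t 0 1 - cell p a s t r1 r2) \<inter> quadrant) = (t - s) - (t - s) * (r2 - r1)"
  proof -
    have "(cell p a s t 0 1 - cell p a s t r1 r2) \<inter> quadrant = (cell p a s t 0 1 \<inter> quadrant) - (cell p a s t r1 r2 \<inter> quadrant)"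
      by auto
    moreover have "emeasure lborel (cell p a s t 0 1 \<inter> quadrant) \<noteq> \<infinity>"
    proof -
      have "emeasure lborel (cell p a s t 0 1 \<inter> quadrant) \<le> emeasure lborel (cell p a s t 0 1)"
        by (intro emeasure_mono) auto
      then show ?thesis using emeasure_cell[OF p(2), of 0 1 s t a] h by (auto simp: top_unique)
    qed
    ultimately show ?thesis
      using quadrant_borel h r measure_Diff[of lborel "cell p a s t 0 1 \<inter> quadrant" "cell p a s t r1 r2 \<inter> quadrant"]
        Int_mono[OF sub order_refl, of quadrant]
      by (simp add: measure_cell)
  qed
  also have "exp (- s) * exp (- ((t - s) * (r2 - r1))) * exp (- ((t - s) - (t - s) * (r2 - r1))) = exp (- t)"
    by (simp flip: exp_add)
  finally show "prob F = (t - s) * (r2 - r1) * exp (- t)" .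
  have [measurable]: "(\<lambda>\<omega>. card (P \<omega> \<inter> ?A i)) \<in> measurable M (count_space UNIV)" for i
    using A by (rule card_P_measurable)
  show "F \<in> events"
    unfolding F by (intro sets.finite_INT) (auto intro!: measurable_sets)
  assume \<omega>: "\<omega> \<in> F"
  then have sp: "\<omega> \<in> space M" by (simp add: F_def)
  obtain q where q: "P \<omega> \<inter> cell p a s t r1 r2 = {q}"
    using \<omega> unfolding F_def mem_Collect_eq by (metis card_1_singletonE)
  then have q1: "q \<in> P \<omega>" "q \<in> cell p a s t r1 r2" by auto
  then have q2: "0 \<le> snd q" "snd q < snd p" "mark p a q \<in> {s<..t} \<times> {r1<..r2}" by (auto simp: cell_def)
  have qu: "q \<in> unexplored p a"
    using mark_pos_iff[OF p(2) q2(2), of a] q2(3) h by (auto simp: mem_Times_iff)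
  have E0: "P \<omega> \<inter> cell p a 0 s 0 1 = {}" "P \<omega> \<inter> (cell p a s t 0 1 - cell p a s t r1 r2) = {}"
    using \<omega> bd locally_finite[OF sp] unfolding F_def by (auto simp: bounded_diff)
  have "is_next (P \<omega> \<inter> unexplored p a) p q"
    unfolding is_next_def
  proof (intro conjI ballI impI)
    show "q \<in> P \<omega> \<inter> unexplored p a" "snd q < snd p" using q1 qu q2 by auto
    fix q' assume q': "q' \<in> P \<omega> \<inter> unexplored p a" "snd q' < snd p"
    show "slope p q < slope p q' \<or> slope p q = slope p q' \<and> snd q \<le> snd q'"
    proof (cases "fst (mark p a q') \<le> t")
      case True
      then have "q' \<in> cell p a 0 t 0 1" by (intro in_cellI[OF _ sp]) (use q' in auto)
      then have "q' \<in> cell p a 0 s 0 1 \<or> q' \<in> cell p a s t 0 1"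
        by (auto simp: cell_def)
      then have "q' \<in> cell p a s t r1 r2" using E0 q' by auto
      then have "q' = q" using q q' by auto
      then show ?thesis by simp
    next
      case False
      then have "fst (mark p a q) < fst (mark p a q')" using q2 by (auto simp: mem_Times_iff)
      then show ?thesis using mark_time_mono[OF p(2)] by blast
    qed
  qed
  then show "next_mark_in (P \<omega> \<inter> unexplored p a) p a ({s<..t} \<times> {r1<..r2})"
    using q2(3) unfolding next_mark_in_def by (intro exI[of _ q] conjI)
qed

lemma measurable_next_mark:
  assumes "C \<in> sets borel"
  shows "{\<omega> \<in> space M. next_mark_in (P \<omega> \<inter> unexplored p a) p a C} \<in> events"
proof -
  interpret U: measurable_config "config_algebra (unexplored p a)" "\<lambda>\<omega>. P \<omega> \<inter> unexplored p a"
    by (rule measurable_config_restrict)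
  have "{\<omega> \<in> space M. next_mark_in (P \<omega> \<inter> unexplored p a) p a C} \<in> sets (config_algebra (unexplored p a))"
    using U.next_mark_measurable[of "\<lambda>x. x" "config_algebra (unexplored p a)" "\<lambda>_. p" "\<lambda>_. a" C] assms
    unfolding pred_def by simp
  moreover have "sets (config_algebra (unexplored p a)) \<subseteq> events"
    using indep_config_algebra[of "unexplored p a" "{}"] unexplored_borel by (simp add: indep_sets2_eq)
  ultimately show ?thesis by auto
qed

text \<open>The sweep up to area \<open>d\<close> is cut into \<open>Suc n\<close> strips. The
  events that the first point is met in a given strip, and alone there, are disjoint, and their
  probabilities form a Riemann sum for the exponential density. Refining the strips removes the loss
  from several points in one strip.\<close>

lemma next_mark_prob_ge:
  assumes d: "0 \<le> d" and r: "0 \<le> r1" "r1 \<le> r2" "r2 \<le> 1"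
  shows "(r2 - r1) * (1 - exp (- d)) \<le>
    prob {\<omega> \<in> space M. next_mark_in (P \<omega> \<inter> unexplored p a) p a ({0<..d} \<times> {r1<..r2})}"
    (is "_ \<le> prob ?N")
proof -
  have bound: "exp (- d / real (Suc n)) * ((r2 - r1) * (1 - exp (- d))) \<le> prob ?N" for n
  proof -
    define h where "h = d / real (Suc n)"
    have h: "0 \<le> h" "real (Suc n) * h = d" using d by (auto simp: h_def)
    define F where "F k = {\<omega> \<in> space M. card (P \<omega> \<inter> cell p a 0 (real k * h) 0 1) = 0 \<and>
      card (P \<omega> \<inter> cell p a (real k * h) (real (Suc k) * h) r1 r2) = 1 \<and>
      card (P \<omega> \<inter> (cell p a (real k * h) (real (Suc k) * h) 0 1 - cell p a (real k * h) (real (Suc k) * h) r1 r2)) = 0}" for k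
    have le: "0 \<le> real k * h" "real k * h \<le> real (Suc k) * h" for k using h by (auto simp: algebra_simps)
    note F = first_in_cell_prob[OF le r, folded F_def]
    have disj: "disjoint_family_on F {..<Suc n}"
      unfolding disjoint_family_on_def
    proof (intro ballI impI, rule ccontr)
      fix k l assume kl: "k \<noteq> l" "F k \<inter> F l \<noteq> {}"
      then obtain \<omega> where \<omega>: "\<omega> \<in> F k" "\<omega> \<in> F l" by auto
      have "{real k * h<..real (Suc k) * h} \<times> {r1<..r2} \<inter> {real l * h<..real (Suc l) * h} \<times> {r1<..r2} \<noteq> {}"
        using next_mark_in_Int[OF F(3)[OF \<omega>(1)] F(3)[OF \<omega>(2)]] next_mark_in_empty by metis
      then have *: "real k * h < real (Suc l) * h" "real l * h < real (Suc k) * h"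
        by auto
      have "0 < h" using *(1) h(1) by (cases "h = 0") auto
      then have "k < Suc l" "l < Suc k" using * by auto
      then show False using kl by simp
    qed
    have sub: "(\<Union>k<Suc n. F k) \<subseteq> ?N"
    proof
      fix \<omega> assume "\<omega> \<in> (\<Union>k<Suc n. F k)"
      then obtain k where k: "k < Suc n" "\<omega> \<in> F k" by auto
      have "real (Suc k) * h \<le> real (Suc n) * h" using k h by (intro mult_right_mono) auto
      then have "{real k * h<..real (Suc k) * h} \<subseteq> {0<..d}" using le(1)[of k] h(2) by auto
      then have "next_mark_in (P \<omega> \<inter> unexplored p a) p a ({0<..d} \<times> {r1<..r2})"
        by (intro next_mark_in_mono[OF F(3)[OF k(2)]] Sigma_mono) auto
      then show "\<omega> \<in> ?N" using k(2) by (simp add: F_def)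
    qed
    have "(r2 - r1) * exp (- h) * (exp (- (real k * h)) - exp (- (real (Suc k) * h))) \<le> prob (F k)" for k
    proof -
      \<comment> \<open>Replacing \<open>h\<close> by the smaller \<open>1 - exp (- h)\<close> makes
        the sum telescope; the remaining factor \<open>exp (- h)\<close> tends to 1 as the strips
        shrink.\<close>
      have "1 - exp (- h) \<le> h" using exp_ge_add_one_self[of "- h"] by simp
      then have "(r2 - r1) * exp (- h) * exp (- (real k * h)) * (1 - exp (- h)) \<le> (r2 - r1) * exp (- h) * exp (- (real k * h)) * h"
        using r by (intro mult_left_mono) auto
      moreover have "exp (- (real (Suc k) * h)) = exp (- h) * exp (- (real k * h))"
        by (simp add: algebra_simps flip: exp_add)
      ultimately show ?thesis unfolding F(2) by (simp add: algebra_simps)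
    qed
    then have "(\<Sum>k<Suc n. (r2 - r1) * exp (- h) * (exp (- (real k * h)) - exp (- (real (Suc k) * h)))) \<le> (\<Sum>k<Suc n. prob (F k))"
      by (intro sum_mono)
    also have "\<dots> = prob (\<Union>k<Suc n. F k)"
      using F(1) disj by (intro finite_measure_finite_Union[symmetric]) auto
    also have "\<dots> \<le> prob ?N"
      by (intro finite_measure_mono sub measurable_next_mark borel_Times) auto
    finally have "(r2 - r1) * exp (- h) * (\<Sum>k<Suc n. exp (- (real k * h)) - exp (- (real (Suc k) * h))) \<le> prob ?N"
      by (simp only: sum_distrib_left)
    moreover have "(\<Sum>k<Suc n. exp (- (real k * h)) - exp (- (real (Suc k) * h))) = 1 - exp (- d)"
      by (subst sum_lessThan_telescope') (simp add: h(2)[simplified])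
    ultimately have "(r2 - r1) * exp (- h) * (1 - exp (- d)) \<le> prob ?N" by metis
    then show ?thesis by (simp add: h_def mult_ac)
  qed
  have "(\<lambda>n. - d / real (Suc n)) \<longlonglongrightarrow> 0"
    by (rule LIMSEQ_Suc[OF lim_const_over_n])
  then have "(\<lambda>n. exp (- d / real (Suc n)) * ((r2 - r1) * (1 - exp (- d)))) \<longlonglongrightarrow> exp 0 * ((r2 - r1) * (1 - exp (- d)))"
    by (intro tendsto_intros)
  then show ?thesis
    using bound by (intro LIMSEQ_le_const2[where X = "\<lambda>n. exp (- d / real (Suc n)) * ((r2 - r1) * (1 - exp (- d)))"]) auto
qed

text \<open>If the first point is met by area \<open>d\<close>, then the cell swept out by that
  time, of area \<open>d\<close>, is not void.\<close>

lemma next_mark_prob_le: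
  assumes d: "0 \<le> d"
  shows "prob {\<omega> \<in> space M. next_mark_in (P \<omega> \<inter> unexplored p a) p a ({..d} \<times> UNIV)} \<le> 1 - exp (- d)"
    (is "prob ?N \<le> _")
proof -
  let ?C = "cell p a 0 d 0 1"
  have C: "bounded ?C" using p a by (intro bounded_cell) auto
  let ?Z = "{\<omega> \<in> space M. card (P \<omega> \<inter> ?C) = 0}"
  have Z: "?Z \<in> events"
    using measurable_sets[OF card_P_measurable[OF _ C], of "{0}"] by (simp add: vimage_def Int_def conj_commute)
  have "prob ?Z = exp (- d)"
    using prob_card_P[OF _ C, of 0] measure_cell[of 0 d 0 1] d by simp
  moreover have "?N \<subseteq> space M - ?Z"
  proof
    fix \<omega> assume \<omega>: "\<omega> \<in> ?N"
    then obtain q where q: "is_next (P \<omega> \<inter> unexplored p a) p q" "fst (mark p a q) \<le> d"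
      unfolding next_mark_in_def by (auto simp: mem_Times_iff)
    then have "q \<in> P \<omega> \<inter> ?C" using \<omega> by (auto simp: is_next_def intro: in_cellI)
    then have "card (P \<omega> \<inter> ?C) \<noteq> 0" using locally_finite[OF _ C, of \<omega>] \<omega> by auto
    then show "\<omega> \<in> space M - ?Z" using \<omega> by simp
  qed
  then have "prob ?N \<le> prob (space M - ?Z)" using Z by (intro finite_measure_mono) auto
  ultimately show ?thesis using prob_compl[OF Z] by simp
qed

text \<open>The lower bounds for ratios up to \<open>r\<close> and for ratios above \<open>r\<close>
  add up to the upper bound for their union, so neither can be exceeded.\<close>

lemma next_mark_prob_rect:
  assumes d: "0 \<le> d" and r: "0 \<le> r" "r \<le> 1"
  shows "prob {\<omega> \<in> space M. next_mark_in (P \<omega> \<inter> unexplored p a) p a ({..d} \<times> {..r})} = (1 - exp (- d)) * r"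
proof (rule antisym)
  let ?N = "\<lambda>C. {\<omega> \<in> space M. next_mark_in (P \<omega> \<inter> unexplored p a) p a C}"
  have m: "?N C \<in> events" if "C \<in> sets borel" for C using measurable_next_mark[OF that] .
  have "prob (?N ({0<..d} \<times> {0<..r})) \<le> prob (?N ({..d} \<times> {..r}))"
    by (intro finite_measure_mono m borel_Times) (auto intro: next_mark_in_mono)
  then show "(1 - exp (- d)) * r \<le> prob (?N ({..d} \<times> {..r}))"
    using next_mark_prob_ge[OF d, of 0 r] r by (simp add: mult.commute)
  have "?N ({..d} \<times> {..r}) \<inter> ?N ({0<..d} \<times> {r<..1}) = {}"
  proof (intro equals0I)
    fix \<omega> assume "\<omega> \<in> ?N ({..d} \<times> {..r}) \<inter> ?N ({0<..d} \<times> {r<..1})"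
    then have "next_mark_in (P \<omega> \<inter> unexplored p a) p a (({..d} \<times> {..r}) \<inter> ({0<..d} \<times> {r<..1}))"
      by (intro next_mark_in_Int) auto
    moreover have "({..d} \<times> {..r}) \<inter> ({0<..d} \<times> {r<..1}) = {}" by auto
    ultimately show False using next_mark_in_empty by metis
  qed
  then have "prob (?N ({..d} \<times> {..r})) + prob (?N ({0<..d} \<times> {r<..1})) =
      prob (?N ({..d} \<times> {..r}) \<union> ?N ({0<..d} \<times> {r<..1}))"
    by (intro finite_measure_Union[symmetric] m borel_Times) auto
  also have "\<dots> \<le> prob (?N ({..d} \<times> UNIV))"
    by (intro finite_measure_mono m borel_Times) (auto intro: next_mark_in_mono)
  also have "\<dots> \<le> 1 - exp (- d)" by (rule next_mark_prob_le[OF d])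
  finally show "prob (?N ({..d} \<times> {..r})) \<le> (1 - exp (- d)) * r"
    using next_mark_prob_ge[OF d, of r 1] r by (simp add: algebra_simps)
qed

text \<open>Let the area bound tend to infinity with the full range of ratios.\<close>

lemma next_mark_prob_ex:
  "prob {\<omega> \<in> space M. next_mark_in (P \<omega> \<inter> unexplored p a) p a UNIV} = 1"
proof (rule antisym)
  let ?N = "\<lambda>C. {\<omega> \<in> space M. next_mark_in (P \<omega> \<inter> unexplored p a) p a C}"
  have "1 - exp (- real n) \<le> prob (?N UNIV)" for n
  proof -
    have "1 - exp (- real n) = prob (?N ({..real n} \<times> {..1}))"
      using next_mark_prob_rect[of "real n" 1] by simp
    also have "\<dots> \<le> prob (?N UNIV)"
      by (intro finite_measure_mono measurable_next_mark) (auto intro: next_mark_in_mono)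
    finally show ?thesis .
  qed
  moreover have "(\<lambda>n. 1 - exp (- real n)) \<longlonglongrightarrow> 1 - 0"
    by (intro tendsto_intros filterlim_compose[OF exp_at_bot] filterlim_compose[OF filterlim_uminus_at_bot_at_top filterlim_real_sequentially])
  ultimately show "1 \<le> prob (?N UNIV)"
    by (intro LIMSEQ_le_const2[where X = "\<lambda>n. 1 - exp (- real n)"]) auto
qed simp

lemma next_mark_law:
  assumes C: "C \<in> sets borel"
  shows "prob {\<omega> \<in> space M. next_mark_in (P \<omega> \<inter> unexplored p a) p a C} = measure (exp_law \<Otimes>\<^sub>M unit_law) C"
proof -
  let ?N = "\<lambda>C. {\<omega> \<in> space M. next_mark_in (P \<omega> \<inter> unexplored p a) p a C}"
  \<comment> \<open>A total random variable is needed to speak of a distribution; the default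
    \<open>(-1, -1)\<close> is taken on a null event only.\<close>
  define f where "f \<omega> = (if next_mark_in (P \<omega> \<inter> unexplored p a) p a UNIV
    then mark p a (THE q. is_next (P \<omega> \<inter> unexplored p a) p q) else (-1, -1))" for \<omega>
  have f_in: "f \<omega> \<in> C \<longleftrightarrow> next_mark_in (P \<omega> \<inter> unexplored p a) p a C"
    if ex: "next_mark_in (P \<omega> \<inter> unexplored p a) p a UNIV" for \<omega> C
  proof -
    obtain q where q: "is_next (P \<omega> \<inter> unexplored p a) p q" using ex by (auto simp: next_mark_in_def)
    then have "(THE q. is_next (P \<omega> \<inter> unexplored p a) p q) = q" using is_next_unique by blast
    then have "f \<omega> = mark p a q" using ex by (simp add: f_def)
    then show ?thesis using q is_next_unique[OF q] unfolding next_mark_in_def by metis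
  qed
  have ex_mono: "next_mark_in (P \<omega> \<inter> unexplored p a) p a C \<Longrightarrow> next_mark_in (P \<omega> \<inter> unexplored p a) p a UNIV" for \<omega> C
    by (rule next_mark_in_mono) auto
  have f: "f \<in> borel_measurable M"
  proof (rule measurableI)
    fix C :: "(real \<times> real) set" assume C: "C \<in> sets borel"
    have "f -` C \<inter> space M = ?N C \<union> (if (-1, -1) \<in> C then space M - ?N UNIV else {})"
    proof (intro set_eqI)
      fix \<omega>
      show "\<omega> \<in> f -` C \<inter> space M \<longleftrightarrow> \<omega> \<in> ?N C \<union> (if (-1, -1) \<in> C then space M - ?N UNIV else {})"
      proof (cases "next_mark_in (P \<omega> \<inter> unexplored p a) p a UNIV")
        case True
        then show ?thesis using f_in[OF True, of C] ex_mono[of \<omega> C] by auto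
      next
        case False
        then have "f \<omega> = (-1, -1)" by (simp add: f_def)
        then show ?thesis using False ex_mono by auto
      qed
    qed
    also have "\<dots> \<in> events" using measurable_next_mark[OF C] measurable_next_mark[of UNIV] by auto
    finally show "f -` C \<inter> space M \<in> events" .
  qed simp
  have AE: "AE \<omega> in M. next_mark_in (P \<omega> \<inter> unexplored p a) p a UNIV"
    using next_mark_prob_ex measurable_next_mark[of UNIV] by (simp add: prob_eq_1)
  have f_prob: "emeasure (distr M borel f) C = ennreal (prob (?N C))" if C: "C \<in> sets borel" for C
  proof -
    have "emeasure (distr M borel f) C = emeasure M (f -` C \<inter> space M)"
      using f C by (simp add: emeasure_distr)
    also have "\<dots> = emeasure M (?N C)"
      using AE f C measurable_next_mark[OF C]
      by (intro emeasure_eq_AE) (auto simp: f_in elim!: eventually_mono)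
    finally show ?thesis by (simp add: emeasure_eq_measure)
  qed
  interpret D: prob_space "distr M borel f" by (rule prob_space_distr[OF f])
  have "distr M borel f = exp_law \<Otimes>\<^sub>M unit_law"
  proof (rule mark_law_eqI)
    show "finite_measure (distr M borel f)" by (rule D.finite_measure_axioms)
    fix x y :: real
    have B: "{..x} \<times> {..y} \<in> sets (borel :: (real \<times> real) measure)" by (intro borel_Times) auto
    show "emeasure (distr M borel f) ({..x} \<times> {..y}) = emeasure exp_law {..x} * emeasure unit_law {..y}"
    proof (cases "x < 0 \<or> y < 0")
      \<comment> \<open>Both coordinates of a mark are positive, so both sides vanish.\<close>
      case True
      have pos: "0 < fst (mark p a q) \<and> 0 < snd (mark p a q)" if "is_next (P \<omega> \<inter> unexplored p a) p q" "\<omega> \<in> space M" for \<omega> q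
      proof -
        have q: "q \<in> P \<omega>" "q \<in> unexplored p a" "snd q < snd p" using that by (auto simp: is_next_def)
        then show ?thesis
          using mark_pos_iff[OF p(2) q(3)] mark_ratio_bounds config_nonneg[OF config_P[OF that(2)] q(1)] by blast
      qed
      have E: "?N ({..x} \<times> {..y}) = {}"
        using True pos unfolding next_mark_in_def by (fastforce simp: mem_Times_iff)
      show ?thesis unfolding f_prob[OF B] E exp_law_atMost unit_law_atMost using True by (auto simp: ennreal_neg)
    next
      case False
      \<comment> \<open>Ratios never exceed 1, so neither side changes when \<open>y\<close> is cut
        off at 1.\<close>
      have "?N ({..x} \<times> {..y}) = ?N ({..x} \<times> {..min 1 y})"
      proof -
        have "snd (mark p a q) \<le> 1" if "is_next (P \<omega> \<inter> unexplored p a) p q" "\<omega> \<in> space M" for \<omega> q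
          using that mark_ratio_bounds(2) config_nonneg(2)[OF config_P[OF that(2)]] by (auto simp: is_next_def)
        then have eq: "mark p a q \<in> {..x} \<times> {..y} \<longleftrightarrow> mark p a q \<in> {..x} \<times> {..min 1 y}"
          if "is_next (P \<omega> \<inter> unexplored p a) p q" "\<omega> \<in> space M" for \<omega> q
          using that by (simp add: mem_Times_iff)
        then show ?thesis unfolding next_mark_in_def by (intro Collect_cong conj_cong refl ex_cong eq)
      qed
      then show ?thesis
        unfolding f_prob[OF B] exp_law_atMost unit_law_atMost
        using False next_mark_prob_rect[of x "min 1 y"] by (simp add: ennreal_mult)
    qed
  qed simp
  then show ?thesis using f_prob[OF C] by (simp add: measure_def)
qed

end

end

section \<open>The strong Markov property\<close>

text \<open>Indicators that stabilise pointwise converge, so dominated convergence applies.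
  \<open>B\<close> is measurable as the set of points lying in all but finitely many
  \<open>A m\<close>.\<close>

lemma (in prob_space) eventually_in_measure_tendsto:
  assumes A: "\<And>m. A m \<in> events" and B: "B \<subseteq> space M"
    and ev: "\<And>x. x \<in> space M \<Longrightarrow> eventually (\<lambda>m. x \<in> A m \<longleftrightarrow> x \<in> B) sequentially"
  shows "B \<in> events" and "(\<lambda>m. prob (A m)) \<longlonglongrightarrow> prob B"
proof -
  have "B = {x \<in> space M. \<exists>N. \<forall>m\<ge>N. x \<in> A m}"
  proof (intro set_eqI iffI)
    fix x assume x: "x \<in> B"
    then have "x \<in> space M" using B by auto
    from ev[OF this] x have "\<exists>N. \<forall>m\<ge>N. x \<in> A m" unfolding eventually_sequentially by blast
    then show "x \<in> {x \<in> space M. \<exists>N. \<forall>m\<ge>N. x \<in> A m}" using \<open>x \<in> space M\<close> by simp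
  next
    fix x assume "x \<in> {x \<in> space M. \<exists>N. \<forall>m\<ge>N. x \<in> A m}"
    then obtain N where x: "x \<in> space M" and N: "\<And>m. m \<ge> N \<Longrightarrow> x \<in> A m" by auto
    obtain N' where N': "\<And>m. m \<ge> N' \<Longrightarrow> x \<in> A m \<longleftrightarrow> x \<in> B"
      using ev[OF x] unfolding eventually_sequentially by auto
    show "x \<in> B" using N[of "max N N'"] N'[of "max N N'"] by simp
  qed
  also have "\<dots> \<in> events"
  proof -
    note [measurable] = A
    show ?thesis by measurable
  qed
  finally show BM: "B \<in> events" .
  have "(\<lambda>m. \<integral>x. indicator (A m) x \<partial>M) \<longlonglongrightarrow> (\<integral>x. indicator B x \<partial>M :: real)"
  proof (rule integral_dominated_convergence[where w = "\<lambda>_. 1"])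
    show "AE x in M. (\<lambda>m. indicator (A m) x) \<longlonglongrightarrow> (indicator B x :: real)"
    proof (rule AE_I2)
      fix x assume "x \<in> space M"
      from ev[OF this] show "(\<lambda>m. indicator (A m) x) \<longlonglongrightarrow> (indicator B x :: real)"
        by (rule tendsto_eventually[OF eventually_mono]) (simp add: indicator_def)
    qed
    show "AE x in M. norm (indicator (A m) x :: real) \<le> 1" for m
      by (auto simp: indicator_def)
  qed (use A BM in auto)
  moreover have "A m \<inter> space M = A m" for m using sets.sets_into_space[OF A[of m]] by blast
  moreover have "B \<inter> space M = B" using B by blast
  ultimately show "(\<lambda>m. prob (A m)) \<longlonglongrightarrow> prob B" by (simp add: Int_commute)
qed

text \<open>For \<open>g = rounding m p a\<close> these are the inequalities of
  \<open>unexplored p a\<close> scaled by \<open>Suc m\<close>, with the height rounded down, the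
  level up and the direction down. Each rounding shrinks the region; for the direction this uses
  that heights in the quadrant are nonnegative.\<close>

definition inner_region :: "nat \<Rightarrow> int \<times> int \<times> int \<Rightarrow> (real \<times> real) set" where
  "inner_region m = (\<lambda>(i, j, k). {q \<in> quadrant. real (Suc m) * snd q < i \<and> j - k * snd q < real (Suc m) * fst q})"

definition rounding :: "nat \<Rightarrow> real \<times> real \<Rightarrow> real \<Rightarrow> int \<times> int \<times> int" where
  "rounding m p a = (\<lfloor>real (Suc m) * snd p\<rfloor>, \<lceil>real (Suc m) * lvl a p\<rceil>, \<lfloor>real (Suc m) * a\<rfloor>)"

lemma inner_region_borel: "inner_region m g \<in> sets borel"
proof -
  have "{q \<in> space borel. (0 \<le> fst q \<and> 0 \<le> snd q) \<and> real (Suc m) * snd q < i \<and> j - k * snd q < real (Suc m) * fst q}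
    \<in> sets (borel :: (real \<times> real) measure)" for i j k :: int
    by measurable
  then show ?thesis
    by (cases g) (simp add: inner_region_def mem_Times_iff)
qed

lemma inner_region_subset: "inner_region m (rounding m p a) \<subseteq> unexplored p a"
proof
  fix q assume "q \<in> inner_region m (rounding m p a)"
  then have q: "0 \<le> snd q" "real (Suc m) * snd q < \<lfloor>real (Suc m) * snd p\<rfloor>"
    "\<lceil>real (Suc m) * lvl a p\<rceil> - \<lfloor>real (Suc m) * a\<rfloor> * snd q < real (Suc m) * fst q"
    by (auto simp: inner_region_def rounding_def)
  have "real (Suc m) * snd q < real (Suc m) * snd p" using q(2) by linarith
  then have 1: "snd q < snd p" by simp
  have "real_of_int \<lfloor>real (Suc m) * a\<rfloor> * snd q \<le> (real (Suc m) * a) * snd q"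
    using q(1) by (intro mult_right_mono) auto
  moreover have "real (Suc m) * lvl a p \<le> \<lceil>real (Suc m) * lvl a p\<rceil>" by simp
  ultimately have "real (Suc m) * lvl a p < real (Suc m) * fst q + (real (Suc m) * a) * snd q"
    using q(3) by linarith
  also have "\<dots> = real (Suc m) * lvl a q" by (simp add: lvl_def algebra_simps)
  finally show "q \<in> unexplored p a" using 1 by (simp add: unexplored_def)
qed

lemma eventually_inner_region:
  assumes q: "q \<in> quadrant" "q \<in> unexplored p a"
  shows "eventually (\<lambda>m. q \<in> inner_region m (rounding m p a)) sequentially"
proof -
  have q': "0 \<le> fst q" "0 \<le> snd q" "0 < snd p - snd q" "0 < lvl a q - lvl a p"
    using q by (auto simp: mem_Times_iff unexplored_def)
  have large: "eventually (\<lambda>m. b < real (Suc m) * c) sequentially" if "0 < c" for b c :: real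
  proof -
    have "filterlim (\<lambda>m. real (Suc m) * c) at_top sequentially"
      by (intro filterlim_at_top_mult_tendsto_pos[OF tendsto_const that]
        filterlim_compose[OF filterlim_real_sequentially filterlim_Suc])
    then show ?thesis by (simp add: filterlim_at_top_dense)
  qed
  \<comment> \<open>The inequalities at \<open>q\<close> are strict, so for large \<open>m\<close>
    the scaled slack exceeds the rounding errors: 1 for the height, and \<open>1 + snd q\<close> for
    the level together with the direction, whose error is multiplied by
    \<open>snd q\<close>.\<close>
  show ?thesis
    using large[OF q'(3), of 1] large[OF q'(4), of "1 + snd q"]
  proof eventually_elim
    case (elim m)
    have 1: "real (Suc m) * snd q < \<lfloor>real (Suc m) * snd p\<rfloor>"
      using elim(1) unfolding right_diff_distrib by linarith
    have "(real (Suc m) * a - 1) * snd q \<le> \<lfloor>real (Suc m) * a\<rfloor> * snd q"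
      using q'(2) by (intro mult_right_mono) linarith+
    moreover have "\<lceil>real (Suc m) * lvl a p\<rceil> \<le> real (Suc m) * lvl a p + 1" by linarith
    ultimately have "\<lceil>real (Suc m) * lvl a p\<rceil> - \<lfloor>real (Suc m) * a\<rfloor> * snd q
        \<le> real (Suc m) * lvl a p + 1 - (real (Suc m) * a - 1) * snd q" by linarith
    also have "\<dots> = real (Suc m) * fst q - (real (Suc m) * (lvl a q - lvl a p) - (1 + snd q))"
      by (simp add: lvl_def algebra_simps)
    also have "\<dots> < real (Suc m) * fst q" using elim(2) by simp
    finally show ?case using 1 q by (simp add: inner_region_def rounding_def)
  qed
qed

lemma is_next_subset: "is_next Y p q \<Longrightarrow> Z \<subseteq> Y \<Longrightarrow> q \<in> Z \<Longrightarrow> is_next Z p q"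
  unfolding is_next_def by blast

lemma next_mark_in_iff: "is_next Y p q \<Longrightarrow> next_mark_in Y p a C \<longleftrightarrow> mark p a q \<in> C"
  unfolding next_mark_in_def using is_next_unique by blast

text \<open>Once the inner region contains the next point, that point remains first among fewer
  competitors.\<close>

lemma eventually_next_mark_in_inner:
  assumes Y: "config Y"
  shows "eventually (\<lambda>m. next_mark_in (Y \<inter> inner_region m (rounding m p a)) p a C \<longleftrightarrow>
    next_mark_in (Y \<inter> unexplored p a) p a C) sequentially"
proof (cases "\<exists>q. is_next (Y \<inter> unexplored p a) p q")
  case True
  then obtain q where q: "is_next (Y \<inter> unexplored p a) p q" by auto
  then have q': "q \<in> Y" "q \<in> unexplored p a" by (auto simp: is_next_def)
  then have "q \<in> quadrant" using Y by (auto simp: config_def)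
  from eventually_inner_region[OF this q'(2)] show ?thesis
  proof eventually_elim
    case (elim m)
    have "is_next (Y \<inter> inner_region m (rounding m p a)) p q"
      using inner_region_subset[of m p a] elim q' by (intro is_next_subset[OF q]) blast+
    then show ?case using q by (simp add: next_mark_in_iff)
  qed
next
  case False
  have "config (Y \<inter> unexplored p a)" using config_subset[OF Y] by auto
  \<comment> \<open>Every unexplored point is below \<open>p\<close> and would give rise to a next
    vertex.\<close>
  then have E: "Y \<inter> unexplored p a = {}"
    using False ex_is_next[of "Y \<inter> unexplored p a" _ p] by (force simp: unexplored_def)
  have "\<not> next_mark_in (Y \<inter> unexplored p a) p a C"
    using False by (auto simp: next_mark_in_def)
  moreover have "\<not> next_mark_in (Y \<inter> inner_region m (rounding m p a)) p a C" for m
  proof -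
    have "Y \<inter> inner_region m (rounding m p a) = {}" using E inner_region_subset by blast
    then show ?thesis by (simp add: next_mark_in_def is_next_def)
  qed
  ultimately show ?thesis by simp
qed

text \<open>The positive height is what \<open>next_mark_law\<close> requires of the vertex from
  which the next step starts.\<close>

definition history :: "nat \<Rightarrow> (nat \<Rightarrow> (real \<times> real) set) \<Rightarrow> (real \<times> real) set \<Rightarrow> bool" where
  "history n A Y \<longleftrightarrow> alive Y n \<and> 0 < snd (hull_pt Y n) \<and> (\<forall>j\<le>n. marks Y j \<in> A j)"

lemma history_cong_unexplored:
  assumes "config Y" "config Y'" "history n A Y"
    and "G \<subseteq> unexplored (hull_pt Y n) (hull_a Y n)" "Y - G = Y' - G"
  shows "history n A Y'"
proof -
  have al: "alive Y n" using assms(3) by (simp add: history_def)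
  note st = hull_pt_cong_unexplored[OF assms(1,2) al assms(4,5)]
  have "marks Y' j = marks Y j" if "j \<le> n" for j
    using that st[of j] st[of "j - 1"] by (cases j) (simp_all add: marks_def del: jump_time.simps)
  then show ?thesis
    using assms(3) alive_cong_unexplored[OF assms(1,2) al assms(4,5)] st[of n] by (simp add: history_def)
qed

text \<open>Rounding to \<open>g\<close> forces \<open>G\<close> into the unexplored region of
  whichever configuration satisfies the condition, so the other one satisfies it too. The past thus
  becomes an event of \<open>config_algebra (- G)\<close>, although the region that it leaves
  unexplored is random.\<close>

lemma history_remove_inner:
  assumes Y: "config Y" and G: "G = inner_region m g"
  shows "history n A (Y - G) \<and> rounding m (hull_pt (Y - G) n) (hull_a (Y - G) n) = g \<and> Q (hull_pt (Y - G) n) (hull_a (Y - G) n)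
    \<longleftrightarrow> history n A Y \<and> rounding m (hull_pt Y n) (hull_a Y n) = g \<and> Q (hull_pt Y n) (hull_a Y n)"
proof -
  have *: "history n A Z \<and> rounding m (hull_pt Z n) (hull_a Z n) = g \<and> Q (hull_pt Z n) (hull_a Z n) \<Longrightarrow>
      history n A Z' \<and> rounding m (hull_pt Z' n) (hull_a Z' n) = g \<and> Q (hull_pt Z' n) (hull_a Z' n)"
    if Z: "config Z" "config Z'" "Z - G = Z' - G" for Z Z'
  proof -
    assume h: "history n A Z \<and> rounding m (hull_pt Z n) (hull_a Z n) = g \<and> Q (hull_pt Z n) (hull_a Z n)"
    then have sub: "G \<subseteq> unexplored (hull_pt Z n) (hull_a Z n)" using inner_region_subset G by metis
    have "alive Z n" using h by (simp add: history_def)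
    from hull_pt_cong_unexplored[OF Z(1,2) this sub Z(3), of n]
      history_cong_unexplored[OF Z(1,2) _ sub Z(3)] h
    show ?thesis by simp
  qed
  have Z: "config (Y - G)" by (rule config_subset[OF Y Diff_subset])
  show ?thesis
    by (rule iffI) (rule *[OF Z Y _], simp, assumption, rule *[OF Y Z _], simp, assumption)
qed

text \<open>No point below a vertex lies on or before its supporting line, so cutting down to the
  unexplored region loses no candidate.\<close>

lemma next_mark_in_unexplored_hull:
  assumes Y: "config Y" "Y \<noteq> {}"
  shows "next_mark_in (Y \<inter> unexplored (hull_pt Y n) (hull_a Y n)) (hull_pt Y n) (hull_a Y n) C \<longleftrightarrow>
    (\<exists>q. is_next Y (hull_pt Y n) q) \<and> marks Y (Suc n) \<in> C"
proof -
  let ?p = "hull_pt Y n" and ?a = "hull_a Y n"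
  have "q \<in> unexplored ?p ?a" if "q \<in> Y" "snd q < snd ?p" for q
    using is_W_less_slope[OF is_W_hull_pt[OF Y] that] slope_less_iff[OF that(2)] that(2)
    by (simp add: unexplored_def)
  then have "is_next (Y \<inter> unexplored ?p ?a) ?p q \<longleftrightarrow> is_next Y ?p q" for q
    unfolding is_next_def by blast
  moreover have "mark ?p ?a q = marks Y (Suc n)" if "is_next Y ?p q" for q
    using hull_next[OF Y(1) Y(1) that] by (simp add: mark_def marks_def del: jump_time.simps)
  ultimately show ?thesis unfolding next_mark_in_def by metis
qed

context measurable_config
begin

lemma history_measurable:
  assumes [measurable]: "\<And>j. A j \<in> sets borel"
  shows "Measurable.pred K (\<lambda>\<omega>. history n A (Y \<omega>))"
proof -
  note [measurable] = hull_pt_measurable marks_measurable alive_measurable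
  show ?thesis unfolding history_def by measurable
qed

lemma rounding_measurable:
  "(\<lambda>\<omega>. rounding m (hull_pt (Y \<omega>) n) (hull_a (Y \<omega>) n)) \<in> measurable K (count_space UNIV)"
proof -
  note [measurable] = hull_pt_measurable hull_a_measurable
  show ?thesis unfolding rounding_def by measurable
qed

end

section \<open>Exchange of the unexplored points for those of an independent copy\<close>

context quadrant_poisson
begin

context
  fixes A :: "nat \<Rightarrow> (real \<times> real) set" and C :: "(real \<times> real) set" and n :: nat
  assumes A: "\<And>j. A j \<in> sets borel" and C: "C \<in> sets borel"
begin

abbreviation pt where "pt \<omega> \<equiv> hull_pt (P \<omega>) n"
abbreviation dir where "dir \<omega> \<equiv> hull_a (P \<omega>) n"

text \<open>For a single value \<open>g\<close> of the rounding the region is deterministic. The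
  past is read off outside it and the next mark from the points inside it, two independent sources
  to which \<open>emeasure_diagonal_indep\<close> applies.\<close>

lemma two_copies_rounded_cell:
  fixes m :: nat and g :: "int \<times> int \<times> int"
  defines "E \<equiv> {x \<in> space (M \<Otimes>\<^sub>M M). history n A (P (fst x)) \<and> rounding m (pt (fst x)) (dir (fst x)) = g \<and>
      next_mark_in (P (snd x) \<inter> inner_region m g) (pt (fst x)) (dir (fst x)) C}"
    and "D \<equiv> {\<omega> \<in> space M. history n A (P \<omega>) \<and> rounding m (pt \<omega>) (dir \<omega>) = g \<and>
      next_mark_in (P \<omega> \<inter> inner_region m g) (pt \<omega>) (dir \<omega>) C}"
  shows "E \<in> sets (M \<Otimes>\<^sub>M M)" "D \<in> events" "emeasure M D = emeasure (M \<Otimes>\<^sub>M M) E"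
proof -
  define G where "G = inner_region m g"
  let ?K = "config_algebra (- G)" and ?L = "config_algebra G"
  have GB: "- G \<in> sets borel" "G \<in> sets borel" using inner_region_borel[of m g] by (auto simp: G_def)
  have ind: "indep_set (sets ?K) (sets ?L)" by (rule indep_config_algebra[OF GB]) auto
  interpret K: measurable_config ?K "\<lambda>\<omega>. P \<omega> \<inter> - G" by (rule measurable_config_restrict)
  interpret L: measurable_config ?L "\<lambda>\<omega>. P \<omega> \<inter> G" by (rule measurable_config_restrict)
  note [measurable] = K.hull_pt_measurable[of n] K.hull_a_measurable[of n]
    K.history_measurable[OF A, of n] K.rounding_measurable[of m n]
  have [measurable]: "Measurable.pred (?K \<Otimes>\<^sub>M ?L) (\<lambda>x. next_mark_in (P (snd x) \<inter> G)
      (hull_pt (P (fst x) \<inter> - G) n) (hull_a (P (fst x) \<inter> - G) n) C)"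
    by (rule L.next_mark_measurable[where f = snd]) (use C in measurable)
  \<comment> \<open>This is \<open>E\<close> with the points of \<open>G\<close> erased from the
    first copy, which exhibits it as an event of the product of the two algebras.\<close>
  let ?E = "{x \<in> space (?K \<Otimes>\<^sub>M ?L). history n A (P (fst x) \<inter> - G) \<and>
     rounding m (hull_pt (P (fst x) \<inter> - G) n) (hull_a (P (fst x) \<inter> - G) n) = g \<and>
     next_mark_in (P (snd x) \<inter> G) (hull_pt (P (fst x) \<inter> - G) n) (hull_a (P (fst x) \<inter> - G) n) C}"
  have E: "?E \<in> sets (?K \<Otimes>\<^sub>M ?L)" by measurable
  have eq: "?E = E"
  proof (intro set_eqI)
    fix x
    show "x \<in> ?E \<longleftrightarrow> x \<in> E"
    proof (cases "x \<in> space (M \<Otimes>\<^sub>M M)")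
      case True
      then have "fst x \<in> space M" by (auto simp: space_pair_measure)
      from history_remove_inner[OF config_P[OF this] G_def, of n A "\<lambda>p a. next_mark_in (P (snd x) \<inter> G) p a C"]
      show ?thesis
        using True unfolding E_def G_def[symmetric] Diff_eq[symmetric] by (simp add: space_pair_measure)
    next
      case False
      then show ?thesis by (simp add: E_def space_pair_measure)
    qed
  qed
  show EM: "E \<in> sets (M \<Otimes>\<^sub>M M)"
    using emeasure_diagonal_indep(1)[OF ind _ _ E] eq by simp
  have "{\<omega> \<in> space M. (\<omega>, \<omega>) \<in> E} = D"
    by (auto simp: E_def D_def space_pair_measure)
  then show "emeasure M D = emeasure (M \<Otimes>\<^sub>M M) E"
    using emeasure_diagonal_indep(2)[OF ind _ _ E] eq by simp
  have "(\<lambda>\<omega>. (\<omega>, \<omega>)) \<in> measurable M (M \<Otimes>\<^sub>M M)" by measurable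
  from measurable_sets[OF this EM] show "D \<in> events"
    using \<open>{\<omega> \<in> space M. (\<omega>, \<omega>) \<in> E} = D\<close> by (simp add: vimage_def Int_def conj_commute)
qed

text \<open>The rounding takes countably many values, over which the identity for a fixed value is
  summed.\<close>

lemma two_copies_rounded:
  fixes m :: nat
  defines "E \<equiv> {x \<in> space (M \<Otimes>\<^sub>M M). history n A (P (fst x)) \<and>
      next_mark_in (P (snd x) \<inter> inner_region m (rounding m (pt (fst x)) (dir (fst x)))) (pt (fst x)) (dir (fst x)) C}"
    and "D \<equiv> {\<omega> \<in> space M. history n A (P \<omega>) \<and>
      next_mark_in (P \<omega> \<inter> inner_region m (rounding m (pt \<omega>) (dir \<omega>))) (pt \<omega>) (dir \<omega>) C}"
  shows "E \<in> sets (M \<Otimes>\<^sub>M M)" "D \<in> events" "emeasure M D = emeasure (M \<Otimes>\<^sub>M M) E"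
proof -
  define Eg where "Eg g = {x \<in> space (M \<Otimes>\<^sub>M M). history n A (P (fst x)) \<and> rounding m (pt (fst x)) (dir (fst x)) = g \<and>
      next_mark_in (P (snd x) \<inter> inner_region m g) (pt (fst x)) (dir (fst x)) C}" for g
  define Dg where "Dg g = {\<omega> \<in> space M. history n A (P \<omega>) \<and> rounding m (pt \<omega>) (dir \<omega>) = g \<and>
      next_mark_in (P \<omega> \<inter> inner_region m g) (pt \<omega>) (dir \<omega>) C}" for g
  note cell = two_copies_rounded_cell[of m, folded Eg_def Dg_def]
  have E: "E = (\<Union>g. Eg g)" unfolding E_def Eg_def by auto
  have D: "D = (\<Union>g. Dg g)" unfolding D_def Dg_def by auto
  show "E \<in> sets (M \<Otimes>\<^sub>M M)" unfolding E using cell(1) by auto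
  show "D \<in> events" unfolding D using cell(2) by auto
  have "emeasure M D = (\<integral>\<^sup>+g. emeasure M (Dg g) \<partial>count_space UNIV)"
    unfolding D using cell(2) by (intro emeasure_UN_countable) (auto simp: disjoint_family_on_def Dg_def)
  also have "\<dots> = (\<integral>\<^sup>+g. emeasure (M \<Otimes>\<^sub>M M) (Eg g) \<partial>count_space UNIV)"
    using cell(3) by simp
  also have "\<dots> = emeasure (M \<Otimes>\<^sub>M M) E"
    unfolding E using cell(1) by (intro emeasure_UN_countable[symmetric]) (auto simp: disjoint_family_on_def Eg_def)
  finally show "emeasure M D = emeasure (M \<Otimes>\<^sub>M M) E" .
qed

text \<open>As the rounding is refined, both sides of the two-copy identity converge. On the product
  space the first copy fixes vertex and direction, so integrating out the second brings in the law
  of the next mark for a deterministic vertex, which is the same for all vertices.\<close>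

lemma strong_markov:
  defines "D \<equiv> {\<omega> \<in> space M. history n A (P \<omega>) \<and> next_mark_in (P \<omega> \<inter> unexplored (pt \<omega>) (dir \<omega>)) (pt \<omega>) (dir \<omega>) C}"
  shows "D \<in> events"
    "prob D = prob {\<omega> \<in> space M. history n A (P \<omega>)} * measure (exp_law \<Otimes>\<^sub>M unit_law) C"
proof -
  interpret MM: pair_prob_space M M ..
  let ?E = "{x \<in> space (M \<Otimes>\<^sub>M M). history n A (P (fst x)) \<and>
      next_mark_in (P (snd x) \<inter> unexplored (pt (fst x)) (dir (fst x))) (pt (fst x)) (dir (fst x)) C}"
  note tc = two_copies_rounded
  have ev: "eventually (\<lambda>m. next_mark_in (P \<omega>' \<inter> inner_region m (rounding m (pt \<omega>) (dir \<omega>))) (pt \<omega>) (dir \<omega>) C \<longleftrightarrow>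
      next_mark_in (P \<omega>' \<inter> unexplored (pt \<omega>) (dir \<omega>)) (pt \<omega>) (dir \<omega>) C) sequentially" if "\<omega>' \<in> space M" for \<omega> \<omega>'
    by (rule eventually_next_mark_in_inner[OF config_P[OF that]])
  have ev_D: "eventually (\<lambda>m. \<omega> \<in> {\<omega> \<in> space M. history n A (P \<omega>) \<and>
      next_mark_in (P \<omega> \<inter> inner_region m (rounding m (pt \<omega>) (dir \<omega>))) (pt \<omega>) (dir \<omega>) C} \<longleftrightarrow> \<omega> \<in> D) sequentially"
    if "\<omega> \<in> space M" for \<omega>
    using ev[OF that, of \<omega>] by eventually_elim (simp add: D_def)
  have ev_E: "eventually (\<lambda>m. x \<in> {x \<in> space (M \<Otimes>\<^sub>M M). history n A (P (fst x)) \<and>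
      next_mark_in (P (snd x) \<inter> inner_region m (rounding m (pt (fst x)) (dir (fst x)))) (pt (fst x)) (dir (fst x)) C} \<longleftrightarrow> x \<in> ?E) sequentially"
    if "x \<in> space (M \<Otimes>\<^sub>M M)" for x
  proof -
    have "snd x \<in> space M" using that by (auto simp: space_pair_measure)
    from ev[OF this, of "fst x"] show ?thesis by eventually_elim simp
  qed
  have "D \<subseteq> space M" by (auto simp: D_def)
  note D = eventually_in_measure_tendsto[OF tc(2) this ev_D]
  have "?E \<subseteq> space (M \<Otimes>\<^sub>M M)" by auto
  note E = MM.P.eventually_in_measure_tendsto[OF tc(1) this ev_E]
  show "D \<in> events" by (rule D(1))
  have "prob D = measure (M \<Otimes>\<^sub>M M) ?E"
    using D(2) E(2) unfolding measure_def tc(3) by (rule LIMSEQ_unique)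
  have "emeasure (M \<Otimes>\<^sub>M M) ?E = (\<integral>\<^sup>+\<omega>. emeasure M (Pair \<omega> -` ?E) \<partial>M)"
    using E(1) by (rule emeasure_pair_measure_alt)
  also have "\<dots> = (\<integral>\<^sup>+\<omega>. ennreal (measure (exp_law \<Otimes>\<^sub>M unit_law) C) * indicator {\<omega> \<in> space M. history n A (P \<omega>)} \<omega> \<partial>M)"
  proof (rule nn_integral_cong)
    fix \<omega> assume \<omega>: "\<omega> \<in> space M"
    show "emeasure M (Pair \<omega> -` ?E) = ennreal (measure (exp_law \<Otimes>\<^sub>M unit_law) C) * indicator {\<omega> \<in> space M. history n A (P \<omega>)} \<omega>"
    proof (cases "history n A (P \<omega>)")
      case True
      then have ne: "P \<omega> \<noteq> {}" "0 < snd (pt \<omega>)" by (auto simp: history_def alive_def)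
      have "pt \<omega> \<in> P \<omega>" using is_W_hull_pt[OF config_P[OF \<omega>] ne(1)] by (simp add: is_W_def)
      then have "0 \<le> fst (pt \<omega>)" by (rule config_nonneg[OF config_P[OF \<omega>]])
      moreover have "0 \<le> dir \<omega>" using hull_a_ge_1[OF config_P[OF \<omega>], of n] by simp
      moreover have "Pair \<omega> -` ?E = {\<omega>' \<in> space M. next_mark_in (P \<omega>' \<inter> unexplored (pt \<omega>) (dir \<omega>)) (pt \<omega>) (dir \<omega>) C}"
        using True \<omega> by (auto simp: space_pair_measure)
      ultimately show ?thesis
        using next_mark_law[OF _ ne(2) _ C] True \<omega> by (simp add: emeasure_eq_measure)
    next
      case False
      then have "Pair \<omega> -` ?E = {}" by auto
      then show ?thesis using False by simp
    qed
  qed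
  also have "\<dots> = ennreal (measure (exp_law \<Otimes>\<^sub>M unit_law) C) * emeasure M {\<omega> \<in> space M. history n A (P \<omega>)}"
    using history_measurable[OF A, of n] by (intro nn_integral_cmult_indicator) (simp add: pred_def)
  also have "\<dots> = ennreal (measure (exp_law \<Otimes>\<^sub>M unit_law) C * prob {\<omega> \<in> space M. history n A (P \<omega>)})"
    by (simp add: emeasure_eq_measure ennreal_mult)
  finally have "measure (M \<Otimes>\<^sub>M M) ?E = measure (exp_law \<Otimes>\<^sub>M unit_law) C * prob {\<omega> \<in> space M. history n A (P \<omega>)}"
    unfolding measure_def[of "M \<Otimes>\<^sub>M M"] by simp
  then show "prob D = prob {\<omega> \<in> space M. history n A (P \<omega>)} * measure (exp_law \<Otimes>\<^sub>M unit_law) C"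
    using \<open>prob D = measure (M \<Otimes>\<^sub>M M) ?E\<close> by simp
qed

end

end

section \<open>Areas and length ratios\<close>

text \<open>The apex has barycentric weight \<open>y / v\<close>, and the remaining weight is shared
  between the ends of the base.\<close>

lemma triangle_section:
  fixes u v b c :: real
  assumes v: "v \<noteq> 0" and bc: "b \<le> c"
  shows "(x, y) \<in> convex hull {(u, v), (b, 0), (c, 0)} \<longleftrightarrow>
    0 \<le> y / v \<and> y / v \<le> 1 \<and> y / v * u + (1 - y / v) * b \<le> x \<and> x \<le> y / v * u + (1 - y / v) * c"
    (is "?L \<longleftrightarrow> ?R")
proof
  assume ?L
  then obtain r s t where rst: "0 \<le> r" "0 \<le> s" "0 \<le> t" "r + s + t = 1"
    "x = r * u + s * b + t * c" "y = r * v"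
    unfolding convex_hull_3 by auto
  have yv: "y / v = r" and e: "1 - r = s + t" using rst v by auto
  have "(1 - r) * b = s * b + t * b" "(1 - r) * c = s * c + t * c" unfolding e by (simp_all add: distrib_right)
  moreover have "t * b \<le> t * c" "s * b \<le> s * c" using rst bc by (auto intro: mult_left_mono)
  ultimately show ?R unfolding yv using rst by linarith
next
  assume R: ?R
  let ?r = "y / v"
  \<comment> \<open>The distance from the left edge along the section; its proportion to the base
    gives the weight of the right corner.\<close>
  define d where "d = x - ?r * u - (1 - ?r) * b"
  have d: "0 \<le> d" "d \<le> (1 - ?r) * (c - b)" using R unfolding d_def right_diff_distrib by linarith+
  obtain t where t: "0 \<le> t" "t \<le> 1 - ?r" "d = t * (c - b)"
  proof (cases "b = c")
    case True
    then show ?thesis using d R by (intro that[of 0]) auto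
  next
    case False
    then show ?thesis using bc d R by (intro that[of "d / (c - b)"]) (auto simp: divide_le_eq)
  qed
  show ?L
    unfolding convex_hull_3
    using t R v
    by (intro CollectI exI[of _ ?r] exI[of _ "1 - ?r - t"] exI[of _ t])
      (auto simp: d_def algebra_simps)
qed

lemma compact_triangle: "compact (convex hull {p, q, r :: real \<times> real})"
  by (intro finite_imp_compact_convex_hull) simp

text \<open>No sign is imposed on \<open>v\<close>, because the corner triangle is also evaluated
  for negative \<open>s\<close>: without points the level of the first line is unspecified.\<close>

lemma measure_triangle:
  fixes u v b c :: real
  assumes bc: "b \<le> c"
  shows "measure lborel (convex hull {(u, v), (b, 0), (c, 0)}) = \<bar>v\<bar> * (c - b) / 2"
proof -
  let ?T = "convex hull {(u, v), (b, 0), (c, 0)}"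
  have T: "?T \<in> sets borel" using compact_triangle by (intro borel_closed compact_imp_closed)
  have fub: "emeasure lborel ?T = (\<integral>\<^sup>+ y. emeasure lborel ((\<lambda>x. (x, y)) -` ?T) \<partial>lborel)"
    by (subst lborel_prod[symmetric], subst lborel_pair.emeasure_pair_measure_alt2)
      (use T in \<open>simp_all only: lborel_prod sets_lborel\<close>)
  show ?thesis
  proof (cases "v = 0")
    case True
    have "?T \<subseteq> UNIV \<times> {0}"
      by (rule hull_minimal) (auto simp: True intro: convex_Times)
    then have "(\<lambda>x. (x, y)) -` ?T = {}" if "y \<noteq> 0" for y using that by auto
    moreover have "AE y in lborel. y \<noteq> (0 :: real)" by (rule AE_lborel_singleton)
    ultimately have "emeasure lborel ?T = (\<integral>\<^sup>+ y. 0 \<partial>(lborel :: real measure))"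
      unfolding fub by (intro nn_integral_cong_AE) (auto elim!: eventually_mono)
    then show ?thesis using True by (simp add: measure_def)
  next
    case False
    let ?I = "{min 0 v .. max 0 v}"
    have I: "0 \<le> y / v \<and> y / v \<le> 1 \<longleftrightarrow> y \<in> ?I" for y
      using False by (cases "0 < v") (auto simp: zero_le_divide_iff divide_le_eq_1 min_def max_def)
    have "emeasure lborel ?T = (\<integral>\<^sup>+ y. ennreal ((1 - y / v) * (c - b)) * indicator ?I y \<partial>lborel)"
      unfolding fub
    proof (rule nn_integral_cong)
      fix y :: real
      have "(\<lambda>x. (x, y)) -` ?T = (if y \<in> ?I then {y / v * u + (1 - y / v) * b .. y / v * u + (1 - y / v) * c} else {})"
        unfolding I[symmetric] by (intro set_eqI) (simp only: vimage_eq triangle_section[OF False bc] atLeastAtMost_iff empty_iff split: if_split, blast)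
      moreover have "(1 - y / v) * b \<le> (1 - y / v) * c" if "y \<in> ?I"
        using that bc I[of y] by (intro mult_left_mono) auto
      ultimately show "emeasure lborel ((\<lambda>x. (x, y)) -` ?T) = ennreal ((1 - y / v) * (c - b)) * indicator ?I y"
        by (simp add: right_diff_distrib)
    qed
    also have "\<dots> = ennreal ((max 0 v - (max 0 v)\<^sup>2 / (2 * v)) * (c - b) - (min 0 v - (min 0 v)\<^sup>2 / (2 * v)) * (c - b))"
    proof (rule nn_integral_FTC_Icc)
      fix y assume y: "y \<in> ?I"
      show "DERIV (\<lambda>y. (y - y\<^sup>2 / (2 * v)) * (c - b)) y :> (1 - y / v) * (c - b)"
        using False by (auto intro!: derivative_eq_intros simp: field_simps)
      show "0 \<le> (1 - y / v) * (c - b)" using y I[of y] bc by (intro mult_nonneg_nonneg) auto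
    qed auto
    also have "(max 0 v - (max 0 v)\<^sup>2 / (2 * v)) * (c - b) - (min 0 v - (min 0 v)\<^sup>2 / (2 * v)) * (c - b) = \<bar>v\<bar> * (c - b) / 2"
      using False by (auto simp: min_def max_def power2_eq_square field_simps)
    finally show ?thesis using bc by (simp add: measure_def)
  qed
qed

definition corner_area :: "real \<times> real \<Rightarrow> real" where
  "corner_area w = (fst w + snd w)\<^sup>2 / 2"

lemma measure_corner_triangle: "measure lborel (convex hull {(0, 0), (s, 0), (0, s)}) = s\<^sup>2 / 2"
proof (cases "0 \<le> s")
  case True
  have "{(0, 0), (s, 0), (0, s)} = {(0, s), (0, 0), (s, 0)}" by auto
  then show ?thesis using measure_triangle[OF True, of 0 s] True by (simp add: power2_eq_square)
next
  case False
  have "{(0, 0), (s, 0), (0, s)} = {(0, s), (s, 0), (0, 0)}" by auto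
  then show ?thesis using measure_triangle[of s 0 0 s] False by (simp add: power2_eq_square)
qed

lemma line_level_eq: "line_level Y (hull_a Y n) = lvl (hull_a Y n) (hull_pt Y n)"
  by (simp add: line_level_def lvl_def hull_pt_def hull_W_def)

lemma triangle_area_0: "triangle_area Y 0 = corner_area (marks Y 0)"
  using measure_corner_triangle[of "line_level Y 1"] line_level_eq[of Y 0]
  by (simp add: triangle_area_def corner_area_def marks_def lvl_def)

text \<open>Both lines pass through the old vertex, so the base, the difference of their intercepts,
  is the change of direction times the height of that vertex.\<close>

lemma triangle_area_Suc:
  assumes Y: "config Y"
  shows "triangle_area Y (Suc n) = fst (marks Y (Suc n))"
proof -
  let ?p = "hull_pt Y n" and ?a = "hull_a Y n" and ?q = "hull_pt Y (Suc n)" and ?b = "hull_a Y (Suc n)"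
  let ?c = "lvl ?a ?p" and ?d = "lvl ?b ?q"
  have T: "triangle_area Y (Suc n) = measure lborel (convex hull {?p, (?c, 0), (?d, 0)})"
    by (simp add: triangle_area_def line_level_eq hull_pt_def[symmetric] del: jump_time.simps)
  have level: "?d = lvl ?b ?p"
  proof (cases "\<exists>q. is_next Y ?p q")
    case True
    then obtain q where q: "is_next Y ?p q" by auto
    then show ?thesis using hull_next[OF Y Y q] lvl_slope[of q ?p] by (simp add: is_next_def del: jump_time.simps)
  next
    case False
    then show ?thesis using hull_no_next[OF Y Y False] by (simp del: jump_time.simps)
  qed
  then have diff: "?d - ?c = (?b - ?a) * snd ?p" by (simp add: lvl_def algebra_simps)
  have "?c \<le> ?d \<and> \<bar>snd ?p\<bar> * (?d - ?c) = (snd ?p)\<^sup>2 * (?b - ?a)"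
  proof (cases "Y = {}")
    case True
    \<comment> \<open>The unspecified vertex may have a height of either sign here, but the base has
      length 0.\<close>
    then have "\<nexists>q. is_next Y ?p q" by (simp add: is_next_def)
    then have "?b = ?a" using hull_no_next[OF Y Y] by blast
    then show ?thesis using diff by simp
  next
    case False
    have "?p \<in> Y" using is_W_hull_pt[OF Y False] by (simp add: is_W_def)
    then have "0 \<le> snd ?p" by (rule config_nonneg[OF Y])
    moreover have "?a \<le> ?b" by (rule hull_a_mono_Suc[OF Y])
    ultimately have "0 \<le> (?b - ?a) * snd ?p" by simp
    then show ?thesis using diff \<open>0 \<le> snd ?p\<close> by (simp add: power2_eq_square del: jump_time.simps)
  qed
  moreover have "?p = (fst ?p, snd ?p)" by simp
  ultimately show ?thesis
    using measure_triangle[of ?c ?d "fst ?p" "snd ?p"] unfolding T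
    by (simp add: marks_def del: jump_time.simps)
qed

lemma length_ratio_Suc:
  assumes Y: "config Y"
  shows "length_ratio Y (Suc n) = snd (marks Y (Suc n))"
proof -
  let ?p = "hull_pt Y n" and ?q = "hull_pt Y (Suc n)"
  let ?r = "x_axis_crossing ?p ?q"
  have L: "length_ratio Y (Suc n) = (dist ?p ?q)\<^sup>2 / (dist ?p ?r)\<^sup>2"
    by (simp add: length_ratio_def edge_length_def extended_length_def Let_def hull_pt_def[symmetric] del: jump_time.simps)
  show ?thesis
  proof (cases "\<exists>q. is_next Y ?p q")
    \<comment> \<open>Without a further jump \<open>S\<close> is 0, and so are both sides.\<close>
    case False
    then show ?thesis using hull_no_next[OF Y Y False] by (simp add: L marks_def del: jump_time.simps)
  next
    case True
    then obtain q where q: "is_next Y ?p q" by auto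
    then have qp: "?q = q" "snd q < snd ?p" "q \<in> Y" using hull_next[OF Y Y q] by (auto simp: is_next_def)
    then have "0 \<le> snd q" using config_nonneg[OF Y] by blast
    \<comment> \<open>The extended segment meets the axis at parameter \<open>t\<close>, so that
      \<open>L = t * S\<close>.\<close>
    define t where "t = snd ?p / (snd ?p - snd q)"
    have t: "1 \<le> t" using qp \<open>0 \<le> snd q\<close> by (simp add: t_def)
    have "?r = ?p + t *\<^sub>R (q - ?p)"
      unfolding x_axis_crossing_def qp(1)
    proof (rule the_equality)
      show "snd (?p + t *\<^sub>R (q - ?p)) = 0 \<and> (\<exists>t'\<ge>1. ?p + t *\<^sub>R (q - ?p) = ?p + t' *\<^sub>R (q - ?p))"
        using t qp by (intro conjI exI[of _ t]) (auto simp: t_def field_simps)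
      fix r assume "snd r = 0 \<and> (\<exists>t\<ge>1. r = ?p + t *\<^sub>R (q - ?p))"
      then obtain t' where t': "r = ?p + t' *\<^sub>R (q - ?p)" "snd r = 0" by blast
      then have "snd ?p + t' * (snd q - snd ?p) = 0" by simp
      then have "t' = t" using qp by (simp add: t_def field_simps)
      then show "r = ?p + t *\<^sub>R (q - ?p)" using t' by simp
    qed
    then have "dist ?p ?r = t * norm (q - ?p)" using t by (simp add: dist_norm norm_minus_commute)
    moreover have "dist ?p ?q = norm (q - ?p)" by (simp add: qp dist_norm norm_minus_commute)
    moreover have "q \<noteq> ?p" using qp by auto
    ultimately have "length_ratio Y (Suc n) = (1 / t)\<^sup>2"
      using t unfolding L by (simp add: power_mult_distrib power_divide)
    then show ?thesis by (simp add: marks_def t_def qp(1) del: jump_time.simps)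
  qed
qed

section \<open>Criteria for independence\<close>

lemma all_le_split: "(\<forall>j\<le>N. Q j) \<longleftrightarrow> Q 0 \<and> (\<forall>j<N. Q (Suc j))"
  by (metis Suc_le_eq le0 not0_implies_Suc)

text \<open>Any finite index set is contained in some \<open>K N\<close>; the surplus indices are
  given the whole space and contribute factors 1.\<close>

lemma (in prob_space) indep_vars_exhaustI:
  fixes X :: "'i \<Rightarrow> 'a \<Rightarrow> 'b"
  assumes rv: "\<And>i. random_variable (M' i) (X i)"
    and K: "\<And>N. finite (K N)" "incseq K" "(\<Union>N::nat. K N) = UNIV"
    and prod: "\<And>N A. (\<And>i. A i \<in> sets (M' i)) \<Longrightarrow>
      prob {\<omega> \<in> space M. \<forall>i\<in>K N. X i \<omega> \<in> A i} = (\<Prod>i\<in>K N. prob {\<omega> \<in> space M. X i \<omega> \<in> A i})"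
  shows "indep_vars M' X UNIV"
  unfolding indep_vars_def2
proof (intro conjI ballI rv indep_setsI)
  fix i show "{X i -` A \<inter> space M |A. A \<in> sets (M' i)} \<subseteq> events" using measurable_sets[OF rv] by auto
next
  fix B J assume J: "J \<noteq> {}" "J \<subseteq> UNIV" "finite J" and B: "\<forall>j\<in>J. B j \<in> {X j -` A \<inter> space M |A. A \<in> sets (M' j)}"
  then obtain A0 where A0: "\<And>j. j \<in> J \<Longrightarrow> A0 j \<in> sets (M' j) \<and> B j = X j -` A0 j \<inter> space M"
    by (auto simp: Ball_def) metis
  define A where "A j = (if j \<in> J then A0 j else space (M' j))" for j
  have A: "A j \<in> sets (M' j)" for j using A0 by (simp add: A_def)
  obtain N where N: "J \<subseteq> K N"
  proof -
    have "\<exists>N. J \<subseteq> K N" using J(3)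
    proof (induction J rule: finite_induct)
      case (insert j J)
      then obtain N where "J \<subseteq> K N" by auto
      moreover obtain N' where "j \<in> K N'" using K(3) by blast
      ultimately have "insert j J \<subseteq> K (max N N')"
        using monoD[OF K(2), of N "max N N'"] monoD[OF K(2), of N' "max N N'"] by auto
      then show ?case by blast
    qed simp
    then show ?thesis using that by blast
  qed
  have in_space: "X j \<omega> \<in> space (M' j)" if "\<omega> \<in> space M" for j \<omega> using measurable_space[OF rv that] .
  have "\<Inter> (B ` J) = {\<omega> \<in> space M. \<forall>i\<in>K N. X i \<omega> \<in> A i}"
    using J(1) N A0 in_space by (auto simp: A_def)
  then have "prob (\<Inter> (B ` J)) = (\<Prod>i\<in>K N. prob {\<omega> \<in> space M. X i \<omega> \<in> A i})"
    using prod[OF A] by simp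
  also have "\<dots> = (\<Prod>i\<in>J. prob {\<omega> \<in> space M. X i \<omega> \<in> A i})"
  proof (rule prod.mono_neutral_right[OF K(1) N], intro ballI)
    fix i assume "i \<in> K N - J"
    then have "{\<omega> \<in> space M. X i \<omega> \<in> A i} = space M" using in_space by (auto simp: A_def)
    then show "prob {\<omega> \<in> space M. X i \<omega> \<in> A i} = 1" by (simp add: prob_space)
  qed
  also have "\<dots> = (\<Prod>j\<in>J. prob (B j))"
    using A0 by (intro prod.cong refl arg_cong[where f = prob]) (auto simp: A_def)
  finally show "prob (\<Inter> (B ` J)) = (\<Prod>j\<in>J. prob (B j))" .
qed

lemma (in prob_space) indep_var_space_cong:
  assumes "indep_var S X T Y" "\<And>\<omega>. \<omega> \<in> space M \<Longrightarrow> X \<omega> = X' \<omega>" "\<And>\<omega>. \<omega> \<in> space M \<Longrightarrow> Y \<omega> = Y' \<omega>"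
  shows "indep_var S X' T Y'"
proof -
  have "X -` A \<inter> space M = X' -` A \<inter> space M" "Y -` B \<inter> space M = Y' -` B \<inter> space M" for A B
    using assms(2,3) by auto
  moreover have "random_variable S X \<longleftrightarrow> random_variable S X'" "random_variable T Y \<longleftrightarrow> random_variable T Y'"
    using assms(2,3) by (intro measurable_cong; simp)+
  ultimately show ?thesis using assms(1) unfolding indep_var_eq by simp
qed

lemma (in prob_space) indep_vars_space_cong:
  assumes "\<And>i \<omega>. i \<in> I \<Longrightarrow> \<omega> \<in> space M \<Longrightarrow> X i \<omega> = Y i \<omega>"
  shows "indep_vars M' X I \<longleftrightarrow> indep_vars M' Y I"
proof -
  have "X i -` A \<inter> space M = Y i -` A \<inter> space M" if "i \<in> I" for i A
    using assms[OF that] by auto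
  moreover have "random_variable (M' i) (X i) \<longleftrightarrow> random_variable (M' i) (Y i)" if "i \<in> I" for i
    using assms[OF that] by (rule measurable_cong)
  ultimately show ?thesis
    unfolding indep_vars_def2 by (intro conj_cong ball_cong indep_sets_cong refl) simp_all
qed

section \<open>The first vertex and the area of the corner triangle\<close>

context quadrant_poisson
begin

text \<open>The half-axis is a countable union of segments of area 0. This supplies the positive
  heights that \<open>history\<close> demands.\<close>

lemma AE_no_point_on_axis: "AE \<omega> in M. \<forall>q\<in>P \<omega>. 0 < snd q"
proof -
  let ?A = "\<lambda>n::nat. {0..real n} \<times> {0::real}"
  have A: "?A n \<in> sets borel" "bounded (?A n)" for n
    by (auto intro!: borel_Times bounded_Times)
  have "AE \<omega> in M. card (P \<omega> \<inter> ?A n) = 0" for n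
  proof -
    have "emeasure lborel (?A n \<inter> quadrant) \<le> emeasure (lborel \<Otimes>\<^sub>M lborel) (?A n)"
      unfolding lborel_prod using A by (intro emeasure_mono) auto
    also have "\<dots> = 0" by (subst lborel.emeasure_pair_measure_Times) auto
    finally have "prob {\<omega> \<in> space M. card (P \<omega> \<inter> ?A n) = 0} = 1"
      using prob_card_P[OF A, of n 0] by (simp add: measure_def)
    moreover have "{\<omega> \<in> space M. card (P \<omega> \<inter> ?A n) = 0} \<in> events"
      using measurable_sets[OF card_P_measurable[OF A], of "{0}" n] by (simp add: vimage_def Int_def conj_commute)
    ultimately show ?thesis by (simp add: prob_eq_1)
  qed
  then have "AE \<omega> in M. \<forall>n. card (P \<omega> \<inter> ?A n) = 0" by (simp add: AE_all_countable)
  then show ?thesis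
  proof (rule AE_mp, intro AE_I2 impI ballI)
    fix \<omega> q assume \<omega>: "\<omega> \<in> space M" "\<forall>n. card (P \<omega> \<inter> ?A n) = 0" "q \<in> P \<omega>"
    obtain n where n: "fst q \<le> real n" using real_arch_simple by blast
    have "card (P \<omega> \<inter> ?A n) = 0" using \<omega>(2) by blast
    then have E: "P \<omega> \<inter> ?A n = {}" using card_0_eq[OF locally_finite[OF \<omega>(1) A(2)[of n]]] by simp
    have "q \<notin> ?A n" using E \<omega>(3) by blast
    then show "0 < snd q"
      using n config_nonneg[OF config_P[OF \<omega>(1)] \<omega>(3)] by (simp add: mem_Times_iff)
  qed
qed

text \<open>The corner triangle with legs \<open>sqrt (2 * t)\<close> has area \<open>t\<close>, and
  \<open>Z\<close> is the event that it is void.\<close>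

lemma corner_void:
  assumes "0 \<le> t"
  defines "Z \<equiv> {\<omega> \<in> space M. \<forall>q\<in>P \<omega>. sqrt (2 * t) < lvl 1 q}"
  shows "Z \<in> events" "prob Z = exp (- t)"
proof -
  let ?s = "sqrt (2 * t)"
  let ?T = "convex hull {(0, 0), (?s, 0), (0, ?s)}"
  have s: "0 \<le> ?s" using assms by simp
  have T: "q \<in> ?T \<longleftrightarrow> 0 \<le> fst q \<and> 0 \<le> snd q \<and> lvl 1 q \<le> ?s" for q
  \<comment> \<open>\<open>triangle_section\<close> needs an apex off the axis, so the degenerate
    triangle is treated separately.\<close>
  proof (cases "?s = 0")
    case True
    have "q \<in> ?T \<longleftrightarrow> q = (0, 0)" unfolding True by simp
    also have "\<dots> \<longleftrightarrow> 0 \<le> fst q \<and> 0 \<le> snd q \<and> lvl 1 q \<le> ?s"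
      unfolding True lvl_def by (auto simp: prod_eq_iff)
    finally show ?thesis .
  next
    case False
    have "{(0, 0), (?s, 0), (0, ?s)} = {(0, ?s), (0, 0), (?s, 0)}" by auto
    then have "q \<in> ?T \<longleftrightarrow> 0 \<le> snd q / ?s \<and> snd q / ?s \<le> 1 \<and> 0 \<le> fst q \<and> fst q \<le> (1 - snd q / ?s) * ?s"
      using triangle_section[OF False s, of "fst q" "snd q" 0] by simp
    moreover have "(1 - snd q / ?s) * ?s = ?s - snd q" using False by (simp add: left_diff_distrib)
    ultimately show ?thesis using s False by (auto simp: lvl_def divide_le_eq zero_le_divide_iff)
  qed
  have TB: "?T \<in> sets borel" "bounded ?T"
    by (intro borel_closed compact_imp_closed compact_imp_bounded compact_triangle)+
  have "P \<omega> \<inter> ?T = {} \<longleftrightarrow> (\<forall>q\<in>P \<omega>. ?s < lvl 1 q)" if "\<omega> \<in> space M" for \<omega>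
    using config_nonneg[OF config_P[OF that]] T by (meson disjoint_iff not_le)
  then have Z: "Z = {\<omega> \<in> space M. card (P \<omega> \<inter> ?T) = 0}"
    unfolding Z_def using locally_finite[OF _ TB(2)] by (intro Collect_cong conj_cong refl) simp
  show "Z \<in> events"
    unfolding Z using measurable_sets[OF card_P_measurable[OF TB], of "{0}"] by (simp add: vimage_def Int_def conj_commute)
  have "?T \<inter> quadrant = ?T" using T by (auto simp: mem_Times_iff)
  then have "measure lborel (?T \<inter> quadrant) = t"
    using measure_corner_triangle[of ?s] assms(1) by simp
  then show "prob Z = exp (- t)" unfolding Z using prob_card_P[OF TB, of 0] by simp
qed

text \<open>An empty configuration misses the corner triangles of every area \<open>n\<close>, which
  are void with probability \<open>exp (- n)\<close>.\<close>

lemma AE_nonempty: "AE \<omega> in M. P \<omega> \<noteq> {}"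
proof -
  have E: "{\<omega> \<in> space M. P \<omega> = {}} \<in> events"
    using void_measurable[of UNIV] by (simp add: pred_def)
  have "prob {\<omega> \<in> space M. P \<omega> = {}} \<le> exp (- real n)" for n
  proof -
    have "prob {\<omega> \<in> space M. P \<omega> = {}} \<le> prob {\<omega> \<in> space M. \<forall>q\<in>P \<omega>. sqrt (2 * real n) < lvl 1 q}"
      by (intro finite_measure_mono corner_void) auto
    then show ?thesis using corner_void(2)[of "real n"] by simp
  qed
  moreover have "(\<lambda>n. exp (- real n)) \<longlonglongrightarrow> 0"
    by (intro filterlim_compose[OF exp_at_bot] filterlim_compose[OF filterlim_uminus_at_bot_at_top filterlim_real_sequentially])
  ultimately have "prob {\<omega> \<in> space M. P \<omega> = {}} \<le> 0"
    by (intro LIMSEQ_le_const[where X = "\<lambda>n. exp (- real n)"]) auto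
  then have "prob {\<omega> \<in> space M. P \<omega> = {}} = 0" by (simp add: measure_le_0_iff)
  then show ?thesis using E by (intro AE_I[where N = "{\<omega> \<in> space M. P \<omega> = {}}"]) (auto simp: emeasure_eq_measure)
qed

text \<open>For a nonempty configuration the area is at most \<open>t\<close> exactly if the corner
  triangle of area \<open>t\<close> contains a point, so its tail is a void probability.\<close>

lemma corner_area_exponential:
  "distributed M lborel (\<lambda>\<omega>. triangle_area (P \<omega>) 0) (exponential_density 1)"
proof -
  have rv: "(\<lambda>\<omega>. triangle_area (P \<omega>) 0) \<in> borel_measurable M"
    using marks_measurable[of 0] unfolding triangle_area_0 corner_area_def by measurable
  have "prob {\<omega> \<in> space M. triangle_area (P \<omega>) 0 \<le> t} = 1 - exp (- t)" if t: "0 \<le> t" for t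
  proof -
    let ?Z = "{\<omega> \<in> space M. \<forall>q\<in>P \<omega>. sqrt (2 * t) < lvl 1 q}"
    have "AE \<omega> in M. triangle_area (P \<omega>) 0 \<le> t \<longleftrightarrow> \<omega> \<in> space M - ?Z"
      using AE_nonempty
    proof (rule AE_mp, intro AE_I2 impI)
      fix \<omega> assume \<omega>: "\<omega> \<in> space M" "P \<omega> \<noteq> {}"
      let ?w = "hull_pt (P \<omega>) 0"
      have W: "is_W (P \<omega>) 1 ?w" using is_W_hull_pt[OF config_P[OF \<omega>(1)] \<omega>(2), of 0] by simp
      then have w: "?w \<in> P \<omega>" by (simp add: is_W_def)
      have "0 \<le> lvl 1 ?w" using config_nonneg[OF config_P[OF \<omega>(1)] w] by (simp add: lvl_def)
      moreover have "triangle_area (P \<omega>) 0 = (lvl 1 ?w)\<^sup>2 / 2"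
        by (simp add: triangle_area_0 corner_area_def marks_def lvl_def)
      ultimately have "triangle_area (P \<omega>) 0 \<le> t \<longleftrightarrow> lvl 1 ?w \<le> sqrt (2 * t)"
        using t by (metis (no_types, opaque_lifting) mult.commute pos_divide_le_eq real_le_rsqrt real_sqrt_le_iff real_sqrt_unique sqrt_le_D zero_less_numeral)
      also have "\<dots> \<longleftrightarrow> (\<exists>q\<in>P \<omega>. lvl 1 q \<le> sqrt (2 * t))"
        using w is_W_le[OF W] order_trans by blast
      finally show "triangle_area (P \<omega>) 0 \<le> t \<longleftrightarrow> \<omega> \<in> space M - ?Z" using \<omega>(1) by (auto simp: not_less)
    qed
    then have "prob {\<omega> \<in> space M. triangle_area (P \<omega>) 0 \<le> t} = prob (space M - ?Z)"
      using rv corner_void(1)[OF t] by (intro finite_measure_eq_AE) (auto elim!: eventually_mono)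
    then show ?thesis using corner_void[OF t] by (simp add: prob_compl)
  qed
  then show ?thesis using rv by (simp add: exponential_distributed_iff)
qed

section \<open>The joint law of the marks\<close>

lemma history_Suc:
  assumes "config Y" "\<forall>q\<in>Y. 0 < snd q"
  shows "history (Suc n) A Y \<longleftrightarrow> history n A Y \<and>
    next_mark_in (Y \<inter> unexplored (hull_pt Y n) (hull_a Y n)) (hull_pt Y n) (hull_a Y n) (A (Suc n))"
proof (cases "Y = {}")
  case True
  then show ?thesis by (simp add: history_def alive_def)
next
  case False
  have "0 < snd (hull_pt Y k)" for k
    using is_W_hull_pt[OF assms(1) False, of k] assms(2) by (auto simp: is_W_def)
  then show ?thesis
    unfolding next_mark_in_unexplored_hull[OF assms(1) False] history_def alive_Suc by (auto simp: le_Suc_eq)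
qed

text \<open>Off the null event of a point on the axis, a history of length \<open>Suc n\<close> is
  one of length \<open>n\<close> followed by a mark in \<open>A (Suc n)\<close>, and
  \<open>strong_markov\<close> factorises the two.\<close>

lemma prob_history_Suc:
  assumes A: "\<And>j. A j \<in> sets borel"
  shows "prob {\<omega> \<in> space M. history (Suc n) A (P \<omega>)} =
    prob {\<omega> \<in> space M. history n A (P \<omega>)} * measure (exp_law \<Otimes>\<^sub>M unit_law) (A (Suc n))"
proof -
  note sm = strong_markov[where n = n and C = "A (Suc n)", OF A A]
  have H: "{\<omega> \<in> space M. history (Suc n) A (P \<omega>)} \<in> events"
    using history_measurable[OF A, of "Suc n"] by (simp add: pred_def)
  have "prob {\<omega> \<in> space M. history (Suc n) A (P \<omega>)} = prob {\<omega> \<in> space M. history n A (P \<omega>) \<and>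
      next_mark_in (P \<omega> \<inter> unexplored (hull_pt (P \<omega>) n) (hull_a (P \<omega>) n)) (hull_pt (P \<omega>) n) (hull_a (P \<omega>) n) (A (Suc n))}"
    by (intro finite_measure_eq_AE[OF _ H sm(1)], rule AE_mp[OF AE_no_point_on_axis])
      (use history_Suc config_P in auto)
  then show ?thesis using sm(2) by simp
qed

text \<open>With unrestricted marks every Markov step has factor 1. In particular, each of the first
  \<open>n\<close> jumps almost surely occurs.\<close>

lemma AE_history: "AE \<omega> in M. history n (\<lambda>_. UNIV) (P \<omega>)"
proof -
  have "prob {\<omega> \<in> space M. history n (\<lambda>_. UNIV) (P \<omega>)} = 1"
  proof (induction n)
    case 0
    have H: "{\<omega> \<in> space M. history 0 (\<lambda>_. UNIV) (P \<omega>)} \<in> events"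
      using history_measurable[of "\<lambda>_. UNIV" 0] by (simp add: pred_def)
    have "AE \<omega> in M. \<omega> \<in> {\<omega> \<in> space M. history 0 (\<lambda>_. UNIV) (P \<omega>)}"
      using AE_nonempty AE_no_point_on_axis AE_space
    proof eventually_elim
      case (elim \<omega>)
      have "is_W (P \<omega>) 1 (hull_pt (P \<omega>) 0)" using is_W_hull_pt[OF config_P elim(1), of 0] elim(3) by simp
      then show ?case using elim by (auto simp: history_def alive_def is_W_def)
    qed
    then show ?case using prob_eq_1[OF H] by simp
  next
    case (Suc n)
    interpret E: prob_space exp_law by (rule prob_space_exp_law)
    interpret U: prob_space unit_law by (rule prob_space_unit_law)
    interpret EU: pair_prob_space exp_law unit_law ..
    have "space (exp_law \<Otimes>\<^sub>M unit_law) = UNIV" by (simp add: space_pair_measure)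
    then have "measure (exp_law \<Otimes>\<^sub>M unit_law) UNIV = 1" using EU.P.prob_space by simp
    then show ?case using Suc prob_history_Suc[of "\<lambda>_. UNIV" n] by simp
  qed
  then show ?thesis
    using prob_eq_1[of "{\<omega> \<in> space M. history n (\<lambda>_. UNIV) (P \<omega>)}"] history_measurable[of "\<lambda>_. UNIV" n]
    by (simp add: pred_def)
qed

text \<open>The clauses of \<open>history\<close> other than the one on marks hold almost
  surely.\<close>

lemma prob_marks_history:
  assumes A: "\<And>j. A j \<in> sets borel"
  shows "prob {\<omega> \<in> space M. \<forall>j\<le>n. marks (P \<omega>) j \<in> A j} = prob {\<omega> \<in> space M. history n A (P \<omega>)}"
proof (rule finite_measure_eq_AE)
  show "AE \<omega> in M. \<omega> \<in> {\<omega> \<in> space M. \<forall>j\<le>n. marks (P \<omega>) j \<in> A j} \<longleftrightarrow> \<omega> \<in> {\<omega> \<in> space M. history n A (P \<omega>)}"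
    using AE_history[of n] by eventually_elim (auto simp: history_def)
  note [measurable] = marks_measurable A
  show "{\<omega> \<in> space M. \<forall>j\<le>n. marks (P \<omega>) j \<in> A j} \<in> events" by measurable
  show "{\<omega> \<in> space M. history n A (P \<omega>)} \<in> events"
    using history_measurable[OF A, of n] by (simp add: pred_def)
qed

lemma prob_marks_prod:
  assumes A: "\<And>j. A j \<in> sets borel"
  shows "prob {\<omega> \<in> space M. \<forall>j\<le>n. marks (P \<omega>) j \<in> A j} =
    prob {\<omega> \<in> space M. marks (P \<omega>) 0 \<in> A 0} * (\<Prod>j<n. measure (exp_law \<Otimes>\<^sub>M unit_law) (A (Suc j)))"
proof (induction n)
  case (Suc n)
  then show ?case
    using prob_history_Suc[OF A, of n] by (simp add: prob_marks_history[OF A] mult.assoc)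
qed simp

lemma prob_mark_Suc:
  assumes C: "C \<in> sets borel"
  shows "prob {\<omega> \<in> space M. marks (P \<omega>) (Suc n) \<in> C} = measure (exp_law \<Otimes>\<^sub>M unit_law) C"
proof -
  let ?A = "\<lambda>j. if j = Suc n then C else UNIV"
  have A: "?A j \<in> sets borel" for j using C by simp
  have "{\<omega> \<in> space M. marks (P \<omega>) (Suc n) \<in> C} = {\<omega> \<in> space M. \<forall>j\<le>Suc n. marks (P \<omega>) j \<in> ?A j}"
    by auto
  then have "prob {\<omega> \<in> space M. marks (P \<omega>) (Suc n) \<in> C} = prob {\<omega> \<in> space M. history n ?A (P \<omega>)} * measure (exp_law \<Otimes>\<^sub>M unit_law) C"
    using prob_marks_history[of ?A "Suc n"] prob_history_Suc[of ?A n] A by simp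
  also have "{\<omega> \<in> space M. history n ?A (P \<omega>)} = {\<omega> \<in> space M. history n (\<lambda>_. UNIV) (P \<omega>)}"
    by (auto simp: history_def)
  also have "prob \<dots> = 1"
    using AE_history[of n] history_measurable[of "\<lambda>_. UNIV" n] by (simp add: prob_eq_1 pred_def)
  finally show ?thesis by simp
qed

lemma prob_mark_Suc_rect:
  assumes "A \<in> sets borel" "B \<in> sets borel"
  shows "prob {\<omega> \<in> space M. marks (P \<omega>) (Suc n) \<in> A \<times> B} = measure exp_law A * measure unit_law B"
proof -
  interpret U: prob_space unit_law by (rule prob_space_unit_law)
  interpret E: prob_space exp_law by (rule prob_space_exp_law)
  have "emeasure (exp_law \<Otimes>\<^sub>M unit_law) (A \<times> B) = emeasure exp_law A * emeasure unit_law B"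
    using assms by (intro U.emeasure_pair_measure_Times) auto
  then show ?thesis
    using prob_mark_Suc[OF borel_Times[OF assms], of n] by (simp add: measure_def enn2real_mult)
qed

lemma prob_area_Suc:
  assumes "A \<in> sets borel"
  shows "prob {\<omega> \<in> space M. triangle_area (P \<omega>) (Suc n) \<in> A} = measure exp_law A"
proof -
  interpret U: prob_space unit_law by (rule prob_space_unit_law)
  have "{\<omega> \<in> space M. triangle_area (P \<omega>) (Suc n) \<in> A} = {\<omega> \<in> space M. marks (P \<omega>) (Suc n) \<in> A \<times> UNIV}"
    using triangle_area_Suc[OF config_P] by (auto simp: mem_Times_iff)
  then show ?thesis using prob_mark_Suc_rect[OF assms, of UNIV n] U.prob_space by simp
qed

lemma prob_ratio_Suc:
  assumes "B \<in> sets borel"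
  shows "prob {\<omega> \<in> space M. length_ratio (P \<omega>) (Suc n) \<in> B} = measure unit_law B"
proof -
  interpret E: prob_space exp_law by (rule prob_space_exp_law)
  have "{\<omega> \<in> space M. length_ratio (P \<omega>) (Suc n) \<in> B} = {\<omega> \<in> space M. marks (P \<omega>) (Suc n) \<in> UNIV \<times> B}"
    using length_ratio_Suc[OF config_P] by (auto simp: mem_Times_iff)
  then show ?thesis using prob_mark_Suc_rect[of UNIV B n] assms E.prob_space by simp
qed

lemma triangle_area_measurable: "(\<lambda>\<omega>. triangle_area (P \<omega>) n) \<in> borel_measurable M"
proof (cases n)
  case 0
  show ?thesis
    using marks_measurable[of 0] unfolding 0 triangle_area_0 corner_area_def by measurable
next
  case (Suc m)
  have "(\<lambda>\<omega>. fst (marks (P \<omega>) (Suc m))) \<in> borel_measurable M"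
    using marks_measurable[of "Suc m"] by measurable
  then show ?thesis
    unfolding Suc by (rule measurable_cong[THEN iffD1, rotated]) (simp add: triangle_area_Suc[OF config_P])
qed

lemma length_ratio_measurable: "(\<lambda>\<omega>. length_ratio (P \<omega>) (Suc n)) \<in> borel_measurable M"
proof -
  have "(\<lambda>\<omega>. snd (marks (P \<omega>) (Suc n))) \<in> borel_measurable M"
    using marks_measurable[of "Suc n"] by measurable
  then show ?thesis
    by (rule measurable_cong[THEN iffD1, rotated]) (simp add: length_ratio_Suc[OF config_P])
qed

lemma indep_marks: "indep_vars (\<lambda>_. borel) (\<lambda>i \<omega>. marks (P \<omega>) i) UNIV"
proof (rule indep_vars_exhaustI[where K = "\<lambda>N. {..N}"])
  fix N and A :: "nat \<Rightarrow> (real \<times> real) set" assume A: "\<And>i. A i \<in> sets borel"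
  have "(\<Prod>i\<in>{..N}. prob {\<omega> \<in> space M. marks (P \<omega>) i \<in> A i}) =
      prob {\<omega> \<in> space M. marks (P \<omega>) 0 \<in> A 0} * (\<Prod>j<N. measure (exp_law \<Otimes>\<^sub>M unit_law) (A (Suc j)))"
    by (simp add: prod.atMost_shift prob_mark_Suc[OF A])
  then show "prob {\<omega> \<in> space M. \<forall>i\<in>{..N}. marks (P \<omega>) i \<in> A i} = (\<Prod>i\<in>{..N}. prob {\<omega> \<in> space M. marks (P \<omega>) i \<in> A i})"
    using prob_marks_prod[of A N, OF A] by (simp add: Ball_def)
qed (auto simp: incseq_def marks_measurable)

text \<open>Indexing both sequences by one sum type makes their independence of each other part of a
  single statement. Ratios start at 1, hence the shift.\<close>

definition areas_ratios :: "nat + nat \<Rightarrow> 'w \<Rightarrow> real" where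
  "areas_ratios k \<omega> = (case k of Inl i \<Rightarrow> triangle_area (P \<omega>) i | Inr i \<Rightarrow> length_ratio (P \<omega>) (Suc i))"

lemma indep_areas_ratios: "indep_vars (\<lambda>_. borel) areas_ratios UNIV"
\<comment> \<open>The areas 0 to \<open>N\<close> and the ratios 1 to \<open>N\<close> are exactly
  those determined by the marks 0 to \<open>N\<close>.\<close>
proof (rule indep_vars_exhaustI[where K = "\<lambda>N. {..N} <+> {..<N}"])
  show "random_variable borel (areas_ratios k)" for k
    unfolding areas_ratios_def by (cases k) (simp_all add: triangle_area_measurable length_ratio_measurable)
  show "incseq (\<lambda>N::nat. {..N} <+> {..<N})" by (auto simp: incseq_def)
  show "(\<Union>N::nat. {..N} <+> {..<N}) = UNIV"
  proof (intro equalityI subsetI UNIV_I)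
    fix k :: "nat + nat"
    show "k \<in> (\<Union>N::nat. {..N} <+> {..<N})" by (cases k) auto
  qed
  fix N and A :: "nat + nat \<Rightarrow> real set" assume A: "\<And>k. A k \<in> sets borel"
  \<comment> \<open>The zeroth mark is a vertex and enters only through its corner area; every later
    mark pairs an area with a ratio.\<close>
  define B where "B j = (case j of 0 \<Rightarrow> corner_area -` A (Inl 0) | Suc i \<Rightarrow> A (Inl (Suc i)) \<times> A (Inr i))" for j
  have "corner_area \<in> borel_measurable borel" unfolding corner_area_def by measurable
  from measurable_sets[OF this A] have B: "B j \<in> sets borel" for j
    using A by (cases j) (auto simp: B_def intro: borel_Times)
  have "(\<forall>k\<in>{..N} <+> {..<N}. areas_ratios k \<omega> \<in> A k) \<longleftrightarrow> (\<forall>j\<le>N. marks (P \<omega>) j \<in> B j)" if \<omega>: "\<omega> \<in> space M" for \<omega>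
  proof -
    have "(\<forall>j\<le>N. marks (P \<omega>) j \<in> B j) \<longleftrightarrow> marks (P \<omega>) 0 \<in> B 0 \<and> (\<forall>j<N. marks (P \<omega>) (Suc j) \<in> B (Suc j))"
      by (rule all_le_split)
    also have "\<dots> \<longleftrightarrow> (\<forall>i\<le>N. triangle_area (P \<omega>) i \<in> A (Inl i)) \<and> (\<forall>i<N. length_ratio (P \<omega>) (Suc i) \<in> A (Inr i))"
    proof -
      have "(\<forall>i\<le>N. triangle_area (P \<omega>) i \<in> A (Inl i)) \<longleftrightarrow>
          triangle_area (P \<omega>) 0 \<in> A (Inl 0) \<and> (\<forall>i<N. triangle_area (P \<omega>) (Suc i) \<in> A (Inl (Suc i)))"
        by (rule all_le_split)
      then show ?thesis
        using triangle_area_Suc[OF config_P[OF \<omega>]] length_ratio_Suc[OF config_P[OF \<omega>]]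
        by (auto simp: B_def triangle_area_0 mem_Times_iff)
    qed
    also have "\<dots> \<longleftrightarrow> (\<forall>k\<in>{..N} <+> {..<N}. areas_ratios k \<omega> \<in> A k)"
      by (simp add: areas_ratios_def Plus_def ball_Un) (simp add: Ball_def)
    finally show ?thesis ..
  qed
  then have "prob {\<omega> \<in> space M. \<forall>k\<in>{..N} <+> {..<N}. areas_ratios k \<omega> \<in> A k} = prob {\<omega> \<in> space M. \<forall>j\<le>N. marks (P \<omega>) j \<in> B j}"
    by (intro arg_cong[where f = prob] Collect_cong conj_cong refl)
  also have "\<dots> = prob {\<omega> \<in> space M. marks (P \<omega>) 0 \<in> B 0} * (\<Prod>j<N. measure (exp_law \<Otimes>\<^sub>M unit_law) (B (Suc j)))"
    by (rule prob_marks_prod[OF B])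
  also have "prob {\<omega> \<in> space M. marks (P \<omega>) 0 \<in> B 0} = prob {\<omega> \<in> space M. triangle_area (P \<omega>) 0 \<in> A (Inl 0)}"
    by (simp add: B_def triangle_area_0)
  also have "(\<Prod>j<N. measure (exp_law \<Otimes>\<^sub>M unit_law) (B (Suc j))) =
      (\<Prod>j<N. prob {\<omega> \<in> space M. triangle_area (P \<omega>) (Suc j) \<in> A (Inl (Suc j))} * prob {\<omega> \<in> space M. length_ratio (P \<omega>) (Suc j) \<in> A (Inr j)})"
    using prob_mark_Suc[OF B[of "Suc _"], symmetric] A
    by (intro prod.cong refl) (simp add: B_def prob_mark_Suc_rect prob_area_Suc prob_ratio_Suc)
  also have "prob {\<omega> \<in> space M. triangle_area (P \<omega>) 0 \<in> A (Inl 0)} * \<dots> =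
      (\<Prod>j\<le>N. prob {\<omega> \<in> space M. triangle_area (P \<omega>) j \<in> A (Inl j)}) * (\<Prod>j<N. prob {\<omega> \<in> space M. length_ratio (P \<omega>) (Suc j) \<in> A (Inr j)})"
    by (simp add: prod.distrib prod.atMost_shift mult.assoc)
  also have "\<dots> = (\<Prod>k\<in>{..N} <+> {..<N}. prob {\<omega> \<in> space M. areas_ratios k \<omega> \<in> A k})"
    by (subst prod.Plus) (auto simp: areas_ratios_def)
  finally show "prob {\<omega> \<in> space M. \<forall>k\<in>{..N} <+> {..<N}. areas_ratios k \<omega> \<in> A k} =
      (\<Prod>k\<in>{..N} <+> {..<N}. prob {\<omega> \<in> space M. areas_ratios k \<omega> \<in> A k})" .
qed auto

lemma distr_length_ratio: "distr M borel (\<lambda>\<omega>. length_ratio (P \<omega>) (Suc n)) = unit_law"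
proof (rule measure_eqI)
  fix B assume "B \<in> sets (distr M borel (\<lambda>\<omega>. length_ratio (P \<omega>) (Suc n)))"
  then have B: "B \<in> sets borel" by simp
  interpret U: prob_space unit_law by (rule prob_space_unit_law)
  have "emeasure (distr M borel (\<lambda>\<omega>. length_ratio (P \<omega>) (Suc n))) B =
      emeasure M {\<omega> \<in> space M. length_ratio (P \<omega>) (Suc n) \<in> B}"
    using length_ratio_measurable B by (subst emeasure_distr) (auto intro!: arg_cong[where f = "emeasure M"])
  then show "emeasure (distr M borel (\<lambda>\<omega>. length_ratio (P \<omega>) (Suc n))) B = emeasure unit_law B"
    using prob_ratio_Suc[OF B, of n] by (simp add: emeasure_eq_measure U.emeasure_eq_measure)
qed simp

lemma area_Suc_exponential:
  "distributed M lborel (\<lambda>\<omega>. triangle_area (P \<omega>) (Suc n)) (exponential_density 1)"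
proof -
  have "prob {\<omega> \<in> space M. triangle_area (P \<omega>) (Suc n) \<le> t} = 1 - exp (- t)" if "0 \<le> t" for t
    using prob_area_Suc[of "{..t}" n] exp_law_atMost[of t] that by (simp add: measure_def)
  then show ?thesis using triangle_area_measurable by (simp add: exponential_distributed_iff)
qed

lemma indep_areas: "indep_vars (\<lambda>_. borel) (\<lambda>i \<omega>. triangle_area (P \<omega>) i) UNIV"
proof -
  have Y: "(if i = 0 then corner_area else fst) \<in> borel_measurable borel" for i :: nat
  proof -
    have "corner_area \<in> borel_measurable borel" unfolding corner_area_def by measurable
    moreover have "fst \<in> borel_measurable (borel :: (real \<times> real) measure)" by measurable
    ultimately show ?thesis by simp
  qed
  have "indep_vars (\<lambda>_. borel) (\<lambda>i \<omega>. (if i = 0 then corner_area else fst) (marks (P \<omega>) i)) UNIV"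
    by (rule indep_vars_compose2[OF indep_marks Y])
  moreover have "(if i = 0 then corner_area else fst) (marks (P \<omega>) i) = triangle_area (P \<omega>) i"
    if "i \<in> UNIV" "\<omega> \<in> space M" for i \<omega>
    using triangle_area_Suc[OF config_P[OF that(2)]] by (cases i) (simp_all add: triangle_area_0)
  ultimately show ?thesis
    by (rule indep_vars_space_cong[THEN iffD1, rotated])
qed

lemma indep_ratios: "indep_vars (\<lambda>_. borel) (\<lambda>i \<omega>. length_ratio (P \<omega>) i) {1..}"
proof -
  have "indep_vars (\<lambda>_. borel) (\<lambda>i \<omega>. snd (marks (P \<omega>) i)) {1..}"
    by (rule indep_vars_compose2[OF indep_vars_subset[OF indep_marks]]) auto
  moreover have "snd (marks (P \<omega>) i) = length_ratio (P \<omega>) i" if "i \<in> {1..}" "\<omega> \<in> space M" for i \<omega>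
    using that length_ratio_Suc[OF config_P[OF that(2)], of "i - 1"] by simp
  ultimately show ?thesis
    by (rule indep_vars_space_cong[THEN iffD1, rotated])
qed

lemma indep_ratios_areas:
  "indep_var (\<Pi>\<^sub>M i\<in>{1..}. borel) (\<lambda>\<omega>. \<lambda>i\<in>{1..}. length_ratio (P \<omega>) i)
     (\<Pi>\<^sub>M i\<in>UNIV. borel) (\<lambda>\<omega> i. triangle_area (P \<omega>) i)"
proof -
  \<comment> \<open>The shift is undone: the ratio number \<open>i\<close> is stored at
    \<open>Inr (i - 1)\<close>.\<close>
  let ?r = "\<lambda>f :: nat + nat \<Rightarrow> real. \<lambda>i\<in>{1..}. f (Inr (i - 1))" and ?d = "\<lambda>(f :: nat + nat \<Rightarrow> real) i. f (Inl i)"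
  have "indep_var (Pi\<^sub>M (range Inr) (\<lambda>_. borel)) (\<lambda>\<omega>. restrict (\<lambda>k. areas_ratios k \<omega>) (range Inr))
      (Pi\<^sub>M (range Inl) (\<lambda>_. borel)) (\<lambda>\<omega>. restrict (\<lambda>k. areas_ratios k \<omega>) (range Inl))"
    by (rule indep_var_restrict[OF indep_areas_ratios]) auto
  moreover have "?r \<in> measurable (Pi\<^sub>M (range Inr) (\<lambda>_. borel)) (\<Pi>\<^sub>M i\<in>{1..}. borel)"
    by (intro measurable_restrict measurable_component_singleton) auto
  moreover have "?d \<in> measurable (Pi\<^sub>M (range Inl) (\<lambda>_. borel)) (\<Pi>\<^sub>M i\<in>UNIV. borel)"
    by (intro measurable_PiM_single') (auto intro!: measurable_component_singleton)
  ultimately have "indep_var (\<Pi>\<^sub>M i\<in>{1..}. borel) (?r \<circ> (\<lambda>\<omega>. restrict (\<lambda>k. areas_ratios k \<omega>) (range Inr)))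
      (\<Pi>\<^sub>M i\<in>UNIV. borel) (?d \<circ> (\<lambda>\<omega>. restrict (\<lambda>k. areas_ratios k \<omega>) (range Inl)))"
    by (rule indep_var_compose)
  then show ?thesis
    by (rule indep_var_space_cong) (auto simp: areas_ratios_def restrict_def fun_eq_iff)
qed

text \<open>The ratios depend on the marks from 1 on, and W(1) is mark 0. Independence of these two
  blocks passes to the events that their functions generate, which is checked set by set because the
  two value types differ.\<close>

lemma indep_ratios_W:
  "indep_rv M (\<Pi>\<^sub>M i\<in>{1..}. borel) (\<lambda>\<omega>. \<lambda>i\<in>{1..}. length_ratio (P \<omega>) i)
     borel (\<lambda>\<omega>. hull_W (P \<omega>) 1)"
proof -
  let ?X = "\<lambda>\<omega>. restrict (\<lambda>i. marks (P \<omega>) i) {1..}" and ?Y = "\<lambda>\<omega>. restrict (\<lambda>i. marks (P \<omega>) i) {0}"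
  let ?r = "\<lambda>f :: nat \<Rightarrow> real \<times> real. \<lambda>i\<in>{1..}. snd (f i)" and ?w = "\<lambda>f :: nat \<Rightarrow> real \<times> real. f 0"
  let ?S = "Pi\<^sub>M {1..} (\<lambda>_::nat. borel :: (real \<times> real) measure)" and ?T = "Pi\<^sub>M {0} (\<lambda>_::nat. borel :: (real \<times> real) measure)"
  have ind: "indep_var ?S ?X ?T ?Y"
    by (rule indep_var_restrict[OF indep_marks]) auto
  have rvX: "?X \<in> measurable M ?S" and rvY: "?Y \<in> measurable M ?T"
    using ind by (auto dest: indep_var_rv1 indep_var_rv2)
  have r: "?r \<in> measurable ?S (\<Pi>\<^sub>M i\<in>{1..}. borel)"
    by (intro measurable_restrict borel_snd measurable_component_singleton) auto
  have w: "?w \<in> measurable ?T borel" by (rule measurable_component_singleton) auto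
  have eqX: "?r (?X \<omega>) = (\<lambda>i\<in>{1..}. length_ratio (P \<omega>) i)" if "\<omega> \<in> space M" for \<omega>
  proof
    fix i
    show "?r (?X \<omega>) i = (\<lambda>i\<in>{1..}. length_ratio (P \<omega>) i) i"
      using length_ratio_Suc[OF config_P[OF that], of "i - 1"] by (cases "1 \<le> i") auto
  qed
  have eqY: "?w (?Y \<omega>) = hull_W (P \<omega>) 1" for \<omega>
    by (simp add: marks_def hull_pt_def)
  have X: "(\<lambda>\<omega>. \<lambda>i\<in>{1..}. length_ratio (P \<omega>) i) \<in> measurable M (\<Pi>\<^sub>M i\<in>{1..}. borel)"
    using measurable_compose[OF rvX r] by (rule measurable_cong[THEN iffD1, rotated]) (rule eqX)
  have Y: "(\<lambda>\<omega>. hull_W (P \<omega>) 1) \<in> measurable M borel"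
    using measurable_compose[OF rvY w] unfolding eqY .
  let ?A = "{?X -` A \<inter> space M |A. A \<in> sets ?S}" and ?B = "{?Y -` B \<inter> space M |B. B \<in> sets ?T}"
  have AB: "indep_set (sigma_sets (space M) ?A) (sigma_sets (space M) ?B)"
    using ind by (simp add: indep_var_eq)
  have subA: "(\<lambda>\<omega>. \<lambda>i\<in>{1..}. length_ratio (P \<omega>) i) -` A \<inter> space M \<in> sigma_sets (space M) ?A"
    if A: "A \<in> sets (\<Pi>\<^sub>M i\<in>{1..}. borel)" for A
  proof -
    have "(\<lambda>\<omega>. \<lambda>i\<in>{1..}. length_ratio (P \<omega>) i) -` A \<inter> space M = ?X -` (?r -` A \<inter> space ?S) \<inter> space M"
      using eqX measurable_space[OF rvX] by auto
    then show ?thesis using measurable_sets[OF r A] by (intro sigma_sets.Basic) blast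
  qed
  have subB: "(\<lambda>\<omega>. hull_W (P \<omega>) 1) -` B \<inter> space M \<in> sigma_sets (space M) ?B"
    if B: "B \<in> sets borel" for B
  proof -
    have "(\<lambda>\<omega>. hull_W (P \<omega>) 1) -` B \<inter> space M = ?Y -` (?w -` B \<inter> space ?T) \<inter> space M"
      using eqY measurable_space[OF rvY] by auto
    then show ?thesis using measurable_sets[OF w B] by (intro sigma_sets.Basic) blast
  qed
  show ?thesis
    unfolding indep_rv_def
  proof (intro conjI X Y)
    show "indep_set {(\<lambda>\<omega>. \<lambda>i\<in>{1..}. length_ratio (P \<omega>) i) -` A \<inter> space M |A. A \<in> sets (\<Pi>\<^sub>M i\<in>{1..}. borel)}
        {(\<lambda>\<omega>. hull_W (P \<omega>) 1) -` B \<inter> space M |B. B \<in> sets borel}"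
      unfolding indep_sets2_eq
    proof (intro conjI ballI subsetI)
      fix a assume "a \<in> {(\<lambda>\<omega>. \<lambda>i\<in>{1..}. length_ratio (P \<omega>) i) -` A \<inter> space M |A. A \<in> sets (\<Pi>\<^sub>M i\<in>{1..}. borel)}"
      then have a: "a \<in> sigma_sets (space M) ?A" using subA by blast
      then show "a \<in> events" using AB unfolding indep_sets2_eq by blast
      fix b assume "b \<in> {(\<lambda>\<omega>. hull_W (P \<omega>) 1) -` B \<inter> space M |B. B \<in> sets borel}"
      then have "b \<in> sigma_sets (space M) ?B" using subB by blast
      then show "prob (a \<inter> b) = prob a * prob b" using a AB unfolding indep_sets2_eq by blast
    next
      fix b assume "b \<in> {(\<lambda>\<omega>. hull_W (P \<omega>) 1) -` B \<inter> space M |B. B \<in> sets borel}"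
      then show "b \<in> events" using measurable_sets[OF Y] by blast
    qed
  qed
qed

end

theorem theorem2p1:
  fixes M :: "'w measure" and P :: "'w \<Rightarrow> (real \<times> real) set"
  assumes "poisson_process M (restrict_space lborel quadrant) P"
  shows
    "(prob_space.indep_vars M (\<lambda>_. borel) (\<lambda>i \<omega>. triangle_area (P \<omega>) i) UNIV \<and>
      (\<forall>i. distributed M lborel (\<lambda>\<omega>. triangle_area (P \<omega>) i) (exponential_density 1))) \<and>
     (prob_space.indep_vars M (\<lambda>_. borel) (\<lambda>i \<omega>. length_ratio (P \<omega>) i) {1..} \<and>
      (\<forall>i\<ge>1. distr M borel (\<lambda>\<omega>. length_ratio (P \<omega>) i) = uniform_measure lborel {0<..<1}) \<and>
      indep_rv M (\<Pi>\<^sub>M i\<in>{1..}. borel) (\<lambda>\<omega>. \<lambda>i\<in>{1..}. length_ratio (P \<omega>) i)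
                 borel (\<lambda>\<omega>. hull_W (P \<omega>) 1) \<and>
      prob_space.indep_var M
        (\<Pi>\<^sub>M i\<in>{1..}. borel) (\<lambda>\<omega>. \<lambda>i\<in>{1..}. length_ratio (P \<omega>) i)
        (\<Pi>\<^sub>M i\<in>UNIV. borel) (\<lambda>\<omega> i. triangle_area (P \<omega>) i))"
proof -
  interpret poisson_process M "restrict_space lborel quadrant" P by fact
  interpret quadrant_poisson M P ..
  have "distributed M lborel (\<lambda>\<omega>. triangle_area (P \<omega>) i) (exponential_density 1)" for i
    using corner_area_exponential area_Suc_exponential by (cases i) auto
  moreover have "distr M borel (\<lambda>\<omega>. length_ratio (P \<omega>) i) = uniform_measure lborel {0<..<1}" if "i \<ge> 1" for i
    using distr_length_ratio[of "i - 1"] that by simp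
  ultimately show ?thesis
    using indep_areas indep_ratios indep_ratios_W indep_ratios_areas by blast
qed

end
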